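(* Let $\tau$ be in the limit circle case at both $a$ and $b$, with boundary condition bases $\{\phi_a,\psi_a\}$ at $a$ and $\{\phi_b,\psi_b\}$ at $b$, and let $T_{\alpha,\beta}$ and $u_{z,1},u_{z,2}$ be as in the context. If $\alpha,\beta\in(0,\pi)$, then $T_{0,0}$ and $T_{\alpha,\beta}$ are relatively prime with respect to $T_{\min}$. Moreover, for each $z\in\rho(T_{0,0})\cap\rho(T_{\alpha,\beta})$ the matrix $$K_{\alpha,\beta}(z)=\begin{pmatrix}\cot(\beta)+[u_{z,1},\psi_b](b) & -[u_{z,1},\psi_a](a)\\ [u_{z,2},\psi_b](b) & -\cot(\alpha)-[u_{z,2},\psi_a](a)\end{pmatrix}$$ is invertible and $$(T_{\alpha,\beta}-zI)^{-1}=(T_{0,0}-zI)^{-1}-\sum_{j,k=1}^2\big[K_{\alpha,\beta}(z)^{-1}\big]_{j,k}\,\langle u_{\overline z,j},\,\cdot\,\rangle\,u_{z,k}.$$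
   Context: Setting. Let $-\infty\le a<b\le\infty$ and let $p,q,r$ be real-valued Lebesgue measurable functions on $(a,b)$ with $p>0$, $r>0$ a.e. and $p^{-1},q,r\in L^1_{\mathrm{loc}}((a,b);dx)$. Let $\mathfrak D(a,b)$ be the set of $f\in AC_{\mathrm{loc}}(a,b)$ (complex-valued) with $pf'\in AC_{\mathrm{loc}}(a,b)$, and $\tau f=\frac1r[-(pf')'+qf]$ for $f\in\mathfrak D(a,b)$. The Lagrange bracket is $[f,g](x)=f(x)\overline{(pg')(x)}-(pf')(x)\overline{g(x)}$ for $f,g\in\mathfrak D(a,b)$. $I$ and $\langle\cdot,\cdot\rangle$ (linear in the second argument) are the identity and inner product of $L^2((a,b);r(x)\,dx)$. The maximal operator is $T_{\max}f=\tau f$ with $\operatorname{dom}(T_{\max})=\{g\in\mathfrak D(a,b): g,\tau g\in L^2((a,b);r\,dx)\}$; it is densely defined, and the minimal operator is $T_{\min}:=(T_{\max})^*$, which is closed, symmetric, densely defined, with $(T_{\min})^*=T_{\max}$. For $f,g\in\operatorname{dom}(T_{\max})$ the limits $[f,g](a)=\lim_{x\downarrow a}[f,g](x)$ and $[f,g](b)=\lim_{x\uparrow b}[f,g](x)$ exist and are finite. $\tau$ is in the limit circle case at an endpoint if for each $z\in\mathbb C$ all solutions $y\in\mathfrak D(a,b)$ of $\tau y=zy$ are square integrable w.r.t. $r\,dx$ near that endpoint. A boundary condition basis at $c\in\{a,b\}$ is a pair of real-valued functions $\phi,\psi\in\operatorname{dom}(T_{\max})$ with $[\psi,\phi](c)=1$.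 For $\alpha,\beta\in[0,\pi)$, $T_{\alpha,\beta}$ is the restriction of $T_{\max}$ to the set of $g\in\operatorname{dom}(T_{\max})$ with $$\cos(\alpha)[g,\phi_a](a)+\sin(\alpha)[g,\psi_a](a)=0,\qquad \cos(\beta)[g,\phi_b](b)+\sin(\beta)[g,\psi_b](b)=0;$$ it is known to be a self-adjoint extension of $T_{\min}$. For $z\in\rho(T_{0,0})$, $u_{z,1},u_{z,2}$ are the solutions of $\tau u=zu$ satisfying $$[u_{z,1},\phi_a](a)=0,\ [u_{z,1},\phi_b](b)=1,\qquad [u_{z,2},\phi_a](a)=1,\ [u_{z,2},\phi_b](b)=0.$$ For self-adjoint extensions $T,T'$ of a symmetric operator $S$, the maximal common part $C_{T,T'}$ is the restriction of $T$ to $\{f\in\operatorname{dom}(T)\cap\operatorname{dom}(T'): Tf=T'f\}$; $T$ and $T'$ are relatively prime with respect to $S$ if $C_{T,T'}=S$. *)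

theory Defs
  imports "HOL-Analysis.Analysis"
begin

section \<open>The Hilbert space of square integrable functions of a measure\<close>

text \<open>
  Elements of $L^2(M)$ are genuine equivalence classes modulo equality almost everywhere, represented
  as sets of functions. The vector space operations and the inner product act on classes
  through arbitrarily chosen representatives.
\<close>

definition square_integrable :: "'a measure \<Rightarrow> ('a \<Rightarrow> complex) set" where
  "square_integrable M = {f \<in> borel_measurable M. integrable M (\<lambda>x. (norm (f x))\<^sup>2)}"

definition L2_class :: "'a measure \<Rightarrow> ('a \<Rightarrow> complex) \<Rightarrow> ('a \<Rightarrow> complex) set" where
  "L2_class M f = {g \<in> square_integrable M. AE x in M. g x = f x}"

definition L2 :: "'a measure \<Rightarrow> ('a \<Rightarrow> complex) set set" where
  "L2 M = L2_class M ` square_integrable M"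

definition L2_rep :: "('a \<Rightarrow> complex) set \<Rightarrow> 'a \<Rightarrow> complex" where
  "L2_rep F = (SOME f. f \<in> F)"

definition L2_diff ::
    "'a measure \<Rightarrow> ('a \<Rightarrow> complex) set \<Rightarrow> ('a \<Rightarrow> complex) set \<Rightarrow> ('a \<Rightarrow> complex) set" where
  "L2_diff M F G = L2_class M (\<lambda>x. L2_rep F x - L2_rep G x)"

definition L2_scale :: "'a measure \<Rightarrow> complex \<Rightarrow> ('a \<Rightarrow> complex) set \<Rightarrow> ('a \<Rightarrow> complex) set" where
  "L2_scale M c F = L2_class M (\<lambda>x. c * L2_rep F x)"

text \<open>Linear in the second argument.\<close>

definition L2_inner :: "'a measure \<Rightarrow> ('a \<Rightarrow> complex) set \<Rightarrow> ('a \<Rightarrow> complex) set \<Rightarrow> complex" where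
  "L2_inner M F G = (LINT x|M. cnj (L2_rep F x) * L2_rep G x)"

definition L2_norm :: "'a measure \<Rightarrow> ('a \<Rightarrow> complex) set \<Rightarrow> real" where
  "L2_norm M F = sqrt (LINT x|M. (norm (L2_rep F x))\<^sup>2)"


section \<open>Unbounded operators\<close>

text \<open>An operator \<open>T\<close> in $L^2(M)$ is represented by its graph; its domain is \<open>Domain T\<close>.\<close>

type_synonym 'a L2_operator = "(('a \<Rightarrow> complex) set \<times> ('a \<Rightarrow> complex) set) set"

text \<open>\<open>U\<close> is in the domain of the adjoint, with image \<open>V\<close>, iff $\langle U, TF\rangle = \langle V, F\rangle$
  for all \<open>F\<close> in the domain of \<open>T\<close>.\<close>

definition adjoint_op :: "'a measure \<Rightarrow> 'a L2_operator \<Rightarrow> 'a L2_operator" where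
  "adjoint_op M T = {(U, V). U \<in> L2 M \<and> V \<in> L2 M \<and>
     (\<forall>(F, G) \<in> T. L2_inner M U G = L2_inner M V F)}"

text \<open>The operator \<open>T - z I\<close>.\<close>

definition shift_op :: "'a measure \<Rightarrow> 'a L2_operator \<Rightarrow> complex \<Rightarrow> 'a L2_operator" where
  "shift_op M T z = {(F, L2_diff M G (L2_scale M z F)) |F G. (F, G) \<in> T}"

text \<open>\<open>T - z I\<close> is a bijection from its domain onto the whole space, with bounded inverse.\<close>

definition resolvent_set :: "'a measure \<Rightarrow> 'a L2_operator \<Rightarrow> complex set" where
  "resolvent_set M T = {z.
     (\<forall>G \<in> L2 M. \<exists>!F. (F, G) \<in> shift_op M T z) \<and>
     (\<exists>C. \<forall>(F, G) \<in> shift_op M T z. L2_norm M F \<le> C * L2_norm M G)}"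

definition resolvent ::
    "'a measure \<Rightarrow> 'a L2_operator \<Rightarrow> complex \<Rightarrow> ('a \<Rightarrow> complex) set \<Rightarrow> ('a \<Rightarrow> complex) set" where
  "resolvent M T z G = (THE F. (F, G) \<in> shift_op M T z)"

text \<open>The restriction of \<open>T\<close> to those \<open>F\<close> in both domains on which \<open>T\<close> and \<open>T'\<close> coincide;
  its graph is the intersection of the two graphs.\<close>

definition max_common_part :: "'a L2_operator \<Rightarrow> 'a L2_operator \<Rightarrow> 'a L2_operator" where
  "max_common_part T T' = {(F, G). (F, G) \<in> T \<and> (F, G) \<in> T'}"

definition relatively_prime :: "'a L2_operator \<Rightarrow> 'a L2_operator \<Rightarrow> 'a L2_operator \<Rightarrow> bool" where
  "relatively_prime S T T' \<longleftrightarrow> max_common_part T T' = S"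


section \<open>Absolute continuity\<close>

definition absolutely_continuous_on_interval :: "real \<Rightarrow> real \<Rightarrow> (real \<Rightarrow> complex) \<Rightarrow> bool" where
  "absolutely_continuous_on_interval c d f \<longleftrightarrow>
     (\<forall>\<epsilon>>0. \<exists>\<delta>>0. \<forall>P. finite P \<and>
        (\<forall>(s, t) \<in> P. c \<le> s \<and> s \<le> t \<and> t \<le> d) \<and>
        disjoint_family_on (\<lambda>(s, t). {s<..<t}) P \<and>
        (\<Sum>(s, t) \<in> P. t - s) < \<delta> \<longrightarrow>
        (\<Sum>(s, t) \<in> P. norm (f t - f s)) < \<epsilon>)"

definition AC_loc :: "real set \<Rightarrow> (real \<Rightarrow> complex) set" where
  "AC_loc I = {f. \<forall>c d. c < d \<and> {c..d} \<subseteq> I \<longrightarrow> absolutely_continuous_on_interval c d f}"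


section \<open>Sturm--Liouville differential expressions\<close>

text \<open>The data of $\tau f = \frac{1}{r}(-(pf')' + qf)$ on the interval \<open>(lower_end, upper_end)\<close>.\<close>

record sl_expr =
  lower_end :: ereal
  upper_end :: ereal
  coeff_p :: "real \<Rightarrow> real"
  coeff_q :: "real \<Rightarrow> real"
  coeff_r :: "real \<Rightarrow> real"

definition sl_dom :: "sl_expr \<Rightarrow> real set" where
  "sl_dom \<tau> = {x. lower_end \<tau> < ereal x \<and> ereal x < upper_end \<tau>}"

definition L1_loc :: "real set \<Rightarrow> (real \<Rightarrow> real) set" where
  "L1_loc I = {f. \<forall>c d. {c..d} \<subseteq> I \<longrightarrow> f absolutely_integrable_on {c..d}}"

definition sturm_liouville :: "sl_expr \<Rightarrow> bool" where
  "sturm_liouville \<tau> \<longleftrightarrow>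
     lower_end \<tau> < upper_end \<tau> \<and>
     coeff_p \<tau> \<in> borel_measurable (lebesgue_on (sl_dom \<tau>)) \<and>
     coeff_q \<tau> \<in> borel_measurable (lebesgue_on (sl_dom \<tau>)) \<and>
     coeff_r \<tau> \<in> borel_measurable (lebesgue_on (sl_dom \<tau>)) \<and>
     (AE x in lebesgue_on (sl_dom \<tau>). coeff_p \<tau> x > 0) \<and>
     (AE x in lebesgue_on (sl_dom \<tau>). coeff_r \<tau> x > 0) \<and>
     (\<lambda>x. 1 / coeff_p \<tau> x) \<in> L1_loc (sl_dom \<tau>) \<and>
     coeff_q \<tau> \<in> L1_loc (sl_dom \<tau>) \<and>
     coeff_r \<tau> \<in> L1_loc (sl_dom \<tau>)"

text \<open>The measure \<open>r(x) dx\<close> on the interval.\<close>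

definition weight :: "sl_expr \<Rightarrow> real measure" where
  "weight \<tau> = density (lebesgue_on (sl_dom \<tau>)) (\<lambda>x. ennreal (coeff_r \<tau> x))"

text \<open>
  The product $pf'$ is only defined almost everywhere; that it is locally absolutely continuous means
  that it has a locally absolutely continuous representative, which is then unique on the interval.
  \<open>quasi_deriv \<tau> f\<close> is this representative.
\<close>

definition is_quasi_deriv :: "sl_expr \<Rightarrow> (real \<Rightarrow> complex) \<Rightarrow> (real \<Rightarrow> complex) \<Rightarrow> bool" where
  "is_quasi_deriv \<tau> f h \<longleftrightarrow> h \<in> AC_loc (sl_dom \<tau>) \<and>
     (AE x in lebesgue_on (sl_dom \<tau>).
        h x = complex_of_real (coeff_p \<tau> x) * vector_derivative f (at x))"

definition quasi_deriv :: "sl_expr \<Rightarrow> (real \<Rightarrow> complex) \<Rightarrow> real \<Rightarrow> complex" where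
  "quasi_deriv \<tau> f = (SOME h. is_quasi_deriv \<tau> f h)"

definition frakD :: "sl_expr \<Rightarrow> (real \<Rightarrow> complex) set" where
  "frakD \<tau> = {f \<in> AC_loc (sl_dom \<tau>). \<exists>h. is_quasi_deriv \<tau> f h}"

definition sl_apply :: "sl_expr \<Rightarrow> (real \<Rightarrow> complex) \<Rightarrow> real \<Rightarrow> complex" where
  "sl_apply \<tau> f = (\<lambda>x. 1 / complex_of_real (coeff_r \<tau> x) *
     (- vector_derivative (quasi_deriv \<tau> f) (at x) + complex_of_real (coeff_q \<tau> x) * f x))"

definition sl_solution :: "sl_expr \<Rightarrow> complex \<Rightarrow> (real \<Rightarrow> complex) \<Rightarrow> bool" where
  "sl_solution \<tau> z y \<longleftrightarrow>
     y \<in> frakD \<tau> \<and> (AE x in lebesgue_on (sl_dom \<tau>). sl_apply \<tau> y x = z * y x)"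

definition bracket :: "sl_expr \<Rightarrow> (real \<Rightarrow> complex) \<Rightarrow> (real \<Rightarrow> complex) \<Rightarrow> real \<Rightarrow> complex" where
  "bracket \<tau> f g x = f x * cnj (quasi_deriv \<tau> g x) - quasi_deriv \<tau> f x * cnj (g x)"

text \<open>The boundary values $[f,g](a)$ and $[f,g](b)$. The one-sided limits are taken in the extended reals,
  which also covers infinite endpoints. They exist for \<open>f\<close>, \<open>g\<close> in the domain of the maximal
  operator; \<open>Lim\<close> is unspecified otherwise.\<close>

definition bracket_lower :: "sl_expr \<Rightarrow> (real \<Rightarrow> complex) \<Rightarrow> (real \<Rightarrow> complex) \<Rightarrow> complex" where
  "bracket_lower \<tau> f g = Lim (at_right (lower_end \<tau>)) (bracket \<tau> f g \<circ> real_of_ereal)"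

definition bracket_upper :: "sl_expr \<Rightarrow> (real \<Rightarrow> complex) \<Rightarrow> (real \<Rightarrow> complex) \<Rightarrow> complex" where
  "bracket_upper \<tau> f g = Lim (at_left (upper_end \<tau>)) (bracket \<tau> f g \<circ> real_of_ereal)"

definition limit_circle_lower :: "sl_expr \<Rightarrow> bool" where
  "limit_circle_lower \<tau> \<longleftrightarrow> (\<forall>z y. sl_solution \<tau> z y \<longrightarrow>
     (\<exists>c \<in> sl_dom \<tau>. set_integrable (weight \<tau>) {..<c} (\<lambda>x. (norm (y x))\<^sup>2)))"

definition limit_circle_upper :: "sl_expr \<Rightarrow> bool" where
  "limit_circle_upper \<tau> \<longleftrightarrow> (\<forall>z y. sl_solution \<tau> z y \<longrightarrow>
     (\<exists>c \<in> sl_dom \<tau>. set_integrable (weight \<tau>) {c<..} (\<lambda>x. (norm (y x))\<^sup>2)))"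


section \<open>The associated operators\<close>

text \<open>
  The domain of the maximal operator, as a set of functions: an equivalence class contains at most
  one function of \<open>frakD \<tau>\<close>, up to its irrelevant values outside the interval.
\<close>

definition dom_max :: "sl_expr \<Rightarrow> (real \<Rightarrow> complex) set" where
  "dom_max \<tau> = {g \<in> frakD \<tau>. g \<in> square_integrable (weight \<tau>) \<and>
     sl_apply \<tau> g \<in> square_integrable (weight \<tau>)}"

definition T_max :: "sl_expr \<Rightarrow> real L2_operator" where
  "T_max \<tau> = {(L2_class (weight \<tau>) g, L2_class (weight \<tau>) (sl_apply \<tau> g)) |g. g \<in> dom_max \<tau>}"

definition T_min :: "sl_expr \<Rightarrow> real L2_operator" where
  "T_min \<tau> = adjoint_op (weight \<tau>) (T_max \<tau>)"

definition real_valued_on :: "real set \<Rightarrow> (real \<Rightarrow> complex) \<Rightarrow> bool" where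
  "real_valued_on I f \<longleftrightarrow> (\<forall>x \<in> I. f x \<in> \<real>)"

definition bc_basis_lower :: "sl_expr \<Rightarrow> (real \<Rightarrow> complex) \<Rightarrow> (real \<Rightarrow> complex) \<Rightarrow> bool" where
  "bc_basis_lower \<tau> \<phi> \<psi> \<longleftrightarrow> \<phi> \<in> dom_max \<tau> \<and> \<psi> \<in> dom_max \<tau> \<and>
     real_valued_on (sl_dom \<tau>) \<phi> \<and> real_valued_on (sl_dom \<tau>) \<psi> \<and> bracket_lower \<tau> \<psi> \<phi> = 1"

definition bc_basis_upper :: "sl_expr \<Rightarrow> (real \<Rightarrow> complex) \<Rightarrow> (real \<Rightarrow> complex) \<Rightarrow> bool" where
  "bc_basis_upper \<tau> \<phi> \<psi> \<longleftrightarrow> \<phi> \<in> dom_max \<tau> \<and> \<psi> \<in> dom_max \<tau> \<and>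
     real_valued_on (sl_dom \<tau>) \<phi> \<and> real_valued_on (sl_dom \<tau>) \<psi> \<and> bracket_upper \<tau> \<psi> \<phi> = 1"

definition T_sep :: "sl_expr \<Rightarrow> (real \<Rightarrow> complex) \<Rightarrow> (real \<Rightarrow> complex) \<Rightarrow>
    (real \<Rightarrow> complex) \<Rightarrow> (real \<Rightarrow> complex) \<Rightarrow> real \<Rightarrow> real \<Rightarrow> real L2_operator" where
  "T_sep \<tau> \<phi>a \<psi>a \<phi>b \<psi>b \<alpha> \<beta> =
     {(L2_class (weight \<tau>) g, L2_class (weight \<tau>) (sl_apply \<tau> g)) |g. g \<in> dom_max \<tau> \<and>
        of_real (cos \<alpha>) * bracket_lower \<tau> g \<phi>a + of_real (sin \<alpha>) * bracket_lower \<tau> g \<psi>a = 0 \<and>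
        of_real (cos \<beta>) * bracket_upper \<tau> g \<phi>b + of_real (sin \<beta>) * bracket_upper \<tau> g \<psi>b = 0}"

text \<open>
  The solutions $u_{z,1}$ and $u_{z,2}$; for \<open>z\<close> in the resolvent set of $T_{0,0}$ they exist and
  are unique on the interval.
\<close>

definition sol_u :: "sl_expr \<Rightarrow> (real \<Rightarrow> complex) \<Rightarrow> (real \<Rightarrow> complex) \<Rightarrow>
    complex \<Rightarrow> 2 \<Rightarrow> real \<Rightarrow> complex" where
  "sol_u \<tau> \<phi>a \<phi>b z j = (SOME u. sl_solution \<tau> z u \<and>
     (if j = 1 then bracket_lower \<tau> u \<phi>a = 0 \<and> bracket_upper \<tau> u \<phi>b = 1
      else bracket_lower \<tau> u \<phi>a = 1 \<and> bracket_upper \<tau> u \<phi>b = 0))"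

definition K_matrix :: "sl_expr \<Rightarrow> (real \<Rightarrow> complex) \<Rightarrow> (real \<Rightarrow> complex) \<Rightarrow>
    (real \<Rightarrow> complex) \<Rightarrow> (real \<Rightarrow> complex) \<Rightarrow> real \<Rightarrow> real \<Rightarrow> complex \<Rightarrow> complex ^ 2 ^ 2" where
  "K_matrix \<tau> \<phi>a \<psi>a \<phi>b \<psi>b \<alpha> \<beta> z =
    (let u = sol_u \<tau> \<phi>a \<phi>b z in
     vector
      [vector [of_real (cot \<beta>) + bracket_upper \<tau> (u 1) \<psi>b, - bracket_lower \<tau> (u 1) \<psi>a],
       vector [bracket_upper \<tau> (u 2) \<psi>b, - of_real (cot \<alpha>) - bracket_lower \<tau> (u 2) \<psi>a]])"

end

theory Submission
  imports Defs
begin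

text \<open>
  Notation: $[f,g]$ is the Lagrange bracket, $F$ is a right-hand side in $L^2$ and
  $c_j = \langle u_{\overline z,j}, F\rangle$.
  
  The resolvent formula is linear algebra with boundary values. Both operators restrict the maximal one,
  so $(T_{\alpha,\beta}-z)^{-1}F$ differs from $f_0 = (T_{0,0}-z)^{-1}F$ by a solution of $\tau u = zu$,
  that is, by a combination $d_1 u_{z,1} + d_2 u_{z,2}$. Green's formula for $f_0$ and $u_{\overline z,j}$
  turns $c_j$ into boundary brackets, and at each endpoint the Pluecker identity
  $[f,g] = [f,\psi]\overline{[g,\phi]} - [f,\phi]\overline{[g,\psi]}$ reduces these to
  $c_1 = [f_0,\psi_b](b)$ and $c_2 = -[f_0,\psi_a](a)$. The boundary conditions of $T_{\alpha,\beta}$,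
  divided by $\sin\beta$ and $\sin\alpha$, now read $K^T d = -c$. A vector in the kernel of $K^T$ would
  make $d_1 u_{z,1} + d_2 u_{z,2}$ an eigenfunction of $T_{\alpha,\beta}$ for the eigenvalue $z$, hence $K$ is
  invertible (\<open>krein_formula\<close>).
  
  For relative primeness, a function in both domains has all four boundary values equal to zero; by the
  Pluecker identity and Green's formula it lies in the domain of $(T_{\max})^* = T_{\min}$. Conversely, let
  $(U,V)$ be in the graph of $(T_{\max})^*$ (\<open>adjoint_of_maximal\<close>). In the limit circle case at both ends all solutions of
  $\tau u = 0$ are square integrable on the whole interval, so variation of parameters solves
  $\tau g = h$ in $L^2$ for every $h \in L^2$, with vanishing boundary values at $a$ and boundary values
  at $b$ given by the integrals of $h$ against the solutions (\<open>variation_of_parameters\<close>). Testing the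
  adjoint relation against all these $g$ shows first that $U$ is such a solution for $h = V$ plus a solution of
  $\tau u = 0$, and then that all boundary values of $U$ vanish.
  
  The domains are defined by absolute continuity and derivatives almost everywhere. The link to integrals is
  Lebesgue's fundamental theorem of calculus: the locally absolutely continuous functions are exactly the
  primitives of locally integrable functions, and the density is the derivative almost everywhere
  (\<open>AC_loc_ac_primitive\<close>, \<open>ac_primitive_has_derivative\<close>, \<open>ac_primitive_AC_loc\<close>). In this form $\tau f = w$
  is a first-order system for $f$ and $pf'$ (\<open>sl_pair\<close>), the Lagrange identity is the product rule, and
  solutions exist by Picard iteration (\<open>linear_system_solution_exists\<close>).
\<close>

section \<open>Differentiation of indefinite integrals\<close>

text \<open>
  Right averages converge almost everywhere by \<open>integrable_ccontinuous_explicit\<close>; left averages are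
  right averages of the reflected function.
\<close>

lemma one_sided_averages_converge_ae:
  fixes f :: "real \<Rightarrow> 'a::euclidean_space"
  assumes f: "\<And>a b. f integrable_on {a..b}"
  obtains N where "negligible N"
    "\<And>x e. x \<notin> N \<Longrightarrow> 0 < e \<Longrightarrow>
       \<exists>d>0. \<forall>h. 0 < h \<and> h < d \<longrightarrow> norm (integral {x..x + h} f /\<^sub>R h - f x) < e
                               \<and> norm (integral {x - h..x} f /\<^sub>R h - f x) < e"
proof -
  have f1: "f integrable_on cbox a b" for a b using f by (simp add: box_real)
  obtain N1 where N1: "negligible N1"
    "\<And>x e. \<lbrakk>x \<notin> N1; 0 < e\<rbrakk> \<Longrightarrow> \<exists>d>0. \<forall>h. 0 < h \<and> h < d \<longrightarrow>
       norm(integral (cbox x (x + h *\<^sub>R One)) f /\<^sub>R h ^ DIM(real) - f x) < e"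
    using integrable_ccontinuous_explicit[OF f1] by blast
  have f2: "(\<lambda>x. f (- x)) integrable_on cbox a b" for a b
    using integrable_reflect[where f = f and a = "-b" and b = "-a"] f1 by simp
  obtain N2 where N2: "negligible N2"
    "\<And>x e. \<lbrakk>x \<notin> N2; 0 < e\<rbrakk> \<Longrightarrow> \<exists>d>0. \<forall>h. 0 < h \<and> h < d \<longrightarrow>
       norm(integral (cbox x (x + h *\<^sub>R One)) (\<lambda>x. f (-x)) /\<^sub>R h ^ DIM(real) - f (-x)) < e"
    using integrable_ccontinuous_explicit[OF f2] by blast
  have "negligible (uminus ` N2)"
    using N2(1) by (intro negligible_differentiable_image_negligible) (auto simp: differentiable_on_def)
  then have "negligible (N1 \<union> uminus ` N2)" using N1(1) by (simp only: negligible_Un)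
  then show ?thesis
  proof (rule that)
    fix x e :: real assume x: "x \<notin> N1 \<union> uminus ` N2" and e: "0 < e"
    obtain d1 where d1: "d1 > 0" "\<And>h. 0 < h \<Longrightarrow> h < d1 \<Longrightarrow> norm (integral {x..x + h} f /\<^sub>R h - f x) < e"
      using N1(2)[of x e] x e by (auto simp: box_real)
    have "- x \<notin> N2" using x by force
    then obtain d2 where d2: "d2 > 0" "\<And>h. 0 < h \<Longrightarrow> h < d2 \<Longrightarrow> norm (integral {-x..-x + h} (\<lambda>x. f (-x)) /\<^sub>R h - f x) < e"
      using N2(2)[of "-x" e] e by (auto simp: box_real)
    have *: "integral {-x..-x + h} (\<lambda>x. f (-x)) = integral {x - h..x} f" for h
      using integral_reflect[where f = f and a = "x - h" and b = x] by simp
    show "\<exists>d>0. \<forall>h. 0 < h \<and> h < d \<longrightarrow> norm (integral {x..x + h} f /\<^sub>R h - f x) < e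
                               \<and> norm (integral {x - h..x} f /\<^sub>R h - f x) < e"
      using d1 d2 unfolding * by (intro exI[of _ "min d1 d2"]) auto
  qed
qed

lemma primitive_differentiable_ae:
  fixes f F :: "real \<Rightarrow> 'a::euclidean_space"
  assumes f: "\<And>a b. f integrable_on {a..b}"
    and F: "\<And>a b. a \<le> b \<Longrightarrow> integral {a..b} f = F b - F a"
  obtains N where "negligible N" "\<And>x. x \<notin> N \<Longrightarrow> (F has_vector_derivative f x) (at x)"
proof -
  obtain N where N: "negligible N"
    "\<And>x e. x \<notin> N \<Longrightarrow> 0 < e \<Longrightarrow>
       \<exists>d>0. \<forall>h. 0 < h \<and> h < d \<longrightarrow> norm (integral {x..x + h} f /\<^sub>R h - f x) < e
                               \<and> norm (integral {x - h..x} f /\<^sub>R h - f x) < e"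
    using one_sided_averages_converge_ae[OF f] by blast
  from N(1) show ?thesis
  proof (rule that)
    fix x assume x: "x \<notin> N"
    have "((\<lambda>y. norm (F y - F x - (y - x) *\<^sub>R f x) / norm (y - x)) \<longlongrightarrow> 0) (at x)"
    proof (rule tendstoI)
      fix e :: real assume "e > 0"
      from N(2)[OF x this] obtain d where d: "d > 0"
        "\<forall>h. 0 < h \<and> h < d \<longrightarrow> norm (integral {x..x + h} f /\<^sub>R h - f x) < e
            \<and> norm (integral {x - h..x} f /\<^sub>R h - f x) < e"
        by (elim exE conjE)
      have "norm (F y - F x - (y - x) *\<^sub>R f x) / norm (y - x) < e" if "y \<noteq> x" "dist y x < d" for y
      proof (cases "y > x")
        case True
        have "norm (integral {x..y} f /\<^sub>R (y - x) - f x) < e"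
          using d(2)[rule_format, of "y - x"] True that by (auto simp: dist_real_def)
        moreover have "integral {x..y} f /\<^sub>R (y - x) - f x = (F y - F x - (y - x) *\<^sub>R f x) /\<^sub>R (y - x)"
          using True F[of x y] by (simp add: scaleR_diff_right)
        ultimately show ?thesis using True by (simp add: divide_inverse mult.commute)
      next
        case False
        then have yx: "y < x" using that by auto
        have "norm (integral {y..x} f /\<^sub>R (x - y) - f x) < e"
          using d(2)[rule_format, of "x - y"] yx that by (auto simp: dist_real_def)
        moreover have "integral {y..x} f /\<^sub>R (x - y) - f x = - ((F y - F x - (y - x) *\<^sub>R f x) /\<^sub>R (x - y))"
        proof -
          have "(y - x) *\<^sub>R f x = - ((x - y) *\<^sub>R f x)" by (simp flip: scaleR_minus_left)
          then show ?thesis using yx F[of y x] by (simp add: scaleR_diff_right scaleR_add_right)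
        qed
        ultimately show ?thesis using yx by (simp add: divide_inverse mult.commute)
      qed
      then show "\<forall>\<^sub>F y in at x. dist (norm (F y - F x - (y - x) *\<^sub>R f x) / norm (y - x)) 0 < e"
        unfolding eventually_at using d(1) by (intro exI[of _ d]) auto
    qed
    then show "(F has_vector_derivative f x) (at x)"
      unfolding has_vector_derivative_def has_derivative_iff_norm
      by (simp add: bounded_linear_scaleR_left)
  qed
qed

section \<open>Variation of absolutely continuous functions\<close>

text \<open>
  An interval is represented by the pair of its end points. Degenerate pairs are excluded: then distinct
  pairs are distinct nonempty open intervals, and a union of families over disjoint regions is a disjoint union.
\<close>

definition nonoverlapping :: "(real \<times> real) set \<Rightarrow> bool" where
  "nonoverlapping P \<longleftrightarrow> finite P \<and> (\<forall>(s, t) \<in> P. s < t) \<and>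
     (\<forall>(s, t) \<in> P. \<forall>(s', t') \<in> P. (s, t) \<noteq> (s', t') \<longrightarrow> t \<le> s' \<or> t' \<le> s)"

definition increments :: "(real \<Rightarrow> real) \<Rightarrow> (real \<times> real) set \<Rightarrow> real" where
  "increments f P = (\<Sum>(s, t) \<in> P. \<bar>f t - f s\<bar>)"

definition total_length :: "(real \<times> real) set \<Rightarrow> real" where
  "total_length P = (\<Sum>(s, t) \<in> P. t - s)"

text \<open>
  Absolute continuity on all of $\mathbb R$ with one $\delta$ for the whole line; functions on a compact
  interval are brought into this form by extending them constantly.
\<close>

definition AC_real :: "(real \<Rightarrow> real) \<Rightarrow> bool" where
  "AC_real f \<longleftrightarrow> (\<forall>\<epsilon>>0. \<exists>\<delta>>0. \<forall>P. nonoverlapping P \<and> total_length P < \<delta> \<longrightarrow> increments f P < \<epsilon>)"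

lemma nonoverlappingD:
  assumes "nonoverlapping P"
  shows "finite P" "\<And>s t. (s, t) \<in> P \<Longrightarrow> s < t"
    "\<And>s t s' t'. (s, t) \<in> P \<Longrightarrow> (s', t') \<in> P \<Longrightarrow> (s, t) \<noteq> (s', t') \<Longrightarrow> t \<le> s' \<or> t' \<le> s"
proof -
  show "finite P" using assms unfolding nonoverlapping_def by simp
  show "s < t" if "(s, t) \<in> P" for s t
  proof -
    have "\<forall>p\<in>P. case p of (s, t) \<Rightarrow> s < t" using assms unfolding nonoverlapping_def by simp
    from bspec[OF this that] show ?thesis by simp
  qed
  show "t \<le> s' \<or> t' \<le> s" if "(s, t) \<in> P" "(s', t') \<in> P" "(s, t) \<noteq> (s', t')" for s t s' t'
  proof -
    have "\<forall>p\<in>P. case p of (s, t) \<Rightarrow> \<forall>q\<in>P. case q of (s', t') \<Rightarrow> (s, t) \<noteq> (s', t') \<longrightarrow> t \<le> s' \<or> t' \<le> s"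
      using assms unfolding nonoverlapping_def by simp
    from bspec[OF this that(1)] have "\<forall>q\<in>P. case q of (s', t') \<Rightarrow> (s, t) \<noteq> (s', t') \<longrightarrow> t \<le> s' \<or> t' \<le> s" by simp
    from bspec[OF this that(2)] show ?thesis using that(3) by simp
  qed
qed

lemma nonoverlappingI:
  assumes "finite P" "\<And>s t. (s, t) \<in> P \<Longrightarrow> s < t"
    "\<And>s t s' t'. (s, t) \<in> P \<Longrightarrow> (s', t') \<in> P \<Longrightarrow> (s, t) \<noteq> (s', t') \<Longrightarrow> t \<le> s' \<or> t' \<le> s"
  shows "nonoverlapping P"
  unfolding nonoverlapping_def
proof (intro conjI ballI)
  fix p assume p: "p \<in> P"
  obtain s t where st: "p = (s, t)" by fastforce
  show "case p of (s, t) \<Rightarrow> s < t" using assms(2) p st by simp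
  show "case p of (s, t) \<Rightarrow> \<forall>(s', t')\<in>P. (s, t) \<noteq> (s', t') \<longrightarrow> t \<le> s' \<or> t' \<le> s"
    using assms(3) p st by auto
qed (rule assms(1))

text \<open>
  A monotone map sends nonoverlapping intervals to nonoverlapping intervals after the collapsed ones have been
  dropped, and these do not contribute to sums of increments. This serves to cut families at points.
\<close>

lemma nonoverlapping_image:
  assumes P: "nonoverlapping P" and m: "mono m"
  obtains Q where "nonoverlapping Q" "Q \<subseteq> (\<lambda>(s, t). (m s, m t)) ` P"
    "\<And>g. (\<And>s. g s s = 0) \<Longrightarrow> (\<Sum>(s, t) \<in> Q. g s t) = (\<Sum>(s, t) \<in> P. g (m s) (m t) :: real)"
proof -
  define P' where "P' = {(s, t) \<in> P. m s < m t}"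
  define mm where "mm = (\<lambda>(s, t). (m s, m t))"
  have fin: "finite P" "finite P'" "P' \<subseteq> P" using nonoverlappingD(1)[OF P] by (auto simp: P'_def intro: finite_subset)
  have sep: "m t \<le> m s' \<or> m t' \<le> m s" if "(s, t) \<in> P'" "(s', t') \<in> P'" "(s, t) \<noteq> (s', t')" for s t s' t'
  proof -
    have "t \<le> s' \<or> t' \<le> s" using nonoverlappingD(3)[OF P, of s t s' t'] that by (simp add: P'_def)
    then show ?thesis using m by (auto simp: mono_def)
  qed
  have inj: "inj_on mm P'"
  proof (rule inj_onI)
    fix x y assume "x \<in> P'" "y \<in> P'" "mm x = mm y"
    moreover obtain s t s' t' where "x = (s, t)" "y = (s', t')" by fastforce
    ultimately show "x = y" using sep[of s t s' t']
      by (auto simp: mm_def P'_def)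
  qed
  show ?thesis
  proof (rule that[of "mm ` P'"])
    show "nonoverlapping (mm ` P')"
    proof (rule nonoverlappingI)
      show "finite (mm ` P')" using fin by simp
      show "s < t" if "(s, t) \<in> mm ` P'" for s t using that by (auto simp: mm_def P'_def)
      show "t \<le> s' \<or> t' \<le> s" if st: "(s, t) \<in> mm ` P'" "(s', t') \<in> mm ` P'" "(s, t) \<noteq> (s', t')" for s t s' t'
      proof -
        obtain a b c d where "(a, b) \<in> P'" "(c, d) \<in> P'" "s = m a" "t = m b" "s' = m c" "t' = m d"
          using st(1,2) by (auto simp: mm_def)
        then show ?thesis using sep[of a b c d] st(3) by auto
      qed
    qed
    show "mm ` P' \<subseteq> (\<lambda>(s, t). (m s, m t)) ` P" using fin(3) by (auto simp: mm_def)
    fix g :: "real \<Rightarrow> real \<Rightarrow> real" assume g: "\<And>s. g s s = 0"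
    have "(\<Sum>(s, t) \<in> mm ` P'. g s t) = (\<Sum>(s, t) \<in> P'. g (m s) (m t))"
      by (subst sum.reindex[OF inj]) (auto simp: mm_def intro!: sum.cong)
    also have "\<dots> = (\<Sum>(s, t) \<in> P. g (m s) (m t))"
    proof (rule sum.mono_neutral_left[OF fin(1) fin(3)])
      have "g (m s) (m t) = 0" if "(s, t) \<in> P" "(s, t) \<notin> P'" for s t
      proof -
        have "s < t" using that nonoverlappingD(2)[OF P] by simp
        then have "m s = m t" using that m by (auto simp: P'_def mono_def intro: antisym dest: less_imp_le)
        then show ?thesis using g by simp
      qed
      then show "\<forall>i\<in>P - P'. (case i of (s, t) \<Rightarrow> g (m s) (m t)) = 0" by auto
    qed
    finally show "(\<Sum>(s, t) \<in> mm ` P'. g s t) = (\<Sum>(s, t) \<in> P. g (m s) (m t))" .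
  qed
qed

lemma nonoverlapping_disjoint_family:
  assumes "nonoverlapping P"
  shows "disjoint_family_on (\<lambda>(s, t). {s<..<t}) P"
  unfolding disjoint_family_on_def
proof (intro ballI impI)
  fix p q assume pq: "p \<in> P" "q \<in> P" "p \<noteq> q"
  obtain s t s' t' where st: "p = (s, t)" "q = (s', t')" by fastforce
  have "t \<le> s' \<or> t' \<le> s" using nonoverlappingD(3)[OF assms, of s t s' t'] pq st by simp
  then show "(case p of (s, t) \<Rightarrow> {s<..<t}) \<inter> (case q of (s, t) \<Rightarrow> {s<..<t}) = {}"
    using st by auto
qed

lemma total_length_le_measure:
  assumes P: "nonoverlapping P" and sub: "\<And>s t. (s, t) \<in> P \<Longrightarrow> {s<..<t} \<subseteq> U" and U: "U \<in> sets borel"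
  shows "ennreal (total_length P) \<le> emeasure lborel U"
proof -
  let ?J = "\<lambda>(s, t). {s<..<t :: real}"
  have lt: "s \<le> t" if "(s, t) \<in> P" for s t using nonoverlappingD(2)[OF P that] by simp
  have "ennreal (total_length P) = (\<Sum>(s, t) \<in> P. ennreal (t - s))"
    unfolding total_length_def using lt by (subst sum_ennreal[symmetric]) (auto simp: split_def)
  also have "\<dots> = (\<Sum>p\<in>P. emeasure lborel (?J p))"
    using lt by (intro sum.cong) (auto split: prod.splits)
  also have "\<dots> = emeasure lborel (\<Union>p\<in>P. ?J p)"
    by (rule sum_emeasure) (use nonoverlapping_disjoint_family[OF P] nonoverlappingD(1)[OF P] in auto)
  also have "\<dots> \<le> emeasure lborel U"
    using sub U by (intro emeasure_mono) fastforce+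
  finally show ?thesis .
qed

lemma total_length_le:
  assumes P: "nonoverlapping P" and sub: "\<And>s t. (s, t) \<in> P \<Longrightarrow> u \<le> s \<and> t \<le> v" and uv: "u \<le> v"
  shows "total_length P \<le> v - u"
proof -
  have "ennreal (total_length P) \<le> emeasure lborel {u..v}"
    by (rule total_length_le_measure[OF P]) (use sub in fastforce)+
  then show ?thesis using uv by (simp add: ennreal_le_iff)
qed

definition bounded_increments :: "(real \<Rightarrow> real) \<Rightarrow> bool" where
  "bounded_increments f \<longleftrightarrow> (\<exists>B. \<forall>P. nonoverlapping P \<longrightarrow> increments f P \<le> B)"

definition variation :: "(real \<Rightarrow> real) \<Rightarrow> real set \<Rightarrow> real" where
  "variation f A = Sup (increments f ` {P. nonoverlapping P \<and> (\<forall>(s, t) \<in> P. {s..t} \<subseteq> A)})"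

lemma nonoverlapping_empty: "nonoverlapping {}"
  by (simp add: nonoverlapping_def)

lemma increments_le_variation:
  assumes "bounded_increments f" "nonoverlapping P" "\<And>s t. (s, t) \<in> P \<Longrightarrow> {s..t} \<subseteq> A"
  shows "increments f P \<le> variation f A"
  unfolding variation_def
proof (rule cSUP_upper)
  show "bdd_above (increments f ` {P. nonoverlapping P \<and> (\<forall>(s, t) \<in> P. {s..t} \<subseteq> A)})"
    using assms(1) unfolding bounded_increments_def bdd_above_def by blast
  show "P \<in> {P. nonoverlapping P \<and> (\<forall>(s, t) \<in> P. {s..t} \<subseteq> A)}" using assms(2,3) by auto
qed

lemma variation_le:
  assumes "\<And>P. nonoverlapping P \<Longrightarrow> (\<And>s t. (s, t) \<in> P \<Longrightarrow> {s..t} \<subseteq> A) \<Longrightarrow> increments f P \<le> B"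
  shows "variation f A \<le> B"
  unfolding variation_def
proof (rule cSUP_least)
  show "{P. nonoverlapping P \<and> (\<forall>(s, t) \<in> P. {s..t} \<subseteq> A)} \<noteq> {}"
    using nonoverlapping_empty by (auto intro!: exI[of _ "{}"])
  show "increments f P \<le> B" if "P \<in> {P. nonoverlapping P \<and> (\<forall>(s, t) \<in> P. {s..t} \<subseteq> A)}" for P
    using that by (intro assms) auto
qed

lemma variation_approx:
  assumes "e > 0"
  obtains P where "nonoverlapping P" "\<And>s t. (s, t) \<in> P \<Longrightarrow> {s..t} \<subseteq> A" "variation f A - e < increments f P"
proof -
  have "\<not> (variation f A \<le> variation f A - e)" using assms by simp
  then show ?thesis using variation_le[of A f "variation f A - e"] that by (meson not_less)
qed

text \<open>
  The interval from $x$ to $y$ can be added to any family to the left of $x$. Hence both the variation and the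
  variation minus the function are increasing.
\<close>

lemma increment_le_variation_diff:
  assumes f: "bounded_increments f" and xy: "x < y"
  shows "\<bar>f y - f x\<bar> \<le> variation f {..y} - variation f {..x}"
proof -
  have "variation f {..x} \<le> variation f {..y} - \<bar>f y - f x\<bar>"
  proof (rule variation_le)
    fix P assume P: "nonoverlapping P" and sub: "\<And>s t. (s, t) \<in> P \<Longrightarrow> {s..t} \<subseteq> {..x}"
    have tx: "s < t \<and> t \<le> x" if "(s, t) \<in> P" for s t
      using sub[OF that] nonoverlappingD(2)[OF P that] by (auto simp: less_imp_le)
    have no: "nonoverlapping (insert (x, y) P)"
      using nonoverlappingD[OF P] tx xy by (intro nonoverlappingI) auto
    have "increments f (insert (x, y) P) \<le> variation f {..y}"
      by (rule increments_le_variation[OF f no]) (use tx xy in fastforce)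
    moreover have "(x, y) \<notin> P" using tx[of x y] xy by auto
    ultimately show "increments f P \<le> variation f {..y} - \<bar>f y - f x\<bar>"
      using nonoverlappingD(1)[OF P] by (simp add: increments_def)
  qed
  then show ?thesis by simp
qed

lemma increments_image:
  assumes P: "nonoverlapping P" and m: "mono m"
  obtains Q where "nonoverlapping Q" "Q \<subseteq> (\<lambda>(s, t). (m s, m t)) ` P"
    "\<And>g. increments g Q = (\<Sum>(s, t) \<in> P. \<bar>g (m t) - g (m s)\<bar>)"
    "total_length Q = (\<Sum>(s, t) \<in> P. m t - m s)"
proof -
  obtain Q where Q: "nonoverlapping Q" "Q \<subseteq> (\<lambda>(s, t). (m s, m t)) ` P"
    "\<And>g. (\<And>s. g s s = 0) \<Longrightarrow> (\<Sum>(s, t) \<in> Q. g s t) = (\<Sum>(s, t) \<in> P. g (m s) (m t) :: real)"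
    using nonoverlapping_image[OF P m] by blast
  show ?thesis
    by (rule that[OF Q(1,2)])
      (use Q(3)[of "\<lambda>s t. \<bar>g t - g s\<bar>" for g] Q(3)[of "\<lambda>s t. t - s"] in
        \<open>simp_all add: increments_def total_length_def\<close>)
qed

text \<open>
  Cutting every interval of a family at $x$, by means of the maps $\min(x,\cdot)$ and $\max(x,\cdot)$,
  splits it into a family to the left and a family to the right of $x$.
\<close>

lemma variation_diff_le:
  assumes f: "bounded_increments f" and xy: "x \<le> y"
  shows "variation f {..y} - variation f {..x} \<le> variation f {x..y}"
proof -
  have "variation f {..y} \<le> variation f {..x} + variation f {x..y}"
  proof (rule variation_le)
    fix P assume P: "nonoverlapping P" and sub: "\<And>s t. (s, t) \<in> P \<Longrightarrow> {s..t} \<subseteq> {..y}"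
    have ty: "s < t \<and> t \<le> y" if "(s, t) \<in> P" for s t
      using sub[OF that] nonoverlappingD(2)[OF P that] by (auto simp: less_imp_le)
    have mono1: "mono (min x)" and mono2: "mono (max x)" by (auto simp: mono_def)
    obtain Q1 where Q1: "nonoverlapping Q1" "Q1 \<subseteq> (\<lambda>(s, t). (min x s, min x t)) ` P"
      "\<And>g. increments g Q1 = (\<Sum>(s, t) \<in> P. \<bar>g (min x t) - g (min x s)\<bar>)"
      using increments_image[OF P mono1] by metis
    obtain Q2 where Q2: "nonoverlapping Q2" "Q2 \<subseteq> (\<lambda>(s, t). (max x s, max x t)) ` P"
      "\<And>g. increments g Q2 = (\<Sum>(s, t) \<in> P. \<bar>g (max x t) - g (max x s)\<bar>)"
      using increments_image[OF P mono2] by metis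
    have "increments f P \<le> increments f Q1 + increments f Q2"
      unfolding Q1(3) Q2(3) unfolding increments_def sum.distrib[symmetric]
    proof (rule sum_mono, clarify)
      fix s t assume "(s, t) \<in> P"
      then have "s < t" using nonoverlappingD(2)[OF P] by simp
      then consider "t \<le> x" | "x \<le> s" | "s < x" "x < t" by linarith
      then show "\<bar>f t - f s\<bar> \<le> \<bar>f (min x t) - f (min x s)\<bar> + \<bar>f (max x t) - f (max x s)\<bar>"
      proof cases
        case 1
        then have "min x t = t" "min x s = s" "max x t = x" "max x s = x" using \<open>s < t\<close> by auto
        then show ?thesis by simp
      next
        case 2
        then have "min x t = x" "min x s = x" "max x t = t" "max x s = s" using \<open>s < t\<close> by auto
        then show ?thesis by simp
      next
        case 3
        then have "min x t = x" "min x s = s" "max x t = t" "max x s = x" by auto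
        then show ?thesis using abs_triangle_ineq[of "f t - f x" "f x - f s"] by simp
      qed
    qed
    also have "increments f Q1 \<le> variation f {..x}"
      by (rule increments_le_variation[OF f Q1(1)]) (use Q1(2) in force)
    also have "increments f Q2 \<le> variation f {x..y}"
    proof (rule increments_le_variation[OF f Q2(1)])
      fix s t assume "(s, t) \<in> Q2"
      then obtain a b where "(a, b) \<in> P" "s = max x a" "t = max x b" using Q2(2) by auto
      then show "{s..t} \<subseteq> {x..y}" using ty[of a b] xy by auto
    qed
    finally show "increments f P \<le> variation f {..x} + variation f {x..y}" by simp
  qed
  then show ?thesis by simp
qed

text \<open>
  In each interval of a short family a subfamily is chosen that almost realizes the variation there. Together
  these subfamilies are again a short family, so their increments are small.
\<close>

lemma AC_real_variation:
  assumes f: "bounded_increments f" and ac: "AC_real f"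
  shows "AC_real (\<lambda>x. variation f {..x})"
  unfolding AC_real_def
proof (intro allI impI)
  fix e :: real assume e: "e > 0"
  then obtain d where d: "d > 0" "\<And>P. nonoverlapping P \<Longrightarrow> total_length P < d \<Longrightarrow> increments f P < e / 2"
    using ac unfolding AC_real_def by (metis half_gt_zero)
  have "increments (\<lambda>x. variation f {..x}) P < e" if P: "nonoverlapping P" and len: "total_length P < d" for P
  proof -
    \<comment> \<open>The error is spread over the intervals; one is added to the cardinality for the empty family.\<close>
    define k where "k = e / (2 * (card P + 1))"
    have k: "k > 0" using e by (simp add: k_def)
    have "\<exists>Q. nonoverlapping Q \<and> (\<forall>s t. (s, t) \<in> Q \<longrightarrow> {s..t} \<subseteq> {fst p..snd p}) \<and> variation f {fst p..snd p} - k < increments f Q" for p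
      using variation_approx[OF k, of "{fst p..snd p}" f] by metis
    then obtain Q where Q: "\<And>p. nonoverlapping (Q p)" "\<And>p s t. (s, t) \<in> Q p \<Longrightarrow> {s..t} \<subseteq> {fst p..snd p}"
      "\<And>p. variation f {fst p..snd p} - k < increments f (Q p)" by metis
    have Qin: "fst p \<le> s \<and> s < t \<and> t \<le> snd p" if "(s, t) \<in> Q p" for p s t
      using Q(2)[OF that] nonoverlappingD(2)[OF Q(1) that] by auto
    have disj: "t \<le> s' \<or> t' \<le> s" if "p \<in> P" "p' \<in> P" "p \<noteq> p'" "(s, t) \<in> Q p" "(s', t') \<in> Q p'" for p p' s t s' t'
      using nonoverlappingD(3)[OF P, of "fst p" "snd p" "fst p'" "snd p'"] that Qin[of s t p] Qin[of s' t' p']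
      by auto
    have nU: "nonoverlapping (\<Union>(Q ` P))"
    proof (rule nonoverlappingI)
      show "finite (\<Union>(Q ` P))" using nonoverlappingD(1)[OF P] nonoverlappingD(1)[OF Q(1)] by blast
      show "s < t" if "(s, t) \<in> \<Union>(Q ` P)" for s t using that Qin by blast
      show "t \<le> s' \<or> t' \<le> s" if st: "(s, t) \<in> \<Union>(Q ` P)" "(s', t') \<in> \<Union>(Q ` P)" "(s, t) \<noteq> (s', t')" for s t s' t'
      proof -
        obtain p p' where p: "p \<in> P" "p' \<in> P" "(s, t) \<in> Q p" "(s', t') \<in> Q p'" using st(1,2) by blast
        show ?thesis
          using disj[OF p(1,2) _ p(3,4)] nonoverlappingD(3)[OF Q(1) p(3), of s' t'] p st(3) by (cases "p = p'") auto
      qed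
    qed
    have dj: "\<forall>p\<in>P. \<forall>p'\<in>P. p \<noteq> p' \<longrightarrow> Q p \<inter> Q p' = {}"
    proof (intro ballI impI, rule ccontr)
      fix p p' assume *: "p \<in> P" "p' \<in> P" "p \<noteq> p'" "Q p \<inter> Q p' \<noteq> {}"
      then obtain s t where "(s, t) \<in> Q p" "(s, t) \<in> Q p'" by fast
      then show False using disj[OF *(1-3), of s t s t] Qin[of s t p] by auto
    qed
    have sumU: "(\<Sum>x\<in>\<Union>(Q ` P). g x) = (\<Sum>p\<in>P. \<Sum>x\<in>Q p. g x)" for g :: "real \<times> real \<Rightarrow> real"
      by (rule sum.UNION_disjoint) (use nonoverlappingD(1)[OF P] nonoverlappingD(1)[OF Q(1)] dj in auto)
    have "total_length (\<Union>(Q ` P)) = (\<Sum>p\<in>P. total_length (Q p))"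
      unfolding total_length_def by (rule sumU)
    also have "\<dots> \<le> total_length P"
      unfolding total_length_def[of P]
    proof (rule sum_mono)
      fix p assume "p \<in> P"
      then have "fst p \<le> snd p" using nonoverlappingD(2)[OF P, of "fst p" "snd p"] by simp
      then show "total_length (Q p) \<le> (case p of (s, t) \<Rightarrow> t - s)"
        using total_length_le[OF Q(1), of p "fst p" "snd p"] Qin by (force split: prod.splits)
    qed
    finally have "increments f (\<Union>(Q ` P)) < e / 2" using d(2)[OF nU] len by simp
    then have A: "(\<Sum>p\<in>P. increments f (Q p)) < e / 2" unfolding increments_def sumU .
    have "increments (\<lambda>x. variation f {..x}) P \<le> (\<Sum>p\<in>P. increments f (Q p) + k)"
      unfolding increments_def[of _ P]
    proof (rule sum_mono)
      fix p assume p: "p \<in> P"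
      then have lt: "fst p < snd p" using nonoverlappingD(2)[OF P, of "fst p" "snd p"] by simp
      have "\<bar>variation f {..snd p} - variation f {..fst p}\<bar> \<le> increments f (Q p) + k"
        using increment_le_variation_diff[OF f lt] variation_diff_le[OF f less_imp_le[OF lt]] Q(3)[of p] by linarith
      then show "(case p of (s, t) \<Rightarrow> \<bar>variation f {..t} - variation f {..s}\<bar>) \<le> increments f (Q p) + k"
        by (simp add: split_def)
    qed
    also have "\<dots> = (\<Sum>p\<in>P. increments f (Q p)) + card P * k" by (simp add: sum.distrib)
    also have "card P * k \<le> e / 2" using e by (simp add: k_def field_simps)
    finally show ?thesis using A by linarith
  qed
  then show "\<exists>d>0. \<forall>P. nonoverlapping P \<and> total_length P < d \<longrightarrow> increments (\<lambda>x. variation f {..x}) P < e"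
    using d(1) by blast
qed

lemma AC_real_diff:
  assumes "AC_real f" "AC_real g"
  shows "AC_real (\<lambda>x. f x - g x)"
  unfolding AC_real_def
proof (intro allI impI)
  fix e :: real assume e: "e > 0"
  then obtain d1 where d1: "d1 > 0" "\<And>P. nonoverlapping P \<Longrightarrow> total_length P < d1 \<Longrightarrow> increments f P < e / 2"
    using assms(1) unfolding AC_real_def by (metis half_gt_zero)
  obtain d2 where d2: "d2 > 0" "\<And>P. nonoverlapping P \<Longrightarrow> total_length P < d2 \<Longrightarrow> increments g P < e / 2"
    using assms(2) e unfolding AC_real_def by (metis half_gt_zero)
  have *: "increments (\<lambda>x. f x - g x) P \<le> increments f P + increments g P" for P
    unfolding increments_def sum.distrib[symmetric] by (rule sum_mono) (auto split: prod.splits)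
  show "\<exists>d>0. \<forall>P. nonoverlapping P \<and> total_length P < d \<longrightarrow> increments (\<lambda>x. f x - g x) P < e"
    using d1(1) d2(1)
  proof (intro exI[of _ "min d1 d2"] conjI allI impI)
    fix P assume "nonoverlapping P \<and> total_length P < min d1 d2"
    then have "increments f P < e / 2" "increments g P < e / 2" using d1(2) d2(2) by auto
    with *[of P]
    show "increments (\<lambda>x. f x - g x) P < e" by linarith
  qed simp
qed

section \<open>Densities of absolutely continuous functions\<close>

lemma AC_real_isCont:
  assumes ac: "AC_real F"
  shows "isCont F a"
  unfolding continuous_at_eps_delta
proof (intro allI impI)
  fix e :: real assume "e > 0"
  then obtain d where d: "d > 0" "\<forall>P. nonoverlapping P \<and> total_length P < d \<longrightarrow> increments F P < e"
    using ac unfolding AC_real_def by meson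
  have inc: "\<bar>F y - F x\<bar> < e" if "x < y" "y - x < d" for x y
  proof -
    have "nonoverlapping {(x, y)}" using that by (intro nonoverlappingI) auto
    then have "increments F {(x, y)} < e" using d(2) that by (auto simp: total_length_def)
    then show ?thesis by (simp add: increments_def)
  qed
  have "dist (F x) (F a) < e" if "dist x a < d" for x
    using inc[of x a] inc[of a x] that \<open>e > 0\<close>
    by (cases x a rule: linorder_cases) (auto simp: dist_real_def)
  then show "\<exists>d>0. \<forall>x. dist x a < d \<longrightarrow> dist (F x) (F a) < e" using d(1) by blast
qed

lemma AC_interval_measure:
  assumes mono: "\<And>x y. x \<le> y \<Longrightarrow> F x \<le> F y" and ac: "AC_real F" and ab: "a \<le> b"
  shows "emeasure (interval_measure F) {a..b} = ennreal (F b - F a)"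
proof (rule emeasure_interval_measure_Icc[OF ab mono])
  show "continuous_on UNIV F" using AC_real_isCont[OF ac] continuous_at_imp_continuous_on by blast
qed

text \<open>
  The Lebesgue--Stieltjes measure of an absolutely continuous increasing function is absolutely continuous: a null set has a
  neighbourhood of small length, and a covering by nonoverlapping intervals inside this neighbourhood
  has small total increment.
\<close>

lemma AC_interval_measure_null:
  assumes mono: "\<And>x y. x \<le> y \<Longrightarrow> F x \<le> F y" and ac: "AC_real F"
    and A: "A \<in> sets borel" "emeasure lborel A = 0"
  shows "emeasure (interval_measure F) A = 0"
proof -
  let ?N = "interval_measure F"
  have Icc: "emeasure ?N {a..b} = ennreal (F b - F a)" if "a \<le> b" for a b
    by (rule AC_interval_measure[OF _ ac that]) (rule mono)
  have "emeasure ?N (A \<inter> {-m..m}) \<le> ennreal e" if e: "e > 0" and m: "m > 0" for e m :: real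
  proof -
    obtain d where d: "d > 0" "\<forall>P. nonoverlapping P \<and> total_length P < d \<longrightarrow> increments F P < e"
      using ac e unfolding AC_real_def by meson
    obtain U where U: "open U" "A \<subseteq> U" "emeasure lborel (U - A) < ennreal d"
      using outer_regular_lborel[OF A(1) d(1)] by blast
    have Ud: "emeasure lborel U < ennreal d"
    proof -
      have "emeasure lborel U = emeasure lborel (U - A)"
        by (rule emeasure_Diff_null_set[symmetric]) (use A U in \<open>auto simp: null_sets_def\<close>)
      then show ?thesis using U by simp
    qed
    \<comment> \<open>With this gauge the covering intervals are contained in the neighbourhood \<open>U\<close>.\<close>
    define \<gamma> where "\<gamma> x = (if x \<in> U then U else UNIV)" for x :: real
    have "gauge \<gamma>" using U(1) unfolding gauge_def \<gamma>_def by auto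
    have sub: "A \<inter> {-m..m} \<subseteq> cbox (-m) m" by auto
    have ne: "box (-m) m \<noteq> {}" using m by simp
    obtain D where D: "countable D" "\<Union>D \<subseteq> cbox (-m) m"
      "\<And>K. K \<in> D \<Longrightarrow> interior K \<noteq> {} \<and> (\<exists>c d. K = cbox c d)"
      "pairwise (\<lambda>A B. interior A \<inter> interior B = {}) D"
      "\<And>K. K \<in> D \<Longrightarrow> \<exists>x \<in> (A \<inter> {-m..m}) \<inter> K. K \<subseteq> \<gamma> x"
      "A \<inter> {-m..m} \<subseteq> \<Union>D"
      using covering_lemma[OF sub ne \<open>gauge \<gamma>\<close>] by metis
    have KU: "K \<subseteq> U" if K: "K \<in> D" for K
    proof -
      obtain x where "x \<in> A" "K \<subseteq> \<gamma> x" using D(5)[OF K] by blast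
      moreover then have "x \<in> U" using U(2) by blast
      ultimately show ?thesis by (simp add: \<gamma>_def)
    qed
    define l r where "l K = Inf K" and "r K = Sup K" for K :: "real set"
    have lr: "l K < r K \<and> K = {l K..r K}" if K: "K \<in> D" for K
    proof -
      obtain c d where cd: "K = {c..d}" "interior K \<noteq> {}" using D(3)[OF K] by auto
      then have "c < d" by (metis interior_atLeastAtMost_real greaterThanLessThan_empty_iff not_less)
      then show ?thesis using cd by (simp add: l_def r_def)
    qed
    have borelD: "K \<in> sets borel" if "K \<in> D" for K using D(3)[OF that] by auto
    have fin: "(\<Sum>K\<in>D'. emeasure ?N K) \<le> ennreal e" if D': "finite D'" "D' \<subseteq> D" for D'
    proof -
      define P where "P = (\<lambda>K. (l K, r K)) ` D'"
      have inj: "inj_on (\<lambda>K. (l K, r K)) D'"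
        by (rule inj_onI) (use lr D' in \<open>metis Pair_inject subsetD\<close>)
      have no: "nonoverlapping P"
      proof (rule nonoverlappingI)
        show "finite P" using D' by (simp add: P_def)
        show "s < t" if "(s, t) \<in> P" for s t using that lr D' by (auto simp: P_def)
        show "t \<le> s' \<or> t' \<le> s" if st: "(s, t) \<in> P" "(s', t') \<in> P" "(s, t) \<noteq> (s', t')" for s t s' t'
        proof (rule ccontr)
          assume *: "\<not> ?thesis"
          obtain K K' where K: "K \<in> D" "K' \<in> D" "s = l K" "t = r K" "s' = l K'" "t' = r K'"
            using st(1,2) D' by (auto simp: P_def)
          then have "K \<noteq> K'" using st(3) by auto
          then have "interior K \<inter> interior K' = {}" using D(4) K by (auto simp: pairwise_def)
          moreover have "interior K = {s<..<t}" "interior K' = {s'<..<t'}"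
            using lr[OF K(1)] lr[OF K(2)] K(3-) by (metis interior_atLeastAtMost_real)+
          moreover have "(max s s' + min t t') / 2 \<in> {s<..<t} \<inter> {s'<..<t'}"
            using * lr[OF K(1)] lr[OF K(2)] K(3-) by (auto simp: max_def min_def field_simps)
          ultimately show False by blast
        qed
      qed
      have "ennreal (total_length P) \<le> emeasure lborel U"
      proof (rule total_length_le_measure[OF no])
        fix s t assume st: "(s, t) \<in> P"
        then obtain K where K: "K \<in> D" "s = l K" "t = r K" using D' by (auto simp: P_def)
        have "{s<..<t} \<subseteq> {l K..r K}" using K by auto
        then show "{s<..<t} \<subseteq> U" using lr[OF K(1)] KU[OF K(1)] by blast
      qed (use U in simp)
      also note Ud
      finally have "ennreal (total_length P) < ennreal d" .
      moreover have "0 \<le> total_length P"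
        unfolding total_length_def using nonoverlappingD(2)[OF no] by (intro sum_nonneg) (auto simp: less_imp_le)
      ultimately have "total_length P < d" by (simp add: ennreal_less_iff)
      then have "increments F P < e" using d(2) no by blast
      moreover have "(\<Sum>K\<in>D'. emeasure ?N K) = (\<Sum>K\<in>D'. ennreal \<bar>F (r K) - F (l K)\<bar>)"
      proof (rule sum.cong)
        fix K assume "K \<in> D'"
        then have "l K < r K" "K = {l K..r K}" using lr D' by auto
        then have "emeasure ?N K = ennreal (F (r K) - F (l K))" using Icc[of "l K" "r K"] by simp
        then show "emeasure ?N K = ennreal \<bar>F (r K) - F (l K)\<bar>" using mono[of "l K" "r K"] \<open>l K < r K\<close> by simp
      qed simp
      moreover have "\<dots> = ennreal (\<Sum>K\<in>D'. \<bar>F (r K) - F (l K)\<bar>)" by (rule sum_ennreal) simp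
      moreover have "(\<Sum>K\<in>D'. \<bar>F (r K) - F (l K)\<bar>) = increments F P"
        unfolding increments_def P_def by (subst sum.reindex[OF inj]) simp
      ultimately show ?thesis by (simp add: less_imp_le ennreal_leI)
    qed
    have "emeasure ?N (A \<inter> {-m..m}) \<le> emeasure ?N (\<Union>n. \<Union>K\<in>D \<inter> from_nat_into D ` {..<n}. K)"
    proof (rule emeasure_mono)
      show "A \<inter> {-m..m} \<subseteq> (\<Union>n. \<Union>K\<in>D \<inter> from_nat_into D ` {..<n}. K)"
      proof
        fix x assume "x \<in> A \<inter> {-m..m}"
        then obtain K where K: "K \<in> D" "x \<in> K" using D(6) by blast
        then obtain n where "K = from_nat_into D n" using from_nat_into_surj[OF D(1)] by metis
        then have "K \<in> D \<inter> from_nat_into D ` {..<Suc n}" using K by auto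
        then show "x \<in> (\<Union>n. \<Union>K\<in>D \<inter> from_nat_into D ` {..<n}. K)" using K(2) by blast
      qed
    qed (use borelD in \<open>auto intro!: sets.countable_UN sets.finite_UN\<close>)
    also have "\<dots> = (SUP n. emeasure ?N (\<Union>K\<in>D \<inter> from_nat_into D ` {..<n}. K))"
      by (rule SUP_emeasure_incseq[symmetric])
        (use borelD in \<open>fastforce intro!: sets.finite_UN simp: incseq_def\<close>)+
    also have "\<dots> \<le> ennreal e"
    proof (rule SUP_least)
      fix n
      have "emeasure ?N (\<Union>K\<in>D \<inter> from_nat_into D ` {..<n}. K) \<le> (\<Sum>K\<in>D \<inter> from_nat_into D ` {..<n}. emeasure ?N K)"
        by (rule emeasure_subadditive_finite) (use borelD in auto)
      also have "\<dots> \<le> ennreal e" by (rule fin) auto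
      finally show "emeasure ?N (\<Union>K\<in>D \<inter> from_nat_into D ` {..<n}. K) \<le> ennreal e" .
    qed
    finally show ?thesis .
  qed
  then have null_m: "emeasure ?N (A \<inter> {-m..m}) = 0" if "m > 0" for m :: real
    using that by (metis ennreal_le_epsilon le_zero_eq add.left_neutral)
  have "A \<inter> {-real (Suc n)..real (Suc n)} \<in> null_sets ?N" for n
    using A null_m[of "real (Suc n)"] by (auto simp: null_sets_def simp del: of_nat_Suc)
  then have "(\<Union>n. A \<inter> {-real (Suc n)..real (Suc n)}) \<in> null_sets ?N" by blast
  moreover have "(\<Union>n. A \<inter> {-real (Suc n)..real (Suc n)}) = A"
  proof -
    have "\<exists>n. x \<in> {-real (Suc n)..real (Suc n)}" for x
      using real_arch_simple[of "\<bar>x\<bar>"] by (auto simp: abs_le_iff) (smt (verit))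
    then show ?thesis by blast
  qed
  ultimately show ?thesis by auto
qed

text \<open>
  The density is the Radon--Nikodym derivative of the Lebesgue--Stieltjes measure.
\<close>

lemma mono_AC_has_density:
  assumes mono: "\<And>x y. x \<le> y \<Longrightarrow> F x \<le> F y" and ac: "AC_real F"
  obtains g where "\<And>a b. g absolutely_integrable_on {a..b}"
    "\<And>a b. a \<le> b \<Longrightarrow> integral {a..b} g = F b - (F a :: real)"
proof -
  let ?N = "interval_measure F"
  have Icc: "emeasure ?N {a..b} = ennreal (F b - F a)" if "a \<le> b" for a b
    by (rule AC_interval_measure[OF _ ac that]) (rule mono)
  have null: "emeasure ?N A = 0" if "A \<in> sets borel" "emeasure lborel A = 0" for A
    by (rule AC_interval_measure_null[OF _ ac that]) (rule mono)
  have "absolutely_continuous lborel ?N"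
    unfolding absolutely_continuous_def using null by (auto simp: null_sets_def)
  then obtain h where h: "h \<in> borel_measurable lborel" "density lborel h = ?N"
    using sigma_finite_measure.Radon_Nikodym[OF lborel.sigma_finite_measure_axioms, of ?N] by auto
  have hint: "(\<integral>\<^sup>+x. h x * indicator {a..b} x \<partial>lborel) = ennreal (F b - F a)" if "a \<le> b" for a b
    using Icc[OF that] h(1) unfolding h(2)[symmetric] by (subst (asm) emeasure_density) auto
  define g where "g x = enn2real (h x)" for x
  have hb: "(\<lambda>x. indicator {a..b} x *\<^sub>R g x) \<in> borel_measurable lborel" for a b :: real
    unfolding g_def using h(1) by measurable
  have "has_bochner_integral lborel (\<lambda>x. indicator {a..b} x *\<^sub>R g x) (F b - F a)" if ab: "a \<le> b" for a b
  proof (rule has_bochner_integral_nn_integral)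
    have "AE x in lborel. h x * indicator {a..b} x \<noteq> \<infinity>"
      by (rule nn_integral_PInf_AE) (use h(1) hint[OF ab] in auto)
    then have "(\<integral>\<^sup>+x. ennreal (indicator {a..b} x *\<^sub>R g x) \<partial>lborel) = (\<integral>\<^sup>+x. h x * indicator {a..b} x \<partial>lborel)"
      by (intro nn_integral_cong_AE) (auto simp: g_def indicator_def top.not_eq_extremum elim!: eventually_mono)
    then show "(\<integral>\<^sup>+x. ennreal (indicator {a..b} x *\<^sub>R g x) \<partial>lborel) = ennreal (F b - F a)" using hint[OF ab] by simp
  qed (use hb mono[OF ab] in \<open>auto simp: g_def\<close>)
  then have "has_bochner_integral lebesgue (\<lambda>x. indicator {a..b} x *\<^sub>R g x) (F b - F a)" if "a \<le> b" for a b
    using that hb[of a b] by (auto simp: has_bochner_integral_iff integrable_completion integral_completion)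
  then have *: "set_integrable lebesgue {a..b} g" "set_lebesgue_integral lebesgue {a..b} g = F b - F a" if "a \<le> b" for a b
    using that by (auto simp: has_bochner_integral_iff set_integrable_def set_lebesgue_integral_def)
  show ?thesis
  proof (rule that[of g])
    show "g absolutely_integrable_on {a..b}" for a b
      using *(1)[of a b] by (cases "a \<le> b") auto
    show "integral {a..b} g = F b - F a" if "a \<le> b" for a b
      using *[OF that] set_lebesgue_integral_eq_integral(2) by force
  qed
qed

text \<open>
  Jordan decomposition: the function is its variation minus an increasing function, and both are absolutely
  continuous.
\<close>

lemma AC_real_has_density:
  assumes ac: "AC_real f" and bd: "bounded_increments f"
  obtains g where "\<And>a b. g absolutely_integrable_on {a..b}"
    "\<And>a b. a \<le> b \<Longrightarrow> integral {a..b} g = f b - (f a :: real)"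
proof -
  let ?v = "\<lambda>x. variation f {..x}"
  have acv: "AC_real ?v" by (rule AC_real_variation[OF bd ac])
  have inc: "\<bar>f y - f x\<bar> \<le> ?v y - ?v x" if "x \<le> y" for x y
    using increment_le_variation_diff[OF bd, of x y] that by (cases "x = y") auto
  have mono1: "?v x \<le> ?v y" and mono2: "?v x - f x \<le> ?v y - f y" if "x \<le> y" for x y
    using inc[OF that] by linarith+
  obtain g1 where g1: "\<And>a b. g1 absolutely_integrable_on {a..b}"
    "\<And>a b. a \<le> b \<Longrightarrow> integral {a..b} g1 = ?v b - ?v a"
    using mono_AC_has_density[OF mono1 acv] by metis
  obtain g2 where g2: "\<And>a b. g2 absolutely_integrable_on {a..b}"
    "\<And>a b. a \<le> b \<Longrightarrow> integral {a..b} g2 = (?v b - f b) - (?v a - f a)"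
    using mono_AC_has_density[OF mono2 AC_real_diff[OF acv ac]] by metis
  show ?thesis
  proof (rule that[of "\<lambda>x. g1 x - g2 x"])
    show "(\<lambda>x. g1 x - g2 x) absolutely_integrable_on {a..b}" for a b
      using g1(1) g2(1) by (rule set_integral_diff)
    show "integral {a..b} (\<lambda>x. g1 x - g2 x) = f b - f a" if "a \<le> b" for a b
      using g1(1)[of a b] g2(1)[of a b] g1(2)[OF that] g2(2)[OF that]
      by (subst integral_diff) (auto dest: set_lebesgue_integral_eq_integral(1))
  qed
qed

definition clamp :: "real \<Rightarrow> real \<Rightarrow> real \<Rightarrow> real" where
  "clamp c d x = max c (min d x)"

lemma mono_clamp: "mono (clamp c d)"
  by (auto simp: mono_def clamp_def)

lemma clamp_bounds: "c \<le> d \<Longrightarrow> clamp c d x \<in> {c..d}"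
  by (auto simp: clamp_def)

lemma clamp_lipschitz: "x \<le> y \<Longrightarrow> clamp c d y - clamp c d x \<le> y - x"
  by (auto simp: clamp_def max_def min_def)

lemma clamp_id: "x \<in> {c..d} \<Longrightarrow> clamp c d x = x"
  by (auto simp: clamp_def)

lemma nonoverlapping_clamp:
  assumes P: "nonoverlapping P" and cd: "c \<le> d"
  obtains Q where "nonoverlapping Q" "\<And>s t. (s, t) \<in> Q \<Longrightarrow> c \<le> s \<and> t \<le> d"
    "\<And>g. increments g Q = (\<Sum>(s, t) \<in> P. \<bar>g (clamp c d t) - g (clamp c d s)\<bar>)"
    "total_length Q \<le> total_length P" "total_length Q \<le> d - c"
proof -
  obtain Q where Q: "nonoverlapping Q" "Q \<subseteq> (\<lambda>(s, t). (clamp c d s, clamp c d t)) ` P"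
    "\<And>g. increments g Q = (\<Sum>(s, t) \<in> P. \<bar>g (clamp c d t) - g (clamp c d s)\<bar>)"
    "total_length Q = (\<Sum>(s, t) \<in> P. clamp c d t - clamp c d s)"
    using increments_image[OF P mono_clamp[of c d]] by metis
  have in_cd: "c \<le> s \<and> t \<le> d" if st: "(s, t) \<in> Q" for s t
  proof -
    obtain a b where "s = clamp c d a" "t = clamp c d b" using Q(2) st by auto
    then show ?thesis using clamp_bounds[OF cd] by (metis atLeastAtMost_iff)
  qed
  show ?thesis
  proof (rule that[OF Q(1) in_cd Q(3)])
    show "total_length Q \<le> total_length P"
      unfolding Q(4) total_length_def[of P]
    proof (rule sum_mono, clarify)
      fix s t assume "(s, t) \<in> P"
      then have "s \<le> t" using nonoverlappingD(2)[OF P] by (simp add: less_imp_le)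
      then show "clamp c d t - clamp c d s \<le> t - s" by (rule clamp_lipschitz)
    qed
    show "total_length Q \<le> d - c" by (rule total_length_le[OF Q(1) in_cd cd])
  qed
qed

lemma AC_on_intervalD:
  assumes ac: "absolutely_continuous_on_interval c d f" and e: "0 < e"
  obtains \<delta> where "\<delta> > 0"
    "\<And>Q. nonoverlapping Q \<Longrightarrow> (\<And>s t. (s, t) \<in> Q \<Longrightarrow> c \<le> s \<and> t \<le> d) \<Longrightarrow> total_length Q < \<delta>
       \<Longrightarrow> (\<Sum>(s, t) \<in> Q. norm (f t - f s)) < e"
proof -
  from ac[unfolded absolutely_continuous_on_interval_def, rule_format, OF e]
  obtain \<delta> where \<delta>: "\<delta> > 0" "\<forall>P. finite P \<and>
        (\<forall>(s, t) \<in> P. c \<le> s \<and> s \<le> t \<and> t \<le> d) \<and>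
        disjoint_family_on (\<lambda>(s, t). {s<..<t}) P \<and>
        (\<Sum>(s, t) \<in> P. t - s) < \<delta> \<longrightarrow> (\<Sum>(s, t) \<in> P. norm (f t - f s)) < e"
    by (elim exE conjE)
  show ?thesis
  proof (rule that[OF \<delta>(1)])
    fix Q assume Q: "nonoverlapping Q" "\<And>s t. (s, t) \<in> Q \<Longrightarrow> c \<le> s \<and> t \<le> d" "total_length Q < \<delta>"
    have "\<forall>(s, t) \<in> Q. c \<le> s \<and> s \<le> t \<and> t \<le> d"
      using Q(2) nonoverlappingD(2)[OF Q(1)] by (auto simp: less_imp_le)
    then show "(\<Sum>(s, t) \<in> Q. norm (f t - f s)) < e"
      using \<delta>(2)[rule_format, of Q] Q nonoverlappingD(1)[OF Q(1)] nonoverlapping_disjoint_family[OF Q(1)]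
      by (simp add: total_length_def)
  qed
qed

lemma increments_le_norm:
  fixes f :: "real \<Rightarrow> complex" and h :: "complex \<Rightarrow> real"
  assumes h: "\<And>x y. \<bar>h x - h y\<bar> \<le> norm (x - y)"
  shows "increments (\<lambda>x. h (f x)) Q \<le> (\<Sum>(s, t) \<in> Q. norm (f t - f s))"
  unfolding increments_def using h by (intro sum_mono) (auto split: prod.splits)

lemma AC_real_clamped:
  fixes f :: "real \<Rightarrow> complex" and h :: "complex \<Rightarrow> real"
  assumes ac: "absolutely_continuous_on_interval c d f" and cd: "c < d"
    and h: "\<And>x y. \<bar>h x - h y\<bar> \<le> norm (x - y)"
  shows "AC_real (\<lambda>x. h (f (clamp c d x)))"
  unfolding AC_real_def
proof (intro allI impI)
  fix e :: real assume e: "0 < e"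
  obtain \<delta> where \<delta>: "\<delta> > 0"
    "\<And>Q. nonoverlapping Q \<Longrightarrow> (\<And>s t. (s, t) \<in> Q \<Longrightarrow> c \<le> s \<and> t \<le> d) \<Longrightarrow> total_length Q < \<delta>
       \<Longrightarrow> (\<Sum>(s, t) \<in> Q. norm (f t - f s)) < e"
    using AC_on_intervalD[OF ac e] by metis
  have "increments (\<lambda>x. h (f (clamp c d x))) P < e"
    if P: "nonoverlapping P" "total_length P < \<delta>" for P
  proof -
    obtain Q where Q: "nonoverlapping Q" "\<And>s t. (s, t) \<in> Q \<Longrightarrow> c \<le> s \<and> t \<le> d"
      "\<And>g. increments g Q = (\<Sum>(s, t) \<in> P. \<bar>g (clamp c d t) - g (clamp c d s)\<bar>)"
      "total_length Q \<le> total_length P"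
      using nonoverlapping_clamp[OF P(1) less_imp_le[OF cd]] by metis
    have "increments (\<lambda>x. h (f (clamp c d x))) P = increments (\<lambda>x. h (f x)) Q"
      unfolding Q(3) increments_def[of _ P] ..
    also have "\<dots> \<le> (\<Sum>(s, t) \<in> Q. norm (f t - f s))" by (rule increments_le_norm[OF h])
    also have "\<dots> < e" by (rule \<delta>(2)[OF Q(1,2)]) (use Q(4) P(2) in auto)
    finally show ?thesis .
  qed
  then show "\<exists>\<delta>>0. \<forall>P. nonoverlapping P \<and> total_length P < \<delta> \<longrightarrow> increments (\<lambda>x. h (f (clamp c d x))) P < e"
    using \<delta>(1) by blast
qed

text \<open>
  The interval is divided into $N$ pieces shorter than the $\delta$ that belongs to $\varepsilon = 1$. The part of
  any family in one piece contributes at most 1, so all increments are bounded by $N$.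
\<close>

lemma bounded_increments_clamped:
  fixes f :: "real \<Rightarrow> complex" and h :: "complex \<Rightarrow> real"
  assumes ac: "absolutely_continuous_on_interval c d f" and cd: "c < d"
    and h: "\<And>x y. \<bar>h x - h y\<bar> \<le> norm (x - y)"
  shows "bounded_increments (\<lambda>x. h (f (clamp c d x)))"
proof -
  obtain \<delta> where \<delta>: "\<delta> > 0"
    "\<And>Q. nonoverlapping Q \<Longrightarrow> (\<And>s t. (s, t) \<in> Q \<Longrightarrow> c \<le> s \<and> t \<le> d) \<Longrightarrow> total_length Q < \<delta>
       \<Longrightarrow> (\<Sum>(s, t) \<in> Q. norm (f t - f s)) < 1"
    using AC_on_intervalD[OF ac zero_less_one] by metis
  obtain N :: nat where N: "(d - c) / \<delta> < N" using reals_Archimedean2 by blast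
  have "0 < (d - c) / \<delta>" using cd \<delta>(1) by simp
  then have N0: "N > 0" using N by (metis gr0I less_trans of_nat_0 less_irrefl)
  define st where "st = (d - c) / N"
  have st: "0 \<le> st" "st < \<delta>" "N * st = d - c"
    using cd N N0 \<delta>(1) by (auto simp: st_def field_simps)
  define e where "e i = c + real i * st" for i
  have e0: "e 0 = c" and eN: "e N = d" using st(3) by (auto simp: e_def)
  have em: "e i \<le> e (Suc i)" "e (Suc i) - e i < \<delta>" "c \<le> e i" for i
    using st(1,2) by (auto simp: e_def algebra_simps)
  have ed: "e i \<le> d" if "i \<le> N" for i
    using eN lift_Suc_mono_le[of e, OF em(1) that] by simp
  define g where "g x = h (f x)" for x
  \<comment> \<open>The increments over the first \<open>n\<close> pieces telescope.\<close>
  have tele: "(\<Sum>i<n. g (clamp (e i) (e (Suc i)) x) - g (e i)) = g (clamp c (e n) x) - g c" for n x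
  proof (induction n)
    case 0
    then show ?case by (simp add: e0 clamp_def)
  next
    case (Suc n)
    have "g (clamp c (e n) x) + g (clamp (e n) (e (Suc n)) x) - g (e n) = g (clamp c (e (Suc n)) x)"
    proof (cases "x \<le> e n")
      case True
      then have "clamp c (e n) x = clamp c (e (Suc n)) x" "clamp (e n) (e (Suc n)) x = e n"
        using em(1)[of n] by (auto simp: clamp_def)
      then show ?thesis by simp
    next
      case False
      then have "clamp c (e n) x = e n" "clamp (e n) (e (Suc n)) x = clamp c (e (Suc n)) x"
        using em(1)[of n] em(3)[of n] by (auto simp: clamp_def)
      then show ?thesis by simp
    qed
    then show ?case using Suc by simp
  qed
  have "increments (\<lambda>x. g (clamp c d x)) P \<le> N" if P: "nonoverlapping P" for P
  proof -
    have "increments (\<lambda>x. g (clamp c d x)) P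
        \<le> (\<Sum>p\<in>P. \<Sum>i<N. \<bar>g (clamp (e i) (e (Suc i)) (snd p)) - g (clamp (e i) (e (Suc i)) (fst p))\<bar>)"
      unfolding increments_def
    proof (rule sum_mono)
      fix p assume "p \<in> P"
      have "g (clamp c d (snd p)) - g (clamp c d (fst p))
        = (\<Sum>i<N. g (clamp (e i) (e (Suc i)) (snd p)) - g (clamp (e i) (e (Suc i)) (fst p)))"
        using tele[of "snd p" N] tele[of "fst p" N] unfolding eN by (simp add: sum_subtractf)
      then show "(case p of (s, t) \<Rightarrow> \<bar>g (clamp c d t) - g (clamp c d s)\<bar>)
         \<le> (\<Sum>i<N. \<bar>g (clamp (e i) (e (Suc i)) (snd p)) - g (clamp (e i) (e (Suc i)) (fst p))\<bar>)"
        using sum_abs by (simp add: split_def)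
    qed
    also have "\<dots> = (\<Sum>i<N. \<Sum>p\<in>P. \<bar>g (clamp (e i) (e (Suc i)) (snd p)) - g (clamp (e i) (e (Suc i)) (fst p))\<bar>)"
      by (rule sum.swap)
    also have "\<dots> \<le> (\<Sum>i<N. 1)"
    proof (rule sum_mono)
      fix i assume i: "i \<in> {..<N}"
      obtain Q where Q: "nonoverlapping Q" "\<And>s t. (s, t) \<in> Q \<Longrightarrow> e i \<le> s \<and> t \<le> e (Suc i)"
        "\<And>g. increments g Q = (\<Sum>(s, t) \<in> P. \<bar>g (clamp (e i) (e (Suc i)) t) - g (clamp (e i) (e (Suc i)) s)\<bar>)"
        "total_length Q \<le> e (Suc i) - e i"
        using nonoverlapping_clamp[OF P em(1)[of i]] by metis
      have "(\<Sum>p\<in>P. \<bar>g (clamp (e i) (e (Suc i)) (snd p)) - g (clamp (e i) (e (Suc i)) (fst p))\<bar>) = increments g Q"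
        unfolding Q(3) by (simp add: split_def)
      also have "\<dots> \<le> (\<Sum>(s, t) \<in> Q. norm (f t - f s))" unfolding g_def by (rule increments_le_norm[OF h])
      also have "\<dots> \<le> 1"
      proof (rule less_imp_le, rule \<delta>(2)[OF Q(1)])
        show "c \<le> s \<and> t \<le> d" if "(s, t) \<in> Q" for s t
          using Q(2)[OF that] em(3)[of i] ed[of "Suc i"] i by auto
        show "total_length Q < \<delta>" using Q(4) em(2)[of i] by linarith
      qed
      finally show "(\<Sum>p\<in>P. \<bar>g (clamp (e i) (e (Suc i)) (snd p)) - g (clamp (e i) (e (Suc i)) (fst p))\<bar>) \<le> 1" .
    qed
    finally show ?thesis by simp
  qed
  then show ?thesis unfolding bounded_increments_def g_def by blast
qed

lemma AC_on_interval_has_density: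
  assumes ac: "absolutely_continuous_on_interval c d f" and cd: "c < d"
  obtains g :: "real \<Rightarrow> complex" where "\<And>a b. g absolutely_integrable_on {a..b}"
    "\<And>a b. a \<le> b \<Longrightarrow> integral {a..b} g = f (clamp c d b) - f (clamp c d a)"
proof -
  have hRe: "\<bar>Re x - Re y\<bar> \<le> norm (x - y)" and hIm: "\<bar>Im x - Im y\<bar> \<le> norm (x - y)" for x y
    using abs_Re_le_cmod[of "x - y"] abs_Im_le_cmod[of "x - y"] by simp_all
  obtain g1 where g1: "\<And>a b. g1 absolutely_integrable_on {a..b}"
    "\<And>a b. a \<le> b \<Longrightarrow> integral {a..b} g1 = Re (f (clamp c d b)) - Re (f (clamp c d a))"
    using AC_real_has_density[OF AC_real_clamped[OF ac cd hRe] bounded_increments_clamped[OF ac cd hRe]] by metis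
  obtain g2 where g2: "\<And>a b. g2 absolutely_integrable_on {a..b}"
    "\<And>a b. a \<le> b \<Longrightarrow> integral {a..b} g2 = Im (f (clamp c d b)) - Im (f (clamp c d a))"
    using AC_real_has_density[OF AC_real_clamped[OF ac cd hIm] bounded_increments_clamped[OF ac cd hIm]] by metis
  have hi: "(g1 has_integral Re (f (clamp c d b)) - Re (f (clamp c d a))) {a..b}"
     "(g2 has_integral Im (f (clamp c d b)) - Im (f (clamp c d a))) {a..b}" if "a \<le> b" for a b
    using g1(1)[of a b] g2(1)[of a b] g1(2)[OF that] g2(2)[OF that]
    by (auto simp: has_integral_iff dest: set_lebesgue_integral_eq_integral(1))
  show ?thesis
  proof (rule that[of "\<lambda>x. of_real (g1 x) + \<i> * of_real (g2 x)"])
    show "(\<lambda>x. of_real (g1 x) + \<i> * of_real (g2 x)) absolutely_integrable_on {a..b}" for a b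
    proof (rule set_integral_add)
      show "(\<lambda>x. complex_of_real (g1 x)) absolutely_integrable_on {a..b}"
        using absolutely_integrable_linear[OF g1(1) bounded_linear_of_real] by (simp add: o_def)
      show "(\<lambda>x. \<i> * complex_of_real (g2 x)) absolutely_integrable_on {a..b}"
        using absolutely_integrable_linear[OF g2(1) bounded_linear_compose[OF bounded_linear_mult_right[of \<i>] bounded_linear_of_real]]
        by (simp add: o_def)
    qed
    show "integral {a..b} (\<lambda>x. of_real (g1 x) + \<i> * of_real (g2 x)) = f (clamp c d b) - f (clamp c d a)" if "a \<le> b" for a b
    proof -
      have "((\<lambda>x. complex_of_real (g1 x) + \<i> * complex_of_real (g2 x)) has_integral
         (of_real (Re (f (clamp c d b)) - Re (f (clamp c d a))) + \<i> * of_real (Im (f (clamp c d b)) - Im (f (clamp c d a))))) {a..b}"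
        using has_integral_linear[OF hi(1)[OF that] bounded_linear_of_real[where 'a = complex]]
          has_integral_linear[OF hi(2)[OF that] bounded_linear_compose[OF bounded_linear_mult_right[of \<i>] bounded_linear_of_real]]
        by (intro has_integral_add) (simp_all add: o_def)
      then show ?thesis by (auto simp: complex_eq_iff dest!: integral_unique)
    qed
  qed
qed

section \<open>Local primitives\<close>

text \<open>
  The integral form of local absolute continuity: \<open>f\<close> is a primitive of the locally integrable function
  \<open>g\<close>. Working with the pair avoids all choices of representatives for derivatives.
\<close>

definition ac_primitive :: "real set \<Rightarrow> (real \<Rightarrow> complex) \<Rightarrow> (real \<Rightarrow> complex) \<Rightarrow> bool" where
  "ac_primitive I f g \<longleftrightarrow> (\<forall>a b. a \<le> b \<and> {a..b} \<subseteq> I \<longrightarrow>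
     g absolutely_integrable_on {a..b} \<and> integral {a..b} g = f b - f a)"

lemma ac_primitiveD:
  assumes "ac_primitive I f g" "a \<le> b" "{a..b} \<subseteq> I"
  shows "g absolutely_integrable_on {a..b}" "integral {a..b} g = f b - f a" "g integrable_on {a..b}"
  using assms set_lebesgue_integral_eq_integral(1) unfolding ac_primitive_def by blast+

lemma ac_primitiveI:
  assumes "\<And>a b. a \<le> b \<Longrightarrow> {a..b} \<subseteq> I \<Longrightarrow> g absolutely_integrable_on {a..b}"
    "\<And>a b. a \<le> b \<Longrightarrow> {a..b} \<subseteq> I \<Longrightarrow> integral {a..b} g = f b - f a"
  shows "ac_primitive I f g"
  using assms unfolding ac_primitive_def by blast

lemma AE_lebesgue_on_iff_negligible:
  assumes "I \<in> sets lebesgue"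
  shows "(AE x in lebesgue_on I. P x) \<longleftrightarrow> negligible {x \<in> I. \<not> P x}"
proof -
  have "(AE x in lebesgue_on I. P x) \<longleftrightarrow> (AE x in lebesgue. x \<in> I \<longrightarrow> P x)"
    by (rule AE_restrict_space_iff) (use assms in simp)
  also have "\<dots> \<longleftrightarrow> negligible {x \<in> I. \<not> P x}"
  proof
    assume "AE x in lebesgue. x \<in> I \<longrightarrow> P x"
    then obtain N where "{x \<in> space lebesgue. \<not> (x \<in> I \<longrightarrow> P x)} \<subseteq> N" "N \<in> null_sets lebesgue"
      unfolding eventually_ae_filter by (elim bexE)
    moreover then have "negligible N" by (simp add: negligible_iff_null_sets)
    ultimately show "negligible {x \<in> I. \<not> P x}" by (elim negligible_subset) auto
  next
    assume "negligible {x \<in> I. \<not> P x}"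
    then show "AE x in lebesgue. x \<in> I \<longrightarrow> P x"
      by (intro AE_I'[of "{x \<in> I. \<not> P x}"]) (auto simp: negligible_iff_null_sets)
  qed
  finally show ?thesis .
qed

lemma open_has_interval:
  assumes "open I" "(x::real) \<in> I"
  obtains c d where "c \<in> \<rat>" "d \<in> \<rat>" "c < x" "x < d" "{c..d} \<subseteq> I"
proof -
  obtain e where e: "e > 0" "ball x e \<subseteq> I" using assms openE by blast
  obtain c where c: "c \<in> \<rat>" "x - e < c" "c < x" using Rats_dense_in_real[of "x - e" x] e by auto
  obtain d where d: "d \<in> \<rat>" "x < d" "d < x + e" using Rats_dense_in_real[of x "x + e"] e by auto
  have "{c..d} \<subseteq> ball x e" using c d by (auto simp: dist_real_def)
  then show ?thesis using that c d e by blast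
qed

text \<open>
  An open set is a countable union of intervals with rational end points.
\<close>

lemma negligible_open_local:
  assumes I: "open I"
    and loc: "\<And>c d :: real. c < d \<Longrightarrow> {c..d} \<subseteq> I \<Longrightarrow> negligible ({c<..<d} \<inter> B)"
  shows "negligible (I \<inter> B)"
proof -
  let ?Q = "{(c, d) \<in> \<rat> \<times> \<rat>. c < d \<and> {c..d} \<subseteq> I}"
  have "countable ?Q"
    by (rule countable_subset[of _ "\<rat> \<times> \<rat>"]) (auto intro: countable_rat)
  then have "negligible (\<Union>p\<in>?Q. {fst p<..<snd p} \<inter> B)"
    by (intro negligible_countable_Union) (auto intro!: loc)
  then show ?thesis
  proof (rule negligible_subset)
    show "I \<inter> B \<subseteq> (\<Union>p\<in>?Q. {fst p<..<snd p} \<inter> B)"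
    proof
      fix x assume x: "x \<in> I \<inter> B"
      then have "x \<in> I" by simp
      then obtain c d where "c \<in> \<rat>" "d \<in> \<rat>" "c < x" "x < d" "{c..d} \<subseteq> I"
        using open_has_interval[OF I] by metis
      then show "x \<in> (\<Union>p\<in>?Q. {fst p<..<snd p} \<inter> B)" using x by (intro UN_I[of "(c, d)"]) auto
    qed
  qed
qed

lemma AE_open_local:
  assumes I: "open I"
    and loc: "\<And>c d :: real. c < d \<Longrightarrow> {c..d} \<subseteq> I \<Longrightarrow> \<exists>N. negligible N \<and> (\<forall>x. c < x \<and> x < d \<and> x \<notin> N \<longrightarrow> P x)"
  shows "AE x in lebesgue_on I. P x"
proof -
  have "negligible (I \<inter> {x. \<not> P x})"
  proof (rule negligible_open_local[OF I])
    fix c d :: real assume "c < d" "{c..d} \<subseteq> I"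
    from loc[OF this] obtain N where "negligible N" "\<forall>x. c < x \<and> x < d \<and> x \<notin> N \<longrightarrow> P x"
      by (elim exE conjE)
    then show "negligible ({c<..<d} \<inter> {x. \<not> P x})" by (elim negligible_subset) auto
  qed
  moreover have "I \<in> sets lebesgue" using I by (simp add: borel_open)
  ultimately show ?thesis by (simp add: AE_lebesgue_on_iff_negligible Int_def)
qed

lemma AE_lebesgue_on_negligibleE:
  assumes "open I" "AE x in lebesgue_on I. P x"
  obtains N where "negligible N" "\<And>x. x \<in> I \<Longrightarrow> x \<notin> N \<Longrightarrow> P x"
proof -
  have "I \<in> sets lebesgue" using assms by (simp add: borel_open)
  then have "negligible {x \<in> I. \<not> P x}" using assms(2) AE_lebesgue_on_iff_negligible by blast
  then show ?thesis by (rule that) simp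
qed

lemma clamp_has_vector_derivative:
  assumes "(f \<circ> clamp c d has_vector_derivative g) (at x)" "c < x" "x < d"
  shows "(f has_vector_derivative g) (at x)"
  by (rule has_vector_derivative_transform_within_open[OF assms(1), of "{c<..<d}"])
    (use assms in \<open>auto simp: clamp_id\<close>)

text \<open>
  One half of Lebesgue's fundamental theorem. The densities on compact subintervals exist by the preceding section; almost everywhere
  they agree with the derivative, which therefore serves as a common density on the whole set.
\<close>

lemma AC_loc_ac_primitive:
  assumes I: "open I" and f: "f \<in> AC_loc I"
  shows "ac_primitive I f (\<lambda>x. vector_derivative f (at x))"
    and "AE x in lebesgue_on I. (f has_vector_derivative vector_derivative f (at x)) (at x)"
proof -
  have loc: "\<exists>N g. negligible N \<and> g absolutely_integrable_on {c..d} \<and> integral {c..d} g = f d - f c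
     \<and> (\<forall>x. c < x \<and> x < d \<and> x \<notin> N \<longrightarrow> (f has_vector_derivative g x) (at x))"
    if cd: "c < d" "{c..d} \<subseteq> I" for c d
  proof -
    have "absolutely_continuous_on_interval c d f" using f cd unfolding AC_loc_def by blast
    then obtain g where g: "\<And>a b. g absolutely_integrable_on {a..b}"
      "\<And>a b. a \<le> b \<Longrightarrow> integral {a..b} g = f (clamp c d b) - f (clamp c d a)"
      using AC_on_interval_has_density[OF _ cd(1)] by metis
    have gi: "g integrable_on {a..b}" for a b using g(1) set_lebesgue_integral_eq_integral(1) by blast
    obtain N where N: "negligible N" "\<And>x. x \<notin> N \<Longrightarrow> (f \<circ> clamp c d has_vector_derivative g x) (at x)"
      using primitive_differentiable_ae[OF gi, of "f \<circ> clamp c d"] g(2) by (metis o_apply)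
    have "integral {c..d} g = f d - f c" using g(2)[of c d] cd by (simp add: clamp_id)
    moreover have "\<forall>x. c < x \<and> x < d \<and> x \<notin> N \<longrightarrow> (f has_vector_derivative g x) (at x)"
      using N(2) clamp_has_vector_derivative by blast
    ultimately show ?thesis using N(1) g(1) by blast
  qed
  show "AE x in lebesgue_on I. (f has_vector_derivative vector_derivative f (at x)) (at x)"
  proof (rule AE_open_local[OF I])
    fix c d :: real assume "c < d" "{c..d} \<subseteq> I"
    from loc[OF this] obtain N g where N: "negligible N" "\<forall>x. c < x \<and> x < d \<and> x \<notin> N \<longrightarrow> (f has_vector_derivative g x) (at x)"
      by (elim exE conjE)
    then have "(f has_vector_derivative vector_derivative f (at x)) (at x)" if x: "c < x" "x < d" "x \<notin> N" for x
    proof -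
      have "(f has_vector_derivative g x) (at x)" using N(2) x by blast
      then show ?thesis by (simp add: vector_derivative_at)
    qed
    then show "\<exists>N. negligible N \<and> (\<forall>x. c < x \<and> x < d \<and> x \<notin> N \<longrightarrow> (f has_vector_derivative vector_derivative f (at x)) (at x))"
      using N(1) by blast
  qed
  show "ac_primitive I f (\<lambda>x. vector_derivative f (at x))"
    unfolding ac_primitive_def
  proof (intro allI impI)
    fix c d :: real assume cd: "c \<le> d \<and> {c..d} \<subseteq> I"
    show "(\<lambda>x. vector_derivative f (at x)) absolutely_integrable_on {c..d} \<and>
       integral {c..d} (\<lambda>x. vector_derivative f (at x)) = f d - f c"
    proof (cases "c = d")
      case True
      then show ?thesis by (auto intro!: absolutely_integrable_negligible)
    next
      case False
      then obtain N g where N: "negligible N" "g absolutely_integrable_on {c..d}" "integral {c..d} g = f d - f c"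
        "\<forall>x. c < x \<and> x < d \<and> x \<notin> N \<longrightarrow> (f has_vector_derivative g x) (at x)"
        using loc[of c d] cd by auto
      have neg: "negligible (N \<union> {c, d})" using N(1) by (simp add: negligible_Un_eq)
      have eq: "vector_derivative f (at x) = g x" if "x \<in> {c..d} - (N \<union> {c, d})" for x
      proof -
        have "c < x" "x < d" "x \<notin> N" using that by auto
        then show ?thesis using N(4) vector_derivative_at by blast
      qed
      show ?thesis
      proof
        show "(\<lambda>x. vector_derivative f (at x)) absolutely_integrable_on {c..d}"
          by (rule absolutely_integrable_spike[OF N(2) neg eq])
        have "integral {c..d} (\<lambda>x. vector_derivative f (at x)) = integral {c..d} g"
          by (rule integral_spike[OF neg]) (simp add: eq)
        then show "integral {c..d} (\<lambda>x. vector_derivative f (at x)) = f d - f c" using N(3) by simp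
      qed
    qed
  qed
qed

text \<open>
  On a compact subinterval the density is cut off outside and the primitive is extended constantly; the
  resulting functions satisfy the global differentiation theorem.
\<close>

lemma ac_primitive_has_derivative:
  assumes I: "open I" and fg: "ac_primitive I f g"
  shows "AE x in lebesgue_on I. (f has_vector_derivative g x) (at x)"
proof (rule AE_open_local[OF I])
  fix c d :: real assume cd: "c < d" "{c..d} \<subseteq> I"
  define h where "h = (\<lambda>x. if x \<in> {c..d} then g x else 0)"
  have int: "h integrable_on {a..b} \<and> (a \<le> b \<longrightarrow> integral {a..b} h = (f \<circ> clamp c d) b - (f \<circ> clamp c d) a)" for a b
  proof -
    have Int: "{c..d} \<inter> {a..b} = {max c a..min d b}" by auto
    show ?thesis
    proof (cases "max c a \<le> min d b")
      case True
      have gi: "g integrable_on {max c a..min d b}" "integral {max c a..min d b} g = f (min d b) - f (max c a)"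
        using ac_primitiveD[OF fg True order_trans[OF _ cd(2)]] by auto
      moreover have "a \<le> b \<Longrightarrow> clamp c d b = min d b" "a \<le> b \<Longrightarrow> clamp c d a = max c a"
        using True by (auto simp: clamp_def)
      ultimately show ?thesis
        unfolding h_def by (simp only: integral_restrict_Int integrable_restrict_Int Int o_apply) auto
    next
      case False
      then have "a \<le> b \<Longrightarrow> clamp c d b = clamp c d a" using cd
        by (auto simp: clamp_def)
      then show ?thesis using False
        unfolding h_def by (simp only: integral_restrict_Int integrable_restrict_Int Int o_apply) auto
    qed
  qed
  obtain N where N: "negligible N" "\<And>x. x \<notin> N \<Longrightarrow> (f \<circ> clamp c d has_vector_derivative h x) (at x)"
    using primitive_differentiable_ae[of h "f \<circ> clamp c d"] int by metis
  have "(f has_vector_derivative g x) (at x)" if "c < x" "x < d" "x \<notin> N" for x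
    using clamp_has_vector_derivative[OF N(2)[OF that(3)] that(1,2)] that by (simp add: h_def)
  then show "\<exists>N. negligible N \<and> (\<forall>x. c < x \<and> x < d \<and> x \<notin> N \<longrightarrow> (f has_vector_derivative g x) (at x))"
    using N(1) by blast
qed

lemma integral_truncation:
  fixes k :: "'a \<Rightarrow> real"
  assumes k: "integrable M k" "\<And>x. 0 \<le> k x" and e: "e > 0"
  obtains n :: nat where "(LINT x|M. k x - min (k x) n) < e"
proof -
  have "(\<lambda>n. LINT x|M. k x - min (k x) (real n)) \<longlonglongrightarrow> (LINT x|M. 0)"
  proof (rule integral_dominated_convergence[where w = k])
    show "(\<lambda>x. k x - min (k x) (real n)) \<in> borel_measurable M" for n using k(1) by measurable
    show "AE x in M. (\<lambda>n. k x - min (k x) (real n)) \<longlonglongrightarrow> 0"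
    proof (rule AE_I2)
      fix x
      obtain N :: nat where "k x \<le> N" using real_arch_simple by blast
      then have "k x - min (k x) (real n) = 0" if "n \<ge> N" for n
        using that by (simp add: min_def)
      then have "\<forall>\<^sub>F n in sequentially. k x - min (k x) (real n) = 0"
        using eventually_sequentially by blast
      then show "(\<lambda>n. k x - min (k x) (real n)) \<longlonglongrightarrow> 0" by (rule tendsto_eventually)
    qed
    show "AE x in M. norm (k x - min (k x) (real n)) \<le> k x" for n using k(2) by (auto simp: min_def)
  qed (use k in auto)
  then have "\<forall>\<^sub>F n in sequentially. (LINT x|M. k x - min (k x) (real n)) < e"
    using e by (intro order_tendstoD(2)[of _ 0]) simp_all
  then show ?thesis using that by (auto simp: eventually_sequentially)
qed

text \<open>
  The converse half. The absolute value of the density is a bounded function plus a function with small integral;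
  over a family of total length $\delta$ the first contributes at most a multiple of $\delta$.
\<close>

lemma ac_primitive_AC_loc:
  assumes fg: "ac_primitive I f g"
  shows "f \<in> AC_loc I"
  unfolding AC_loc_def absolutely_continuous_on_interval_def
proof (intro CollectI allI impI, elim conjE)
  fix c d e :: real assume cd: "c < d" "{c..d} \<subseteq> I" and e: "e > 0"
  define k where "k x = indicator {c..d} x * norm (g x)" for x
  have "set_integrable lebesgue {c..d} (\<lambda>x. norm (g x))"
    using ac_primitiveD(1)[OF fg _ cd(2)] cd(1) by (intro set_integrable_norm) auto
  then have k: "integrable lebesgue k" unfolding k_def set_integrable_def by simp
  have k0: "0 \<le> k x" for x by (simp add: k_def)
  obtain n :: nat where n: "(LINT x|lebesgue. k x - min (k x) n) < e / 2"
    using integral_truncation[OF k k0, of "e / 2"] e by auto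
  define k1 where "k1 x = k x - min (k x) n" for x
  have k1: "\<And>x. 0 \<le> k1 x" "\<And>x. k x \<le> n + k1 x" "\<And>x. k1 x \<le> k x"
    unfolding k1_def using k0 by (auto simp: min_def)
  have k1i: "integrable lebesgue k1"
  proof (rule Bochner_Integration.integrable_bound[OF k])
    show "k1 \<in> borel_measurable lebesgue" unfolding k1_def using k by measurable
    show "AE x in lebesgue. norm (k1 x) \<le> norm (k x)" using k1 k0 by simp
  qed
  show "\<exists>\<delta>>0. \<forall>P. finite P \<and> (\<forall>(s, t)\<in>P. c \<le> s \<and> s \<le> t \<and> t \<le> d) \<and>
         disjoint_family_on (\<lambda>(s, t). {s<..<t}) P \<and> (\<Sum>(s, t)\<in>P. t - s) < \<delta> \<longrightarrow>
         (\<Sum>(s, t)\<in>P. norm (f t - f s)) < e"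
  proof (intro exI[of _ "e / (2 * (real n + 1))"] conjI allI impI)
    show "0 < e / (2 * (real n + 1))" using e by simp
    fix P assume P: "finite P \<and> (\<forall>(s, t)\<in>P. c \<le> s \<and> s \<le> t \<and> t \<le> d) \<and>
         disjoint_family_on (\<lambda>(s, t). {s<..<t}) P \<and> (\<Sum>(s, t)\<in>P. t - s) < e / (2 * (real n + 1))"
    define J where "J p = {fst p<..<snd p :: real}" for p
    have "(\<lambda>(s, t). {s<..<t}) = J" by (auto simp: J_def)
    then have dj: "disjoint_family_on J P" using P by simp
    have int1: "integrable lebesgue (\<lambda>x. indicator (J p) x * k1 x)" for p
      using integrable_real_mult_indicator[OF _ k1i, of "J p"] by (simp add: mult.commute J_def)
    have bound: "norm (f t - f s) \<le> real n * (t - s) + (LINT x|lebesgue. indicator (J (s, t)) x * k1 x)"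
      if st: "c \<le> s" "s \<le> t" "t \<le> d" for s t :: real
    proof -
      have sub: "{s..t} \<subseteq> I" using st cd by auto
      note gD = ac_primitiveD[OF fg st(2) sub]
      have ng: "(\<lambda>x. norm (g x)) absolutely_integrable_on {s..t}" using gD(1) by (rule set_integrable_norm)
      have "norm (f t - f s) \<le> integral {s..t} (\<lambda>x. norm (g x))"
        unfolding gD(2)[symmetric] using gD(3) set_lebesgue_integral_eq_integral(1)[OF ng] by (intro integral_norm_bound_integral) auto
      also have "\<dots> = integral {s<..<t} (\<lambda>x. norm (g x))"
        by (simp add: integral_open_interval_real)
      also have "\<dots> = (LINT x:{s<..<t}|lebesgue. norm (g x))"
        by (rule set_lebesgue_integral_eq_integral(2)[symmetric], rule set_integrable_subset[OF ng]) auto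
      also have "\<dots> = (LINT x|lebesgue. indicator (J (s, t)) x * k x)"
        unfolding set_lebesgue_integral_def using st by (intro Bochner_Integration.integral_cong) (auto simp: J_def k_def indicator_def)
      also have "\<dots> \<le> (LINT x|lebesgue. real n * indicator (J (s, t)) x + indicator (J (s, t)) x * k1 x)"
      proof (rule integral_mono)
        show "integrable lebesgue (\<lambda>x. indicator (J (s, t)) x * k x)"
          using integrable_real_mult_indicator[OF _ k, of "J (s, t)"] by (simp add: mult.commute J_def)
        show "integrable lebesgue (\<lambda>x. real n * indicator (J (s, t)) x + indicator (J (s, t)) x * k1 x)"
          by (intro Bochner_Integration.integrable_add integrable_mult_right int1)
            (use st in \<open>auto simp: J_def integrable_indicator_iff emeasure_lborel_Ioo\<close>)
        show "indicator (J (s, t)) x * k x \<le> real n * indicator (J (s, t)) x + indicator (J (s, t)) x * k1 x" for x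
          using k1(2)[of x] by (auto simp: indicator_def)
      qed
      also have "\<dots> = real n * (t - s) + (LINT x|lebesgue. indicator (J (s, t)) x * k1 x)"
        by (subst Bochner_Integration.integral_add[OF integrable_mult_right int1])
          (use st in \<open>auto simp: J_def integrable_indicator_iff emeasure_lborel_Ioo\<close>)
      finally show ?thesis .
    qed
    have "(\<Sum>(s, t)\<in>P. norm (f t - f s)) \<le> (\<Sum>p\<in>P. real n * (snd p - fst p) + (LINT x|lebesgue. indicator (J p) x * k1 x))"
      using P bound by (intro sum_mono) (auto split: prod.splits)
    also have "\<dots> = real n * (\<Sum>(s, t)\<in>P. t - s) + (LINT x|lebesgue. (\<Sum>p\<in>P. indicator (J p) x * k1 x))"
      by (subst Bochner_Integration.integral_sum) (auto intro: int1 simp: sum.distrib sum_distrib_left split_def)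
    also have "(LINT x|lebesgue. (\<Sum>p\<in>P. indicator (J p) x * k1 x)) \<le> (LINT x|lebesgue. k1 x)"
    proof (rule integral_mono)
      show "integrable lebesgue (\<lambda>x. \<Sum>p\<in>P. indicator (J p) x * k1 x)"
        by (intro Bochner_Integration.integrable_sum int1)
      have "(\<Sum>p\<in>P. indicator (J p) x * k1 x) = indicator (\<Union>(J ` P)) x * k1 x" for x
        using P dj by (simp add: indicator_UN_disjoint sum_distrib_right)
      then show "(\<Sum>p\<in>P. indicator (J p) x * k1 x) \<le> k1 x" for x using k1(1)[of x] by (simp add: indicator_def)
    qed (rule k1i)
    also have "(LINT x|lebesgue. k1 x) < e / 2" using n by (simp add: k1_def)
    also have "real n * (\<Sum>(s, t)\<in>P. t - s) \<le> real n * (e / (2 * (real n + 1)))"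
      using P by (intro mult_left_mono) auto
    also have "real n * (e / (2 * (real n + 1))) \<le> e / 2" using e by (simp add: field_simps)
    finally show "(\<Sum>(s, t)\<in>P. norm (f t - f s)) < e" by simp
  qed
qed

lemma ac_primitive_cong:
  assumes "ac_primitive I f g" "\<And>x. x \<in> I \<Longrightarrow> f x = f' x" "\<And>x. x \<in> I \<Longrightarrow> g x = g' x"
  shows "ac_primitive I f' g'"
proof (rule ac_primitiveI)
  fix a b :: real assume ab: "a \<le> b" "{a..b} \<subseteq> I"
  have eq: "g' x = g x" if "x \<in> {a..b}" for x using assms(3) ab(2) that by auto
  show "g' absolutely_integrable_on {a..b}"
    by (rule absolutely_integrable_spike[OF ac_primitiveD(1)[OF assms(1) ab] negligible_empty]) (use eq in auto)
  have "a \<in> I" "b \<in> I" using ab by auto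
  then show "integral {a..b} g' = f' b - f' a"
    using ac_primitiveD(2)[OF assms(1) ab] assms(2) Henstock_Kurzweil_Integration.integral_cong[of "{a..b}" g' g, OF eq] by simp
qed

lemma ac_primitive_cong_ae:
  assumes I: "open I" and fg: "ac_primitive I f g" and eq: "AE x in lebesgue_on I. g x = g' x"
  shows "ac_primitive I f g'"
proof (rule ac_primitiveI)
  fix a b :: real assume ab: "a \<le> b" "{a..b} \<subseteq> I"
  obtain N where N: "negligible N" "\<And>x. x \<in> I \<Longrightarrow> x \<notin> N \<Longrightarrow> g x = g' x"
    using AE_lebesgue_on_negligibleE[OF I eq] by blast
  have eq: "g' x = g x" if "x \<in> {a..b} - N" for x
  proof -
    have "x \<in> I" "x \<notin> N" using that ab(2) by auto
    then show ?thesis using N(2) by simp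
  qed
  show "g' absolutely_integrable_on {a..b}"
    by (rule absolutely_integrable_spike[OF ac_primitiveD(1)[OF fg ab] N(1) eq])
  have "integral {a..b} g' = integral {a..b} g"
    by (rule integral_spike[OF N(1)]) (simp add: eq)
  then show "integral {a..b} g' = f b - f a" using ac_primitiveD(2)[OF fg ab] by simp
qed

lemma ac_primitive_of_derivative:
  assumes I: "open I" and f: "f \<in> AC_loc I" and d: "AE x in lebesgue_on I. (f has_vector_derivative g x) (at x)"
  shows "ac_primitive I f g"
proof (rule ac_primitive_cong_ae[OF I AC_loc_ac_primitive(1)[OF I f]])
  show "AE x in lebesgue_on I. vector_derivative f (at x) = g x"
    using d by (rule eventually_mono) (rule vector_derivative_at)
qed

lemma ac_primitive_unique:
  assumes I: "open I" and f: "ac_primitive I f g" "ac_primitive I f h"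
  shows "AE x in lebesgue_on I. g x = h x"
  using ac_primitive_has_derivative[OF I f(1)] ac_primitive_has_derivative[OF I f(2)]
  by eventually_elim (rule vector_derivative_unique_at)

lemma ac_primitive_isCont:
  assumes I: "open I" and fg: "ac_primitive I f g" and x: "x \<in> I"
  shows "isCont f x"
proof -
  obtain c d where cd: "c < x" "x < d" "{c..d} \<subseteq> I" using open_has_interval[OF I x] by metis
  have "continuous_on {c..d} (\<lambda>y. f c + integral {c..y} g)"
    using ac_primitiveD(3)[OF fg, of c d] cd by (intro continuous_intros indefinite_integral_continuous_1) auto
  then have "continuous_on {c..d} f"
  proof (rule continuous_on_eq)
    fix y assume "y \<in> {c..d}"
    then have "c \<le> y" "{c..y} \<subseteq> I" using cd by auto
    then show "f c + integral {c..y} g = f y" using ac_primitiveD(2)[OF fg] by simp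
  qed
  then show ?thesis using cd by (intro continuous_on_interior[of "{c..d}"]) auto
qed

lemma ac_primitive_continuous_on:
  assumes "open I" "ac_primitive I f g" "S \<subseteq> I"
  shows "continuous_on S f"
  using ac_primitive_isCont[OF assms(1,2)] assms(3) by (intro continuous_at_imp_continuous_on) blast

lemma ac_primitive_add:
  assumes "ac_primitive I f g" "ac_primitive I f' g'"
  shows "ac_primitive I (\<lambda>x. f x + f' x) (\<lambda>x. g x + g' x)"
proof (rule ac_primitiveI)
  fix a b :: real assume ab: "a \<le> b" "{a..b} \<subseteq> I"
  note D = ac_primitiveD[OF assms(1) ab] ac_primitiveD[OF assms(2) ab]
  show "(\<lambda>x. g x + g' x) absolutely_integrable_on {a..b}" using D(1,4) by (rule set_integral_add)
  show "integral {a..b} (\<lambda>x. g x + g' x) = f b + f' b - (f a + f' a)"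
    using D by (simp add: Henstock_Kurzweil_Integration.integral_add)
qed

lemma ac_primitive_bounded_linear:
  assumes "ac_primitive I f g" "bounded_linear h"
  shows "ac_primitive I (\<lambda>x. h (f x)) (\<lambda>x. h (g x))"
proof (rule ac_primitiveI)
  fix a b :: real assume ab: "a \<le> b" "{a..b} \<subseteq> I"
  note D = ac_primitiveD[OF assms(1) ab]
  show "(\<lambda>x. h (g x)) absolutely_integrable_on {a..b}"
    using absolutely_integrable_linear[OF D(1) assms(2)] by (simp add: o_def)
  show "integral {a..b} (\<lambda>x. h (g x)) = h (f b) - h (f a)"
    using integral_linear[OF D(3) assms(2)] D(2) by (simp add: o_def linear_diff bounded_linear.linear assms(2))
qed

lemma ac_primitive_cmult:
  assumes "ac_primitive I f g"
  shows "ac_primitive I (\<lambda>x. k * f x) (\<lambda>x. k * g x)"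
  by (rule ac_primitive_bounded_linear[OF assms bounded_linear_mult_right])

lemma ac_primitive_cnj:
  assumes "ac_primitive I f g"
  shows "ac_primitive I (\<lambda>x. cnj (f x)) (\<lambda>x. cnj (g x))"
  by (rule ac_primitive_bounded_linear[OF assms bounded_linear_cnj])

lemma ac_primitive_const: "ac_primitive I (\<lambda>x. k) (\<lambda>x. 0)"
  by (rule ac_primitiveI) auto

lemma ac_primitive_diff:
  assumes "ac_primitive I f g" "ac_primitive I f' g'"
  shows "ac_primitive I (\<lambda>x. f x - f' x) (\<lambda>x. g x - g' x)"
  using ac_primitive_add[OF assms(1) ac_primitive_cmult[OF assms(2), of "-1"]] by simp

text \<open>
  Both factors are bounded on a compact interval, and
  $f_1(t)f_2(t) - f_1(s)f_2(s) = f_1(t)(f_2(t)-f_2(s)) + (f_1(t)-f_1(s))f_2(s)$.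
\<close>

lemma AC_loc_mult:
  assumes I: "open I" and f: "f1 \<in> AC_loc I" "f2 \<in> AC_loc I"
  shows "(\<lambda>x. f1 x * f2 x) \<in> AC_loc I"
  unfolding AC_loc_def absolutely_continuous_on_interval_def
proof (intro CollectI allI impI, elim conjE)
  fix c d e :: real assume cd: "c < d" "{c..d} \<subseteq> I" and e: "e > 0"
  have "compact (f1 ` {c..d})" "compact (f2 ` {c..d})"
    using ac_primitive_continuous_on[OF I AC_loc_ac_primitive(1)[OF I f(1)] cd(2)]
      ac_primitive_continuous_on[OF I AC_loc_ac_primitive(1)[OF I f(2)] cd(2)]
    by (auto intro!: compact_continuous_image)
  then have "bounded (f1 ` {c..d})" "bounded (f2 ` {c..d})" by (simp_all add: compact_imp_bounded)
  then obtain B1 B2 where B1: "B1 > 0" "\<forall>x\<in>f1 ` {c..d}. norm x \<le> B1" and B2: "B2 > 0" "\<forall>x\<in>f2 ` {c..d}. norm x \<le> B2"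
    unfolding bounded_pos by (elim exE conjE)
  define B where "B = B1 + B2"
  have B: "B > 0" "norm (f1 x) \<le> B" "norm (f2 x) \<le> B" if "x \<in> {c..d}" for x
    using B1(1) B2(1) bspec[OF B1(2), of "f1 x"] bspec[OF B2(2), of "f2 x"] that unfolding B_def by auto
  have B0: "B > 0" using B1(1) B2(1) by (simp add: B_def)
  have e': "e / (2 * B) > 0" using e B0 by simp
  have ac: "absolutely_continuous_on_interval c d f1" "absolutely_continuous_on_interval c d f2"
    using f cd unfolding AC_loc_def by blast+
  obtain d1 where d1: "d1 > 0" "\<forall>P. finite P \<and> (\<forall>(s, t)\<in>P. c \<le> s \<and> s \<le> t \<and> t \<le> d) \<and>
         disjoint_family_on (\<lambda>(s, t). {s<..<t}) P \<and> (\<Sum>(s, t)\<in>P. t - s) < d1 \<longrightarrow>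
         (\<Sum>(s, t)\<in>P. norm (f1 t - f1 s)) < e / (2 * B)"
    using ac(1)[unfolded absolutely_continuous_on_interval_def, rule_format, OF e'] by (elim exE conjE)
  obtain d2 where d2: "d2 > 0" "\<forall>P. finite P \<and> (\<forall>(s, t)\<in>P. c \<le> s \<and> s \<le> t \<and> t \<le> d) \<and>
         disjoint_family_on (\<lambda>(s, t). {s<..<t}) P \<and> (\<Sum>(s, t)\<in>P. t - s) < d2 \<longrightarrow>
         (\<Sum>(s, t)\<in>P. norm (f2 t - f2 s)) < e / (2 * B)"
    using ac(2)[unfolded absolutely_continuous_on_interval_def, rule_format, OF e'] by (elim exE conjE)
  show "\<exists>\<delta>>0. \<forall>P. finite P \<and> (\<forall>(s, t)\<in>P. c \<le> s \<and> s \<le> t \<and> t \<le> d) \<and>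
         disjoint_family_on (\<lambda>(s, t). {s<..<t}) P \<and> (\<Sum>(s, t)\<in>P. t - s) < \<delta> \<longrightarrow>
         (\<Sum>(s, t)\<in>P. norm (f1 t * f2 t - f1 s * f2 s)) < e"
  proof (intro exI[of _ "min d1 d2"] conjI allI impI)
    show "0 < min d1 d2" using d1(1) d2(1) by simp
    fix P assume P: "finite P \<and> (\<forall>(s, t)\<in>P. c \<le> s \<and> s \<le> t \<and> t \<le> d) \<and>
         disjoint_family_on (\<lambda>(s, t). {s<..<t}) P \<and> (\<Sum>(s, t)\<in>P. t - s) < min d1 d2"
    have "(\<Sum>(s, t)\<in>P. norm (f1 t * f2 t - f1 s * f2 s))
       \<le> (\<Sum>p\<in>P. B * (case p of (s, t) \<Rightarrow> norm (f2 t - f2 s)) + B * (case p of (s, t) \<Rightarrow> norm (f1 t - f1 s)))"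
    proof (rule sum_mono, clarify)
      fix s t assume "(s, t) \<in> P"
      then have st: "s \<in> {c..d}" "t \<in> {c..d}" using P by auto
      have "f1 t * f2 t - f1 s * f2 s = f1 t * (f2 t - f2 s) + (f1 t - f1 s) * f2 s"
        by (simp add: algebra_simps)
      then have "norm (f1 t * f2 t - f1 s * f2 s) \<le> norm (f1 t) * norm (f2 t - f2 s) + norm (f1 t - f1 s) * norm (f2 s)"
        using norm_triangle_ineq[of "f1 t * (f2 t - f2 s)" "(f1 t - f1 s) * f2 s"] by (simp only: norm_mult)
      also have "\<dots> \<le> B * norm (f2 t - f2 s) + norm (f1 t - f1 s) * B"
        using B st by (intro add_mono mult_right_mono mult_left_mono) auto
      finally show "norm (f1 t * f2 t - f1 s * f2 s) \<le> B * norm (f2 t - f2 s) + B * norm (f1 t - f1 s)"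
        by (simp add: mult.commute)
    qed
    also have "\<dots> = B * (\<Sum>(s, t)\<in>P. norm (f2 t - f2 s)) + B * (\<Sum>(s, t)\<in>P. norm (f1 t - f1 s))"
      by (simp add: sum.distrib sum_distrib_left)
    also have "\<dots> < B * (e / (2 * B)) + B * (e / (2 * B))"
      using d1(2)[rule_format, of P] d2(2)[rule_format, of P] P B0 by (intro add_strict_mono mult_strict_left_mono) auto
    also have "\<dots> = e" using B0 by simp
    finally show "(\<Sum>(s, t)\<in>P. norm (f1 t * f2 t - f1 s * f2 s)) < e" .
  qed
qed

text \<open>
  The product rule holds almost everywhere, and since the product is absolutely continuous this determines
  its density. This is the integration by parts behind the Lagrange identity.
\<close>

lemma ac_primitive_mult:
  assumes I: "open I" and f: "ac_primitive I f1 g1" "ac_primitive I f2 g2"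
  shows "ac_primitive I (\<lambda>x. f1 x * f2 x) (\<lambda>x. f1 x * g2 x + g1 x * f2 x)"
proof (rule ac_primitive_of_derivative[OF I])
  show "(\<lambda>x. f1 x * f2 x) \<in> AC_loc I"
    by (rule AC_loc_mult[OF I ac_primitive_AC_loc[OF f(1)] ac_primitive_AC_loc[OF f(2)]])
  show "AE x in lebesgue_on I. ((\<lambda>x. f1 x * f2 x) has_vector_derivative f1 x * g2 x + g1 x * f2 x) (at x)"
    using ac_primitive_has_derivative[OF I f(1)] ac_primitive_has_derivative[OF I f(2)]
    by eventually_elim (rule has_vector_derivative_mult)
qed

lemma segment_subset_interval:
  assumes "is_interval I" "s \<in> I" "(t::real) \<in> I"
  shows "{s..t} \<subseteq> I"
  using mem_is_interval_1_I[OF assms] by (simp add: subset_iff)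

text \<open>
  The set where two continuous functions differ is open, and a nonempty open set is not negligible.
\<close>

lemma continuous_eq_if_AE_eq:
  fixes f g :: "real \<Rightarrow> complex"
  assumes I: "open I" and f: "continuous_on I f" and g: "continuous_on I g"
    and eq: "AE x in lebesgue_on I. f x = g x" and x: "x \<in> I"
  shows "f x = g x"
proof (rule ccontr)
  assume ne: "f x \<noteq> g x"
  let ?U = "I \<inter> (\<lambda>x. f x - g x) -` (- {0})"
  have "open ?U" using I f g by (intro continuous_open_preimage) (auto intro: continuous_intros)
  moreover have "?U \<noteq> {}" using ne x by auto
  moreover have "negligible ?U"
  proof -
    obtain N where "negligible N" "\<And>x. x \<in> I \<Longrightarrow> x \<notin> N \<Longrightarrow> f x = g x"
      using AE_lebesgue_on_negligibleE[OF I eq] by blast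
    then show ?thesis by (elim negligible_subset) auto
  qed
  ultimately show False using open_not_negligible by blast
qed

lemma ac_primitive_zero_const:
  assumes I: "is_interval I" and f: "ac_primitive I f (\<lambda>x. 0)" and x: "x \<in> I" "y \<in> I"
  shows "f x = f y"
proof (cases "x \<le> y")
  case True
  then show ?thesis using ac_primitiveD(2)[OF f True segment_subset_interval[OF I x]] by simp
next
  case False
  then show ?thesis using ac_primitiveD(2)[OF f, of y x] segment_subset_interval[OF I x(2,1)] by simp
qed

section \<open>Linear systems with locally integrable coefficients\<close>

definition locally_integrable :: "real set \<Rightarrow> (real \<Rightarrow> complex) \<Rightarrow> bool" where
  "locally_integrable I g \<longleftrightarrow> (\<forall>a b. {a..b} \<subseteq> I \<longrightarrow> g absolutely_integrable_on {a..b})"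

definition primitive_from :: "real \<Rightarrow> (real \<Rightarrow> complex) \<Rightarrow> real \<Rightarrow> complex" where
  "primitive_from c g x = (if c \<le> x then integral {c..x} g else - integral {x..c} g)"

lemma ac_primitive_from:
  assumes I: "is_interval I" and c: "c \<in> I" and g: "locally_integrable I g"
  shows "ac_primitive I (primitive_from c g) g"
proof (rule ac_primitiveI)
  fix a b :: real assume ab: "a \<le> b" "{a..b} \<subseteq> I"
  then show "g absolutely_integrable_on {a..b}" using g by (simp add: locally_integrable_def)
  have gi: "g integrable_on {s..t}" if "s \<in> I" "t \<in> I" for s t
  proof -
    have "{s..t} \<subseteq> I" using segment_subset_interval[OF I that] .
    then have "g absolutely_integrable_on {s..t}" using g by (simp add: locally_integrable_def)
    then show ?thesis by (rule set_lebesgue_integral_eq_integral(1))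
  qed
  have abI: "a \<in> I" "b \<in> I" using ab by auto
  consider "c \<le> a" | "a < c" "c \<le> b" | "b < c" by linarith
  then show "integral {a..b} g = primitive_from c g b - primitive_from c g a"
  proof cases
    case 1
    then show ?thesis using Henstock_Kurzweil_Integration.integral_combine[where a = c and c = a and b = b and f = g] gi[OF c abI(2)] ab by (auto simp: primitive_from_def algebra_simps)
  next
    case 2
    then show ?thesis using Henstock_Kurzweil_Integration.integral_combine[where a = a and c = c and b = b and f = g] gi[OF abI] by (auto simp: primitive_from_def algebra_simps)
  next
    case 3
    then show ?thesis using Henstock_Kurzweil_Integration.integral_combine[where a = a and c = b and b = c and f = g] gi[OF abI(1) c] ab by (auto simp: primitive_from_def algebra_simps)
  qed
qed

lemma primitive_from_same [simp]: "primitive_from c g c = 0"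
  by (simp add: primitive_from_def)

lemma absolutely_integrable_mult_continuous:
  fixes f g :: "real \<Rightarrow> complex"
  assumes g: "g absolutely_integrable_on {a..b}" and f: "continuous_on {a..b} f"
  shows "(\<lambda>x. f x * g x) absolutely_integrable_on {a..b}"
proof -
  have bl: "bilinear ((*) :: complex \<Rightarrow> complex \<Rightarrow> complex)"
    by (simp add: bilinear_conv_bounded_bilinear bounded_bilinear_mult)
  have m: "f \<in> borel_measurable (lebesgue_on {a..b})"
    by (rule continuous_imp_measurable_on_sets_lebesgue[OF f]) simp
  have b: "bounded (f ` {a..b})" using f compact_continuous_image compact_imp_bounded compact_Icc by blast
  show ?thesis
    using absolutely_integrable_bounded_measurable_product[OF bl m _ b g] by simp
qed

lemma locally_integrable_mult:
  assumes g: "locally_integrable I g" and f: "continuous_on I f"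
  shows "locally_integrable I (\<lambda>x. f x * g x)"
  unfolding locally_integrable_def
proof (intro allI impI)
  fix a b :: real assume ab: "{a..b} \<subseteq> I"
  show "(\<lambda>x. f x * g x) absolutely_integrable_on {a..b}"
    using g ab continuous_on_subset[OF f ab] unfolding locally_integrable_def
    by (intro absolutely_integrable_mult_continuous) auto
qed

lemma locally_integrable_add:
  assumes "locally_integrable I f" "locally_integrable I g"
  shows "locally_integrable I (\<lambda>x. f x + g x)"
  using assms unfolding locally_integrable_def by (auto intro!: set_integral_add)

lemma locally_integrable_norm:
  assumes "locally_integrable I f"
  shows "locally_integrable I (\<lambda>x. of_real (norm (f x)))"
  unfolding locally_integrable_def
proof (intro allI impI)
  fix a b :: real assume ab: "{a..b} \<subseteq> I"
  have "(\<lambda>x. norm (f x)) absolutely_integrable_on {a..b}"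
    using assms ab unfolding locally_integrable_def by (intro set_integrable_norm) auto
  from absolutely_integrable_linear[OF this bounded_linear_of_real]
  show "(\<lambda>x. complex_of_real (norm (f x))) absolutely_integrable_on {a..b}" by (simp add: o_def)
qed

text \<open>
  The iterated integrals in the Picard estimate: $W^{n+1}/(n+1)!$ is a primitive of $W' W^n/n!$.
\<close>

lemma ac_primitive_power:
  assumes I: "open I" and W: "ac_primitive I W w"
  shows "ac_primitive I (\<lambda>x. W x ^ Suc n / fact (Suc n)) (\<lambda>x. w x * (W x ^ n / fact n))"
proof (induction n)
  case 0
  then show ?case using W by simp
next
  case (Suc n)
  have eq: "(1 / of_nat (n + 2) :: complex) * (W x ^ Suc n / fact (Suc n) * w x + w x * (W x ^ n / fact n) * W x)
      = w x * (W x ^ Suc n / fact (Suc n))" for x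
  proof -
    define a where "a = w x * (W x ^ Suc n / fact (Suc n))"
    have "w x * (W x ^ n / fact n) * W x = of_nat (Suc n) * a"
      unfolding a_def by (simp add: fact_Suc del: of_nat_Suc)
    moreover have "W x ^ Suc n / fact (Suc n) * w x = a" by (simp add: a_def)
    ultimately have "W x ^ Suc n / fact (Suc n) * w x + w x * (W x ^ n / fact n) * W x = of_nat (n + 2) * a"
      by (simp only: of_nat_add of_nat_Suc) (simp add: algebra_simps)
    moreover have "of_nat (n + 2) \<noteq> (0 :: complex)" by (simp only: of_nat_eq_0_iff)
    ultimately show ?thesis unfolding a_def[symmetric] by (simp only: mult.assoc[symmetric] divide_self_if if_False times_divide_eq_left mult_1)
  qed
  have eq2: "(1 / of_nat (n + 2)) * (W x ^ Suc n / fact (Suc n) * W x) = W x ^ Suc (Suc n) / fact (Suc (Suc n))" for x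
    by (simp add: fact_Suc mult.commute)
  show ?case
    using ac_primitive_cmult[OF ac_primitive_mult[OF I Suc W], of "1 / of_nat (n + 2)"] unfolding eq eq2 .
qed

text \<open>
  The terms of the Picard series of $y' = Av$, $v' = By$; its partial sums are the usual Picard iterates.
\<close>

fun picard :: "real \<Rightarrow> (real \<Rightarrow> complex) \<Rightarrow> (real \<Rightarrow> complex) \<Rightarrow> complex \<Rightarrow> complex \<Rightarrow> nat \<Rightarrow> (real \<Rightarrow> complex) \<times> (real \<Rightarrow> complex)" where
  "picard c A B y0 v0 0 = (\<lambda>_. y0, \<lambda>_. v0)"
| "picard c A B y0 v0 (Suc n) =
     (primitive_from c (\<lambda>x. snd (picard c A B y0 v0 n) x * A x),
      primitive_from c (\<lambda>x. fst (picard c A B y0 v0 n) x * B x))"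

lemma picard_continuous:
  assumes I: "open I" "is_interval I" and c: "c \<in> I" and AB: "locally_integrable I A" "locally_integrable I B"
  shows "continuous_on I (fst (picard c A B y0 v0 n)) \<and> continuous_on I (snd (picard c A B y0 v0 n))"
proof (induction n)
  case (Suc n)
  then show ?case
    using ac_primitive_continuous_on[OF I(1) ac_primitive_from[OF I(2) c locally_integrable_mult[OF AB(1)]]]
      ac_primitive_continuous_on[OF I(1) ac_primitive_from[OF I(2) c locally_integrable_mult[OF AB(2)]]]
    by simp
qed simp

text \<open>
  With $R$ a primitive of the majorant $w$ that vanishes at $c$, the $n$-th term is bounded by $C|R|^n/n!$ on
  both sides of $c$; to the left of $c$ one has $R \le 0$ and $|R|^n = (-1)^n R^n$.
\<close>

lemma picard_step_bound:
  assumes I: "open I" "is_interval I" and c: "c \<in> I" and A: "locally_integrable I A" and f: "continuous_on I f"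
    and W: "ac_primitive I (\<lambda>x. of_real (R x)) (\<lambda>x. of_real (w x))" and wA: "\<And>x. norm (A x) \<le> w x"
    and Rc: "R c = 0" and fb: "\<And>x. x \<in> I \<Longrightarrow> norm (f x) \<le> C * \<bar>R x\<bar> ^ n / fact n" and x: "x \<in> I"
  shows "norm (primitive_from c (\<lambda>x. f x * A x) x) \<le> C * \<bar>R x\<bar> ^ Suc n / fact (Suc n)"
proof -
  have w0: "0 \<le> w x" for x using wA[of x] norm_ge_zero order_trans by blast
  have sub: "{s..t} \<subseteq> I" if "s \<in> I" "t \<in> I" for s t
    by (rule segment_subset_interval[OF I(2) that])
  have Rmono: "R s \<le> R t" if st: "s \<le> t" "s \<in> I" "t \<in> I" for s t
  proof -
    have "((\<lambda>x. complex_of_real (w x)) has_integral of_real (R t) - of_real (R s)) {s..t}"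
      using ac_primitiveD(2,3)[OF W st(1) sub[OF st(2,3)]] by (simp add: has_integral_iff)
    from has_integral_linear[OF this bounded_linear_Re] have "(w has_integral R t - R s) {s..t}"
      by (simp add: o_def)
    from has_integral_nonneg[OF this] w0 show ?thesis by simp
  qed
  have P: "ac_primitive I (\<lambda>x. of_real (R x) ^ Suc n / fact (Suc n)) (\<lambda>x. of_real (w x) * (of_real (R x) ^ n / fact n))"
    using ac_primitive_power[OF I(1) W] by simp
  have real_int: "((\<lambda>x. w x * (R x ^ n / fact n)) has_integral (R t ^ Suc n / fact (Suc n) - R s ^ Suc n / fact (Suc n))) {s..t}"
    if st: "s \<le> t" "s \<in> I" "t \<in> I" for s t
  proof -
    have "((\<lambda>x. complex_of_real (w x) * (of_real (R x) ^ n / fact n)) has_integral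
        of_real (R t) ^ Suc n / fact (Suc n) - of_real (R s) ^ Suc n / fact (Suc n)) {s..t}"
      using ac_primitiveD(2,3)[OF P st(1) sub[OF st(2,3)]] by (simp add: has_integral_iff)
    then have "((\<lambda>x. complex_of_real (w x * (R x ^ n / fact n))) has_integral
        of_real (R t ^ Suc n / fact (Suc n) - R s ^ Suc n / fact (Suc n))) {s..t}" by simp
    from has_integral_linear[OF this bounded_linear_Re] show ?thesis by (simp only: o_def Re_complex_of_real)
  qed
  have fA: "(\<lambda>x. f x * A x) integrable_on {s..t}" if "s \<in> I" "t \<in> I" for s t
  proof -
    have "(\<lambda>x. f x * A x) absolutely_integrable_on {s..t}"
      using locally_integrable_mult[OF A f] sub[OF that] by (simp add: locally_integrable_def)
    then show ?thesis by (rule set_lebesgue_integral_eq_integral(1))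
  qed
  have C: "norm (f x * A x) \<le> C * (w x * (\<bar>R x\<bar> ^ n / fact n))" if "x \<in> I" for x
  proof -
    have "norm (f x * A x) \<le> (C * \<bar>R x\<bar> ^ n / fact n) * w x"
      unfolding norm_mult using fb[OF that] wA[of x] order_trans[OF norm_ge_zero fb[OF that]] by (intro mult_mono) auto
    then show ?thesis by (simp add: mult_ac)
  qed
  show ?thesis
  proof (cases "c \<le> x")
    case True
    have R0: "0 \<le> R t" if "t \<in> {c..x}" for t using Rmono[of c t] that Rc sub[OF c x] c by auto
    have "norm (integral {c..x} (\<lambda>x. f x * A x)) \<le> integral {c..x} (\<lambda>x. C * (w x * (R x ^ n / fact n)))"
    proof (rule integral_norm_bound_integral[OF fA[OF c x]])
      show "(\<lambda>x. C * (w x * (R x ^ n / fact n))) integrable_on {c..x}"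
        using real_int[OF True c x] by (intro integrable_on_mult_right) (auto simp: integrable_on_def)
      show "norm (f t * A t) \<le> C * (w t * (R t ^ n / fact n))" if "t \<in> {c..x}" for t
        using C[of t] R0[OF that] sub[OF c x] that by auto
    qed
    also have "\<dots> = C * (R x ^ Suc n / fact (Suc n))"
      unfolding integral_unique[OF has_integral_mult_right[OF real_int[OF True c x], of C]] using Rc by simp
    finally show ?thesis using True R0[of x] by (simp add: primitive_from_def)
  next
    case False
    then have xc: "x \<le> c" by simp
    have R0: "R t \<le> 0" if "t \<in> {x..c}" for t using Rmono[of t c] that Rc sub[OF x c] c by auto
    have ab: "\<bar>R t\<bar> ^ m = (-1) ^ m * R t ^ m" if "t \<in> {x..c}" for t m
      using R0[OF that] by (simp add: power_mult_distrib[symmetric])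
    have "norm (integral {x..c} (\<lambda>x. f x * A x)) \<le> integral {x..c} (\<lambda>x. (C * (-1) ^ n) * (w x * (R x ^ n / fact n)))"
    proof (rule integral_norm_bound_integral[OF fA[OF x c]])
      show "(\<lambda>x. (C * (-1) ^ n) * (w x * (R x ^ n / fact n))) integrable_on {x..c}"
        using real_int[OF xc x c] by (intro integrable_on_mult_right) (auto simp: integrable_on_def)
      show "norm (f t * A t) \<le> (C * (-1) ^ n) * (w t * (R t ^ n / fact n))" if "t \<in> {x..c}" for t
      proof -
        have "t \<in> I" using sub[OF x c] that by auto
        from C[OF this] show ?thesis unfolding ab[OF that] by (simp add: mult_ac)
      qed
    qed
    also have "\<dots> = (C * (-1) ^ n) * (0 - R x ^ Suc n / fact (Suc n))"
      unfolding integral_unique[OF has_integral_mult_right[OF real_int[OF xc x c], of "C * (-1) ^ n"]] using Rc by simp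
    also have "\<dots> = C * \<bar>R x\<bar> ^ Suc n / fact (Suc n)"
      using ab[of x "Suc n"] xc by simp
    finally show ?thesis using False by (simp add: primitive_from_def)
  qed
qed

text \<open>
  The Picard series is dominated by the exponential series of $|R|$, which is bounded on compact intervals.
  So it converges on the whole interval at once, and dominated convergence permits passing to the limit in
  the integral equations.
\<close>

theorem linear_system_solution_exists:
  assumes I: "open I" "is_interval I" and c: "c \<in> I" and AB: "locally_integrable I A" "locally_integrable I B"
  obtains y v where "ac_primitive I y (\<lambda>x. A x * v x)" "ac_primitive I v (\<lambda>x. B x * y x)" "y c = y0" "v c = v0"
proof -
  define w where "w x = norm (A x) + norm (B x)" for x
  define Y where "Y n = fst (picard c A B y0 v0 n)" for n
  define V where "V n = snd (picard c A B y0 v0 n)" for n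
  have wloc: "locally_integrable I (\<lambda>x. of_real (w x))"
    unfolding w_def of_real_add by (intro locally_integrable_add locally_integrable_norm AB)
  define W where "W = primitive_from c (\<lambda>x. of_real (w x))"
  define R where "R x = Re (W x)" for x
  have W: "ac_primitive I W (\<lambda>x. of_real (w x))" unfolding W_def by (rule ac_primitive_from[OF I(2) c wloc])
  have "ac_primitive I (\<lambda>x. complex_of_real (R x)) (\<lambda>x. complex_of_real (w x))"
    using ac_primitive_bounded_linear[OF W bounded_linear_compose[OF bounded_linear_of_real bounded_linear_Re]]
    by (simp add: R_def)
  note WR = this
  have Rc: "R c = 0" by (simp add: R_def W_def)
  define C where "C = norm y0 + norm v0"
  have contY: "continuous_on I (Y n)" and contV: "continuous_on I (V n)" for n
    using picard_continuous[OF I c AB] by (auto simp: Y_def V_def)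
  have Y0: "Y 0 = (\<lambda>_. y0)" "V 0 = (\<lambda>_. v0)" by (simp_all add: Y_def V_def)
  have YS: "Y (Suc n) = primitive_from c (\<lambda>x. V n x * A x)" "V (Suc n) = primitive_from c (\<lambda>x. Y n x * B x)" for n
    by (simp_all add: Y_def V_def)
  have bound: "norm (Y n x) \<le> C * \<bar>R x\<bar> ^ n / fact n \<and> norm (V n x) \<le> C * \<bar>R x\<bar> ^ n / fact n" if "x \<in> I" for n x
    using that
  proof (induction n arbitrary: x)
    case 0
    then show ?case by (simp add: Y0 C_def)
  next
    case (Suc n)
    show ?case unfolding YS
      using picard_step_bound[OF I c AB(1) contV WR _ Rc _ Suc.prems, of n C n]
        picard_step_bound[OF I c AB(2) contY WR _ Rc _ Suc.prems, of n C n] Suc.IH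
      by (simp add: w_def)
  qed
  define y where "y x = (\<Sum>n. Y n x)" for x
  define v where "v x = (\<Sum>n. V n x)" for x
  have exp_sum: "summable (\<lambda>n. C * \<bar>R x\<bar> ^ n / fact n)" for x
    using summable_mult[OF summable_exp_generic[of "\<bar>R x\<bar>"], of C] by (simp add: divide_inverse mult_ac)
  have sums: "(\<lambda>n. Y n x) sums y x" "(\<lambda>n. V n x) sums v x" if "x \<in> I" for x
  proof -
    have "summable (\<lambda>n. Y n x)" "summable (\<lambda>n. V n x)"
      by (rule summable_comparison_test'[OF exp_sum[of x], of 0], use bound[OF that] in blast)+
    then show "(\<lambda>n. Y n x) sums y x" "(\<lambda>n. V n x) sums v x"
      unfolding y_def v_def by (simp_all add: summable_sums)
  qed
  have partial: "norm (\<Sum>n<N. Z n) \<le> C * exp \<bar>R x\<bar>"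
    if Z: "\<And>n. norm (Z n) \<le> C * \<bar>R x\<bar> ^ n / fact n" for N x and Z :: "nat \<Rightarrow> complex"
  proof -
    have "norm (\<Sum>n<N. Z n) \<le> (\<Sum>n<N. C * \<bar>R x\<bar> ^ n / fact n)" by (rule sum_norm_le) (rule Z)
    also have "\<dots> \<le> (\<Sum>n. C * \<bar>R x\<bar> ^ n / fact n)"
      by (rule sum_le_suminf[OF exp_sum]) (auto simp: C_def)
    also have "\<dots> = C * exp \<bar>R x\<bar>"
      unfolding exp_def using suminf_mult[OF summable_exp_generic[of "\<bar>R x\<bar>"], of C] by (simp add: divide_inverse mult_ac)
    finally show ?thesis .
  qed
  \<comment> \<open>The limit passage, common to both equations of the system.\<close>
  have lim: "ac_primitive I f (\<lambda>x. D x * g x)"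
    if D: "locally_integrable I D"
      and F: "\<And>n. F (Suc n) = primitive_from c (\<lambda>x. G n x * D x)" "F 0 = (\<lambda>_. k)"
      and G: "\<And>n. continuous_on I (G n)" "\<And>n x. x \<in> I \<Longrightarrow> norm (G n x) \<le> C * \<bar>R x\<bar> ^ n / fact n"
      and f: "\<And>x. x \<in> I \<Longrightarrow> (\<lambda>n. F n x) sums f x" and g: "\<And>x. x \<in> I \<Longrightarrow> (\<lambda>n. G n x) sums g x"
    for D f g F G k
  proof (rule ac_primitiveI)
    fix a b :: real assume ab: "a \<le> b" "{a..b} \<subseteq> I"
    have FS: "ac_primitive I (F (Suc n)) (\<lambda>x. G n x * D x)" for n
      unfolding F by (rule ac_primitive_from[OF I(2) c locally_integrable_mult[OF D G(1)]])
    have prim: "ac_primitive I (\<lambda>x. \<Sum>n<Suc N. F n x) (\<lambda>x. (\<Sum>n<N. G n x) * D x)" for N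
    proof (induction N)
      case 0
      then show ?case using ac_primitive_const[of I k] by (simp add: F)
    next
      case (Suc N)
      from ac_primitive_add[OF Suc FS[of N]] show ?case by (simp add: algebra_simps)
    qed
    have "continuous_on {a..b} R"
      using ac_primitive_continuous_on[OF I(1) W ab(2)] unfolding R_def by (intro continuous_intros)
    then have "bounded (R ` {a..b})" by (intro compact_imp_bounded compact_continuous_image) auto
    then obtain M where M: "\<forall>r\<in>R ` {a..b}. norm r \<le> M" unfolding bounded_iff by blast
    have C0: "C \<ge> 0" by (simp add: C_def)
    have Dn: "(\<lambda>x. norm (D x)) integrable_on {a..b}" "D absolutely_integrable_on {a..b}"
      using D ab(2) unfolding locally_integrable_def absolutely_integrable_on_def by auto
    have h: "(\<lambda>x. C * exp M * norm (D x)) integrable_on {a..b}" using Dn(1) by (rule integrable_on_mult_right)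
    have le: "norm ((\<Sum>n<N. G n x) * D x) \<le> C * exp M * norm (D x)" if x: "x \<in> {a..b}" for N x
    proof -
      have "norm (\<Sum>n<N. G n x) \<le> C * exp \<bar>R x\<bar>" using G(2) ab(2) x by (intro partial) auto
      also have "\<dots> \<le> C * exp M" using M x C0 by (intro mult_left_mono) auto
      finally show ?thesis unfolding norm_mult by (rule mult_right_mono) simp
    qed
    have conv: "(\<lambda>N. (\<Sum>n<N. G n x) * D x) \<longlonglongrightarrow> g x * D x" if "x \<in> {a..b}" for x
      using g[of x] ab(2) that unfolding sums_def by (intro tendsto_mult tendsto_const) auto
    have pint: "(\<lambda>x. (\<Sum>n<N. G n x) * D x) integrable_on {a..b}"
      "integral {a..b} (\<lambda>x. (\<Sum>n<N. G n x) * D x) = (\<Sum>n<Suc N. F n b) - (\<Sum>n<Suc N. F n a)" for N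
      using ac_primitiveD(2,3)[OF prim ab] by blast+
    note dom = dominated_convergence[OF pint(1) h le conv]
    have dom1: "(\<lambda>x. g x * D x) integrable_on {a..b}" using dom(1) by blast
    have abI: "a \<in> I" "b \<in> I" using ab by auto
    have "(\<lambda>N. (\<Sum>n<Suc N. F n b) - (\<Sum>n<Suc N. F n a)) \<longlonglongrightarrow> f b - f a"
      using f[OF abI(1)] f[OF abI(2)] unfolding sums_def by (intro tendsto_diff LIMSEQ_Suc) auto
    then have "integral {a..b} (\<lambda>x. g x * D x) = f b - f a"
      using LIMSEQ_unique[OF dom(2)[unfolded pint(2)]] by blast
    then show "integral {a..b} (\<lambda>x. D x * g x) = f b - f a" by (simp add: mult.commute)
    have "(\<lambda>x. g x * D x) absolutely_integrable_on {a..b}"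
    proof (rule absolutely_integrable_integrable_bound[OF _ dom1 h])
      fix x assume x: "x \<in> {a..b}"
      show "norm (g x * D x) \<le> C * exp M * norm (D x)"
        using le[OF x] by (intro LIMSEQ_le_const2[OF tendsto_norm[OF conv[OF x]]]) auto
    qed
    then show "(\<lambda>x. D x * g x) absolutely_integrable_on {a..b}" by (simp add: mult.commute)
  qed
  have Yc: "Y n c = (if n = 0 then y0 else 0)" "V n c = (if n = 0 then v0 else 0)" for n
    by (cases n; simp add: Y0 YS)+
  show ?thesis
  proof (rule that[of y v])
    show "ac_primitive I y (\<lambda>x. A x * v x)"
      by (rule lim[OF AB(1) YS(1) Y0(1) contV]) (use bound sums in auto)
    show "ac_primitive I v (\<lambda>x. B x * y x)"
      by (rule lim[OF AB(2) YS(2) Y0(2) contY]) (use bound sums in auto)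
    show "y c = y0" "v c = v0"
      using sums_unique2[OF sums(1)[OF c]] sums_unique2[OF sums(2)[OF c]]
        sums_single[of 0 "\<lambda>_. y0"] sums_single[of 0 "\<lambda>_. v0"] unfolding Yc by auto
  qed
qed

section \<open>The Sturm--Liouville expression as a first-order system\<close>

locale sl_expression =
  fixes \<tau> :: sl_expr
  assumes sl: "sturm_liouville \<tau>"
begin

abbreviation "I \<equiv> sl_dom \<tau>"
abbreviation "p \<equiv> coeff_p \<tau>"
abbreviation "q \<equiv> coeff_q \<tau>"
abbreviation "r \<equiv> coeff_r \<tau>"
abbreviation "M \<equiv> weight \<tau>"

lemma open_I: "open I"
proof -
  have "I = ereal -` {lower_end \<tau><..<upper_end \<tau>}" by (auto simp: sl_dom_def)
  then show ?thesis by (simp add: open_ereal_vimage)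
qed

lemma interval_I: "is_interval I"
  unfolding is_interval_1 sl_dom_def
  by (metis (mono_tags, lifting) mem_Collect_eq ereal_less_eq(3) le_less_trans less_le_trans)

lemma I_nonempty: "\<exists>c. c \<in> I"
proof -
  have "lower_end \<tau> < upper_end \<tau>" using sl by (simp add: sturm_liouville_def)
  then obtain x where "lower_end \<tau> < ereal x" "ereal x < upper_end \<tau>" using ereal_dense2 by blast
  then show ?thesis by (auto simp: sl_dom_def)
qed

lemma sets_I [measurable, simp]: "I \<in> sets lebesgue"
  using open_I by (simp add: borel_open)

lemma p_pos: "AE x in lebesgue_on I. p x > 0" and r_pos: "AE x in lebesgue_on I. r x > 0"
  and r_meas [measurable]: "r \<in> borel_measurable (lebesgue_on I)"
  using sl by (auto simp: sturm_liouville_def)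

lemma L1_loc_locally_integrable:
  assumes "f \<in> L1_loc I"
  shows "locally_integrable I (\<lambda>x. complex_of_real (f x))"
  unfolding locally_integrable_def
proof (intro allI impI)
  fix a b :: real assume "{a..b} \<subseteq> I"
  then have "f absolutely_integrable_on {a..b}" using assms by (simp add: L1_loc_def)
  from absolutely_integrable_linear[OF this bounded_linear_of_real]
  show "(\<lambda>x. complex_of_real (f x)) absolutely_integrable_on {a..b}" by (simp add: o_def)
qed

lemma coeffs_locally_integrable:
  "locally_integrable I (\<lambda>x. 1 / complex_of_real (p x))"
  "locally_integrable I (\<lambda>x. complex_of_real (q x))"
  "locally_integrable I (\<lambda>x. complex_of_real (r x))"
  using sl L1_loc_locally_integrable[of "\<lambda>x. 1 / p x"] L1_loc_locally_integrable[of q] L1_loc_locally_integrable[of r]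
  by (auto simp: sturm_liouville_def)

text \<open>
  The function $f$ has quasi-derivative $h = pf'$ and $\tau f = w$, in integral form. By \<open>frakD_sl_pair\<close> and
  \<open>sl_pair_frakD\<close> the functions with such $h$ and $w$ are those of \<open>frakD \<tau>\<close>;
  this form is visibly linear and compatible with complex conjugation.
\<close>

definition sl_pair :: "(real \<Rightarrow> complex) \<Rightarrow> (real \<Rightarrow> complex) \<Rightarrow> (real \<Rightarrow> complex) \<Rightarrow> bool" where
  "sl_pair f h w \<longleftrightarrow> ac_primitive I f (\<lambda>x. h x / of_real (p x)) \<and>
     ac_primitive I h (\<lambda>x. of_real (q x) * f x - of_real (r x) * w x)"

lemma sl_pairD:
  assumes "sl_pair f h w"
  shows "ac_primitive I f (\<lambda>x. h x / of_real (p x))"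
    "ac_primitive I h (\<lambda>x. of_real (q x) * f x - of_real (r x) * w x)"
    "continuous_on I f" "continuous_on I h"
  using assms ac_primitive_continuous_on[OF open_I] unfolding sl_pair_def by blast+

lemma frakD_sl_pair:
  assumes "f \<in> frakD \<tau>"
  shows "sl_pair f (quasi_deriv \<tau> f) (sl_apply \<tau> f)"
proof -
  let ?h = "quasi_deriv \<tau> f"
  have f: "f \<in> AC_loc I" and "\<exists>h. is_quasi_deriv \<tau> f h" using assms by (auto simp: frakD_def)
  then have "is_quasi_deriv \<tau> f ?h" unfolding quasi_deriv_def by (metis someI_ex)
  then have h: "?h \<in> AC_loc I" "AE x in lebesgue_on I. ?h x = of_real (p x) * vector_derivative f (at x)"
    by (auto simp: is_quasi_deriv_def)
  have "AE x in lebesgue_on I. vector_derivative f (at x) = ?h x / of_real (p x)"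
    using h(2) p_pos by eventually_elim simp
  from ac_primitive_cong_ae[OF open_I AC_loc_ac_primitive(1)[OF open_I f] this]
  have 1: "ac_primitive I f (\<lambda>x. ?h x / of_real (p x))" .
  have "AE x in lebesgue_on I. vector_derivative ?h (at x) = of_real (q x) * f x - of_real (r x) * sl_apply \<tau> f x"
    using r_pos by eventually_elim (simp add: sl_apply_def)
  from ac_primitive_cong_ae[OF open_I AC_loc_ac_primitive(1)[OF open_I h(1)] this]
  have "ac_primitive I ?h (\<lambda>x. of_real (q x) * f x - of_real (r x) * sl_apply \<tau> f x)" .
  with 1 show ?thesis by (simp add: sl_pair_def)
qed

text \<open>
  A quasi-derivative is continuous and determined almost everywhere, hence unique on the interval; the one chosen by
  \<open>quasi_deriv\<close> is therefore $h$.
\<close>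

lemma sl_pair_frakD:
  assumes "sl_pair f h w"
  shows "f \<in> frakD \<tau>" "\<And>x. x \<in> I \<Longrightarrow> quasi_deriv \<tau> f x = h x" "AE x in lebesgue_on I. sl_apply \<tau> f x = w x"
proof -
  note D = sl_pairD[OF assms]
  have qd: "is_quasi_deriv \<tau> f h"
    unfolding is_quasi_deriv_def
  proof
    show "h \<in> AC_loc I" by (rule ac_primitive_AC_loc[OF D(2)])
    show "AE x in lebesgue_on I. h x = of_real (p x) * vector_derivative f (at x)"
      using ac_primitive_has_derivative[OF open_I D(1)] p_pos
      by eventually_elim (simp add: vector_derivative_at)
  qed
  show f: "f \<in> frakD \<tau>" using qd ac_primitive_AC_loc[OF D(1)] by (auto simp: frakD_def)
  have "is_quasi_deriv \<tau> f (quasi_deriv \<tau> f)" unfolding quasi_deriv_def using someI[of "is_quasi_deriv \<tau> f", OF qd] .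
  then have "AE x in lebesgue_on I. quasi_deriv \<tau> f x = h x"
    using qd unfolding is_quasi_deriv_def by (auto elim: eventually_elim2)
  then show eq: "quasi_deriv \<tau> f x = h x" if "x \<in> I" for x
    using continuous_eq_if_AE_eq[OF open_I sl_pairD(4)[OF frakD_sl_pair[OF f]] D(4) _ that] by blast
  have "AE x in lebesgue_on I. x \<in> I" by (rule AE_I2) simp
  then show "AE x in lebesgue_on I. sl_apply \<tau> f x = w x"
    using ac_primitive_has_derivative[OF open_I D(2)] r_pos
  proof eventually_elim
    case (elim x)
    have "(quasi_deriv \<tau> f has_vector_derivative of_real (q x) * f x - of_real (r x) * w x) (at x)"
      by (rule has_vector_derivative_transform_within_open[OF elim(2) open_I elim(1)]) (simp add: eq)
    then show ?case using elim(3) by (simp add: sl_apply_def vector_derivative_at)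
  qed
qed

lemma sl_pair_cong_ae:
  assumes "sl_pair f h w" "AE x in lebesgue_on I. w x = w' x"
  shows "sl_pair f h w'"
  unfolding sl_pair_def
proof
  show "ac_primitive I f (\<lambda>x. h x / of_real (p x))" by (rule sl_pairD(1)[OF assms(1)])
  show "ac_primitive I h (\<lambda>x. of_real (q x) * f x - of_real (r x) * w' x)"
    by (rule ac_primitive_cong_ae[OF open_I sl_pairD(2)[OF assms(1)]])
      (use assms(2) in eventually_elim, simp)
qed

lemma sl_pair_cong:
  assumes "sl_pair f h w" "\<And>x. x \<in> I \<Longrightarrow> f x = f' x" "\<And>x. x \<in> I \<Longrightarrow> h x = h' x" "\<And>x. x \<in> I \<Longrightarrow> w x = w' x"
  shows "sl_pair f' h' w'"
  using assms ac_primitive_cong unfolding sl_pair_def by (smt (verit, best))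

lemma sl_pair_add:
  assumes "sl_pair f h w" "sl_pair f' h' w'"
  shows "sl_pair (\<lambda>x. f x + f' x) (\<lambda>x. h x + h' x) (\<lambda>x. w x + w' x)"
  using ac_primitive_add[OF sl_pairD(1)[OF assms(1)] sl_pairD(1)[OF assms(2)]]
    ac_primitive_add[OF sl_pairD(2)[OF assms(1)] sl_pairD(2)[OF assms(2)]]
  by (simp add: sl_pair_def algebra_simps add_divide_distrib)

lemma sl_pair_cmult:
  assumes "sl_pair f h w"
  shows "sl_pair (\<lambda>x. k * f x) (\<lambda>x. k * h x) (\<lambda>x. k * w x)"
  using ac_primitive_cmult[OF sl_pairD(1)[OF assms], of k] ac_primitive_cmult[OF sl_pairD(2)[OF assms], of k]
  by (simp add: sl_pair_def algebra_simps)

lemma sl_pair_cnj: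
  assumes "sl_pair f h w"
  shows "sl_pair (\<lambda>x. cnj (f x)) (\<lambda>x. cnj (h x)) (\<lambda>x. cnj (w x))"
  using ac_primitive_cnj[OF sl_pairD(1)[OF assms]] ac_primitive_cnj[OF sl_pairD(2)[OF assms]]
  by (simp add: sl_pair_def)

lemma sl_pair_zero_imp:
  assumes "sl_pair f h w" "\<And>x. x \<in> I \<Longrightarrow> f x = 0" "x \<in> I"
  shows "h x = 0"
proof -
  have "ac_primitive I f (\<lambda>x. 0)"
    by (rule ac_primitive_cong[OF ac_primitive_const[of I 0]]) (simp_all add: assms(2))
  from ac_primitive_unique[OF open_I sl_pairD(1)[OF assms(1)] this]
  have "AE x in lebesgue_on I. h x = 0" using p_pos by eventually_elim simp
  then show ?thesis
    using continuous_eq_if_AE_eq[OF open_I sl_pairD(4)[OF assms(1)] continuous_on_const[of I 0] _ assms(3)] by blast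
qed

text \<open>
  The bilinear form, without conjugation: in the product rule the terms with $1/p$ and with $q$ cancel.
\<close>

lemma lagrange_identity:
  assumes "sl_pair f h w" "sl_pair g k v"
  shows "ac_primitive I (\<lambda>x. f x * k x - h x * g x) (\<lambda>x. of_real (r x) * (w x * g x - f x * v x))"
proof -
  have "ac_primitive I (\<lambda>x. f x * k x - h x * g x)
     (\<lambda>x. (f x * (of_real (q x) * g x - of_real (r x) * v x) + h x / of_real (p x) * k x)
        - (h x * (k x / of_real (p x)) + (of_real (q x) * f x - of_real (r x) * w x) * g x))"
    by (intro ac_primitive_diff ac_primitive_mult[OF open_I] sl_pairD(1,2)[OF assms(1)] sl_pairD(1,2)[OF assms(2)])
  then show ?thesis by (rule ac_primitive_cong) (simp_all add: algebra_simps)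
qed

lemma sl_solution_pair:
  assumes "c \<in> I"
  obtains y h where "sl_pair y h (\<lambda>x. z * y x)" "y c = y0" "h c = h0"
proof -
  have B: "locally_integrable I (\<lambda>x. of_real (q x) + (- z) * of_real (r x))"
    by (intro locally_integrable_add locally_integrable_mult coeffs_locally_integrable continuous_on_const)
  obtain y v where "ac_primitive I y (\<lambda>x. 1 / of_real (p x) * v x)"
    "ac_primitive I v (\<lambda>x. (of_real (q x) + (- z) * of_real (r x)) * y x)" "y c = y0" "v c = h0"
    by (rule linear_system_solution_exists[OF open_I interval_I assms coeffs_locally_integrable(1) B, where ?y0.0 = y0 and ?v0.0 = h0])
  then show ?thesis using that[of y v] by (simp add: sl_pair_def algebra_simps)
qed

lemma sl_solution_iff: "sl_solution \<tau> z y \<longleftrightarrow> (\<exists>h. sl_pair y h (\<lambda>x. z * y x))"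
proof
  assume "sl_solution \<tau> z y"
  then show "\<exists>h. sl_pair y h (\<lambda>x. z * y x)"
    by (intro exI[of _ "quasi_deriv \<tau> y"] sl_pair_cong_ae[OF frakD_sl_pair[of y]]) (auto simp: sl_solution_def)
next
  assume "\<exists>h. sl_pair y h (\<lambda>x. z * y x)"
  then show "sl_solution \<tau> z y"
    using sl_pair_frakD by (auto simp: sl_solution_def)
qed

end

section \<open>The weighted space of square integrable functions\<close>

context sl_expression
begin

lemma AE_weight: "(AE x in M. P x) \<longleftrightarrow> (AE x in lebesgue_on I. P x)"
proof -
  have "(AE x in M. P x) \<longleftrightarrow> (AE x in lebesgue_on I. 0 < ennreal (r x) \<longrightarrow> P x)"
    unfolding weight_def by (rule AE_density) measurable
  also have "\<dots> \<longleftrightarrow> (AE x in lebesgue_on I. P x)"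
  proof
    assume "AE x in lebesgue_on I. 0 < ennreal (r x) \<longrightarrow> P x"
    with r_pos show "AE x in lebesgue_on I. P x" by eventually_elim simp
  next
    assume "AE x in lebesgue_on I. P x"
    then show "AE x in lebesgue_on I. 0 < ennreal (r x) \<longrightarrow> P x" by eventually_elim simp
  qed
  finally show ?thesis .
qed

lemma measurable_weight: "borel_measurable M = borel_measurable (lebesgue_on I)"
  unfolding weight_def by (rule measurable_cong_sets) simp_all

lemma space_weight: "space M = I"
  by (simp add: weight_def)

lemma continuous_measurable_weight:
  assumes "continuous_on I f"
  shows "f \<in> borel_measurable M"
  unfolding measurable_weight by (rule continuous_imp_measurable_on_sets_lebesgue[OF assms]) simp

lemma integrable_weight_iff:
  fixes f :: "real \<Rightarrow> complex"
  assumes "f \<in> borel_measurable M"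
  shows "integrable M f \<longleftrightarrow> integrable (lebesgue_on I) (\<lambda>x. of_real (r x) * f x)"
proof -
  have f: "f \<in> borel_measurable (lebesgue_on I)" using assms by (simp only: measurable_weight)
  have "AE x in lebesgue_on I. 0 \<le> r x" using r_pos by eventually_elim simp
  from integrable_density[OF f r_meas this] show ?thesis by (simp add: weight_def scaleR_conv_of_real)
qed

lemma integral_weight:
  fixes f :: "real \<Rightarrow> complex"
  assumes "f \<in> borel_measurable M"
  shows "(LINT x|M. f x) = (LINT x|lebesgue_on I. of_real (r x) * f x)"
proof -
  have f: "f \<in> borel_measurable (lebesgue_on I)" using assms by (simp only: measurable_weight)
  have "AE x in lebesgue_on I. 0 \<le> r x" using r_pos by eventually_elim simp
  from integral_density[OF f r_meas this] show ?thesis by (simp add: weight_def scaleR_conv_of_real)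
qed

abbreviation "SQ \<equiv> square_integrable M"

lemma SQ_meas: "f \<in> SQ \<Longrightarrow> f \<in> borel_measurable M"
  by (simp add: square_integrable_def)

lemma SQ_I:
  assumes "f \<in> borel_measurable M" "integrable M g" "AE x in M. (norm (f x))\<^sup>2 \<le> g x"
  shows "f \<in> SQ"
  unfolding square_integrable_def
proof (intro CollectI conjI assms(1))
  show "integrable M (\<lambda>x. (norm (f x))\<^sup>2)"
  proof (rule Bochner_Integration.integrable_bound[OF assms(2)])
    show "(\<lambda>x. (norm (f x))\<^sup>2) \<in> borel_measurable M" using assms(1) by measurable
    show "AE x in M. norm ((norm (f x))\<^sup>2) \<le> norm (g x)" using assms(3) by eventually_elim simp
  qed
qed

lemma SQ_mult_integrable:
  assumes "f \<in> SQ" "g \<in> SQ"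
  shows "integrable M (\<lambda>x. f x * g x)"
proof (rule Bochner_Integration.integrable_bound)
  show "integrable M (\<lambda>x. (norm (f x))\<^sup>2 + (norm (g x))\<^sup>2)"
    using assms by (simp add: square_integrable_def)
  show "(\<lambda>x. f x * g x) \<in> borel_measurable M" using assms by (auto simp: square_integrable_def)
  have "norm a * norm b \<le> (norm a)\<^sup>2 + (norm b)\<^sup>2" for a b :: complex
    using sum_squares_bound[of "norm a" "norm b"] mult_nonneg_nonneg[OF norm_ge_zero[of a] norm_ge_zero[of b]] by linarith
  then show "AE x in M. norm (f x * g x) \<le> norm ((norm (f x))\<^sup>2 + (norm (g x))\<^sup>2)"
    by (simp add: norm_mult)
qed

lemma SQ_cmult: "f \<in> SQ \<Longrightarrow> (\<lambda>x. k * f x) \<in> SQ"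
  by (auto simp: square_integrable_def norm_mult power_mult_distrib)

lemma SQ_cnj: "f \<in> SQ \<Longrightarrow> (\<lambda>x. cnj (f x)) \<in> SQ"
  by (auto simp: square_integrable_def
      intro: measurable_compose[OF _ borel_measurable_continuous_onI[OF continuous_on_cnj[OF continuous_on_id]]])

lemma SQ_add:
  assumes "f \<in> SQ" "g \<in> SQ"
  shows "(\<lambda>x. f x + g x) \<in> SQ"
proof (rule SQ_I)
  show "(\<lambda>x. f x + g x) \<in> borel_measurable M" using assms by (auto simp: square_integrable_def)
  show "integrable M (\<lambda>x. 2 * (norm (f x))\<^sup>2 + 2 * (norm (g x))\<^sup>2)"
    using assms by (simp add: square_integrable_def)
  have "(norm (a + b))\<^sup>2 \<le> 2 * (norm a)\<^sup>2 + 2 * (norm b)\<^sup>2" for a b :: complex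
  proof -
    have "(norm (a + b))\<^sup>2 \<le> (norm a + norm b)\<^sup>2" by (intro power_mono norm_triangle_ineq) simp
    also have "\<dots> \<le> 2 * (norm a)\<^sup>2 + 2 * (norm b)\<^sup>2"
      using sum_squares_bound[of "norm a" "norm b"] by (simp add: power2_sum)
    finally show ?thesis .
  qed
  then show "AE x in M. (norm (f x + g x))\<^sup>2 \<le> 2 * (norm (f x))\<^sup>2 + 2 * (norm (g x))\<^sup>2" by simp
qed

lemma SQ_diff: "f \<in> SQ \<Longrightarrow> g \<in> SQ \<Longrightarrow> (\<lambda>x. f x - g x) \<in> SQ"
  using SQ_add[of f "\<lambda>x. -1 * g x"] SQ_cmult[of g "-1"] by simp

lemma SQ_cong_ae:
  assumes "f \<in> SQ" "g \<in> borel_measurable M" "AE x in M. g x = f x"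
  shows "g \<in> SQ"
proof (rule SQ_I[OF assms(2)])
  show "integrable M (\<lambda>x. (norm (f x))\<^sup>2)" using assms(1) by (simp add: square_integrable_def)
  show "AE x in M. (norm (g x))\<^sup>2 \<le> (norm (f x))\<^sup>2" using assms(3) by eventually_elim simp
qed

lemma SQ_bounded_mult:
  assumes "f \<in> SQ" "g \<in> borel_measurable M" "\<And>x. x \<in> I \<Longrightarrow> norm (g x) \<le> B"
  shows "(\<lambda>x. g x * f x) \<in> SQ"
proof (rule SQ_I)
  show "(\<lambda>x. g x * f x) \<in> borel_measurable M" using assms(1,2) by (auto simp: square_integrable_def)
  show "integrable M (\<lambda>x. B\<^sup>2 * (norm (f x))\<^sup>2)" using assms(1) by (simp add: square_integrable_def)
  show "AE x in M. (norm (g x * f x))\<^sup>2 \<le> B\<^sup>2 * (norm (f x))\<^sup>2"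
    by (rule AE_I2) (auto simp: norm_mult power_mult_distrib space_weight intro!: mult_right_mono power_mono assms(3))
qed

section \<open>Limits at the end points\<close>

text \<open>
  The filters of the real numbers that approach the lower and the upper end of the interval; they treat finite and
  infinite end points alike.
\<close>

definition FA :: "real filter" where "FA = filtermap real_of_ereal (at_right (lower_end \<tau>))"
definition FB :: "real filter" where "FB = filtermap real_of_ereal (at_left (upper_end \<tau>))"

lemma lower_less_upper: "lower_end \<tau> < upper_end \<tau>"
  using sl by (simp add: sturm_liouville_def)

lemma eventually_FA: "c \<in> I \<Longrightarrow> eventually (\<lambda>x. x \<in> I \<and> x < c) FA"
  unfolding FA_def eventually_filtermap
proof -
  assume c: "c \<in> I"
  then have lc: "lower_end \<tau> < ereal c" by (simp add: sl_dom_def)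
  show "\<forall>\<^sub>F x in at_right (lower_end \<tau>). real_of_ereal x \<in> I \<and> real_of_ereal x < c"
    unfolding eventually_at_right[OF lc]
  proof (intro exI[of _ "ereal c"] conjI allI impI lc)
    fix y assume y: "lower_end \<tau> < y" "y < ereal c"
    then have "\<bar>y\<bar> \<noteq> \<infinity>" by (cases y) auto
    then obtain x where x: "y = ereal x" by auto
    have "y < upper_end \<tau>" using y(2) c less_trans[of y "ereal c"] by (simp add: sl_dom_def)
    then show "real_of_ereal y \<in> I" "real_of_ereal y < c" using y x by (auto simp: sl_dom_def)
  qed
qed

lemma eventually_FB: "c \<in> I \<Longrightarrow> eventually (\<lambda>x. x \<in> I \<and> c < x) FB"
  unfolding FB_def eventually_filtermap
proof -
  assume c: "c \<in> I"
  then have lc: "ereal c < upper_end \<tau>" by (simp add: sl_dom_def)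
  show "\<forall>\<^sub>F x in at_left (upper_end \<tau>). real_of_ereal x \<in> I \<and> c < real_of_ereal x"
    unfolding eventually_at_left[OF lc]
  proof (intro exI[of _ "ereal c"] conjI allI impI lc)
    fix y assume y: "ereal c < y" "y < upper_end \<tau>"
    then have "\<bar>y\<bar> \<noteq> \<infinity>" by (cases y) auto
    then obtain x where x: "y = ereal x" by auto
    have "lower_end \<tau> < y" using y(1) c less_trans[of _ "ereal c" y] by (simp add: sl_dom_def)
    then show "real_of_ereal y \<in> I" "c < real_of_ereal y" using y x by (auto simp: sl_dom_def)
  qed
qed

lemma FA_nontrivial: "FA \<noteq> bot"
  unfolding FA_def filtermap_bot_iff
proof
  assume "at_right (lower_end \<tau>) = bot"
  then have "eventually (\<lambda>_. False) (at_right (lower_end \<tau>))" by simp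
  then obtain b where b: "b > lower_end \<tau>" "\<forall>y>lower_end \<tau>. y < b \<longrightarrow> False"
    unfolding eventually_at_right[OF lower_less_upper] by blast
  then show False using dense by blast
qed

lemma FB_nontrivial: "FB \<noteq> bot"
  unfolding FB_def filtermap_bot_iff
proof
  assume "at_left (upper_end \<tau>) = bot"
  then have "eventually (\<lambda>_. False) (at_left (upper_end \<tau>))" by simp
  then obtain b where b: "b < upper_end \<tau>" "\<forall>y>b. y < upper_end \<tau> \<longrightarrow> False"
    unfolding eventually_at_left[OF lower_less_upper] by blast
  then show False using dense by blast
qed

lemma tendsto_cong_I:
  assumes "(f \<longlongrightarrow> L) F" "F = FA \<or> F = FB" "\<And>x. x \<in> I \<Longrightarrow> g x = f x"
  shows "(g \<longlongrightarrow> L) F"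
proof (rule Lim_transform_eventually[OF assms(1)])
  obtain c where "c \<in> I" using I_nonempty by blast
  then have "eventually (\<lambda>x. x \<in> I) F"
    using assms(2) eventually_FA[of c] eventually_FB[of c] by (auto elim: eventually_mono)
  then show "\<forall>\<^sub>F x in F. f x = g x" by eventually_elim (simp add: assms(3))
qed

text \<open>
  The primitive that vanishes at the lower end point.
\<close>

definition left_integral :: "(real \<Rightarrow> complex) \<Rightarrow> real \<Rightarrow> complex" where
  "left_integral k x = (LINT y|lebesgue. indicator {..<x} y *\<^sub>R (indicator I y *\<^sub>R k y))"

lemma integrable_on_I:
  fixes k :: "real \<Rightarrow> complex"
  assumes "integrable (lebesgue_on I) k"
  shows "integrable lebesgue (\<lambda>y. indicator I y *\<^sub>R k y)"
    "(LINT y|lebesgue. indicator I y *\<^sub>R k y) = (LINT y|lebesgue_on I. k y)"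
  using assms by (simp_all add: integrable_restrict_space integral_restrict_space)

lemma ac_primitive_left_integral:
  assumes k: "integrable (lebesgue_on I) k"
  shows "ac_primitive I (left_integral k) k"
proof (rule ac_primitiveI)
  fix a b :: real assume ab: "a \<le> b" "{a..b} \<subseteq> I"
  let ?K = "\<lambda>y. indicator I y *\<^sub>R k y"
  have kI: "set_integrable lebesgue I k" using integrable_on_I(1)[OF k] by (simp add: set_integrable_def)
  show kab: "k absolutely_integrable_on {a..b}" by (rule set_integrable_subset[OF kI _ ab(2)]) simp
  have int: "integrable lebesgue (\<lambda>y. indicator A y *\<^sub>R ?K y)" if "A \<in> sets lebesgue" for A
    using integrable_mult_indicator[OF that integrable_on_I(1)[OF k]] .
  have "left_integral k b - left_integral k a
     = (LINT y|lebesgue. indicator {..<b} y *\<^sub>R ?K y - indicator {..<a} y *\<^sub>R ?K y)"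
    unfolding left_integral_def by (rule Bochner_Integration.integral_diff[symmetric]; rule int; simp)
  also have "\<dots> = (LINT y:{a..<b}|lebesgue. k y)"
    unfolding set_lebesgue_integral_def
    by (rule Bochner_Integration.integral_cong) (use ab in \<open>auto simp: indicator_def subset_eq\<close>)
  also have "\<dots> = integral {a..<b} k"
    by (rule set_lebesgue_integral_eq_integral(2), rule set_integrable_subset[OF kab]) auto
  also have "\<dots> = integral {a..b} k"
  proof (rule integral_spike_set)
    show "negligible {x \<in> {a..<b} - {a..b}. k x \<noteq> 0}"
      by (rule negligible_subset[OF negligible_empty]) auto
    show "negligible {x \<in> {a..b} - {a..<b}. k x \<noteq> 0}"
      by (rule negligible_subset[OF negligible_sing[of b]]) auto
  qed
  finally show "integral {a..b} k = left_integral k b - left_integral k a" ..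
qed

lemma integral_indicator_vanishing:
  fixes k :: "real \<Rightarrow> complex"
  assumes k: "integrable (lebesgue_on I) k" and A: "\<And>n :: nat. A n \<in> sets lebesgue"
    and ev: "\<And>x. x \<in> I \<Longrightarrow> eventually (\<lambda>n. x \<notin> A n) sequentially"
  shows "(\<lambda>n. LINT y|lebesgue. indicator (A n) y *\<^sub>R norm (indicator I y *\<^sub>R k y)) \<longlonglongrightarrow> 0"
proof -
  let ?K = "\<lambda>y. indicator I y *\<^sub>R k y"
  have "(\<lambda>n. LINT y|lebesgue. indicator (A n) y *\<^sub>R norm (?K y)) \<longlonglongrightarrow> (LINT y|(lebesgue :: real measure). 0)"
  proof (rule integral_dominated_convergence[where w = "\<lambda>y. norm (?K y)"])
    show "integrable lebesgue (\<lambda>y. norm (?K y))" using integrable_on_I(1)[OF k] by (rule integrable_norm)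
    then show "(\<lambda>y. indicator (A n) y *\<^sub>R norm (?K y)) \<in> borel_measurable lebesgue" for n
      using A by (intro borel_measurable_scaleR borel_measurable_indicator) auto
    show "AE y in lebesgue. (\<lambda>n. indicator (A n) y *\<^sub>R norm (?K y)) \<longlonglongrightarrow> 0"
    proof (rule AE_I2)
      fix y :: real
      show "(\<lambda>n. indicator (A n) y *\<^sub>R norm (?K y)) \<longlonglongrightarrow> 0"
      proof (cases "y \<in> I")
        case True
        show ?thesis by (rule tendsto_eventually) (use ev[OF True] in eventually_elim, simp)
      qed simp
    qed
    show "AE y in lebesgue. norm (indicator (A n) y *\<^sub>R norm (?K y)) \<le> norm (?K y)" for n
      by (rule AE_I2) (simp add: indicator_def)
  qed simp
  then show ?thesis by simp
qed

text \<open>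
  The interval is exhausted by compact subintervals, and the integrals over the complements tend to zero by
  dominated convergence.
\<close>

lemma small_tails:
  fixes k :: "real \<Rightarrow> complex"
  assumes k: "integrable (lebesgue_on I) k" and e: "e > 0"
  obtains l u where "l \<in> I" "(LINT y|lebesgue. indicator {..<l} y *\<^sub>R norm (indicator I y *\<^sub>R k y)) < e"
    "u \<in> I" "(LINT y|lebesgue. indicator {u<..} y *\<^sub>R norm (indicator I y *\<^sub>R k y)) < e"
proof -
  let ?K = "\<lambda>y. indicator I y *\<^sub>R k y"
  obtain u l :: "nat \<Rightarrow> real" where ul: "einterval (lower_end \<tau>) (upper_end \<tau>) = (\<Union>i. {l i .. u i})"
    "incseq u" "decseq l" "\<And>i. l i < u i" "\<And>i. lower_end \<tau> < l i" "\<And>i. u i < upper_end \<tau>"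
    "(\<lambda>i. ereal (l i)) \<longlonglongrightarrow> lower_end \<tau>" "(\<lambda>i. ereal (u i)) \<longlonglongrightarrow> upper_end \<tau>"
    by (rule einterval_Icc_approximation[OF lower_less_upper]) (rule that)
  have inI: "l n \<in> I" "u n \<in> I" for n
  proof -
    have "ereal (l n) < ereal (u n)" using ul(4)[of n] by simp
    then have "ereal (l n) < upper_end \<tau>" "lower_end \<tau> < ereal (u n)"
      using ul(5)[of n] ul(6)[of n] less_trans by blast+
    then show "l n \<in> I" "u n \<in> I" using ul(5)[of n] ul(6)[of n] by (simp_all add: sl_dom_def)
  qed
  have cov: "\<exists>N. \<forall>n\<ge>N. l n \<le> x \<and> x \<le> u n" if x: "x \<in> I" for x
  proof -
    have "x \<in> einterval (lower_end \<tau>) (upper_end \<tau>)" using x by (simp add: sl_dom_def einterval_iff)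
    then obtain N where N: "l N \<le> x" "x \<le> u N" unfolding ul(1) by auto
    have "l n \<le> x \<and> x \<le> u n" if "n \<ge> N" for n
      using N decseqD[OF ul(3) that] incseqD[OF ul(2) that] by linarith
    then show ?thesis by blast
  qed
  have lim: "(\<lambda>n. LINT y|lebesgue. indicator (A n) y *\<^sub>R norm (?K y)) \<longlonglongrightarrow> 0"
    if A: "\<And>n. A n \<in> sets lebesgue" "\<And>n x. l n \<le> x \<Longrightarrow> x \<le> u n \<Longrightarrow> x \<notin> A n" for A
  proof (rule integral_indicator_vanishing[OF k A(1)])
    fix x assume "x \<in> I"
    then obtain N where "\<forall>n\<ge>N. l n \<le> x \<and> x \<le> u n" using cov by blast
    then show "eventually (\<lambda>n. x \<notin> A n) sequentially"
      unfolding eventually_sequentially using A(2) by blast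
  qed
  have "\<forall>\<^sub>F n in sequentially. (LINT y|lebesgue. indicator {..<l n} y *\<^sub>R norm (?K y)) < e"
    "\<forall>\<^sub>F n in sequentially. (LINT y|lebesgue. indicator {u n<..} y *\<^sub>R norm (?K y)) < e"
    by (rule order_tendstoD(2)[OF lim e]; simp)+
  then obtain n n' where "(LINT y|lebesgue. indicator {..<l n} y *\<^sub>R norm (?K y)) < e"
    "(LINT y|lebesgue. indicator {u n'<..} y *\<^sub>R norm (?K y)) < e"
    by (auto simp: eventually_sequentially)
  then show ?thesis using that inI by blast
qed

lemma left_integral_limits:
  assumes k: "integrable (lebesgue_on I) k"
  shows "(left_integral k \<longlongrightarrow> 0) FA" "(left_integral k \<longlongrightarrow> (LINT y|lebesgue_on I. k y)) FB"
proof -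
  let ?K = "\<lambda>y. indicator I y *\<^sub>R k y"
  have int: "integrable lebesgue (\<lambda>y. indicator A y *\<^sub>R ?K y)"
    "integrable lebesgue (\<lambda>y. indicator A y *\<^sub>R norm (?K y))" if A: "A \<in> sets lebesgue" for A
    using integrable_mult_indicator[OF A integrable_on_I(1)[OF k]]
      integrable_mult_indicator[OF A integrable_norm[OF integrable_on_I(1)[OF k]]] .
  show "(left_integral k \<longlongrightarrow> 0) FA"
  proof (rule tendstoI)
    fix e :: real assume e: "e > 0"
    obtain l where l: "l \<in> I" "(LINT y|lebesgue. indicator {..<l} y *\<^sub>R norm (?K y)) < e"
      using small_tails[OF k e] by metis
    show "\<forall>\<^sub>F x in FA. dist (left_integral k x) 0 < e"
      using eventually_FA[OF l(1)]
    proof eventually_elim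
      case (elim x)
      have "norm (left_integral k x) \<le> (LINT y|lebesgue. indicator {..<l} y *\<^sub>R norm (?K y))"
        unfolding left_integral_def
      proof (rule Bochner_Integration.integral_norm_bound_integral[OF int(1) int(2)])
        show "norm (indicator {..<x} y *\<^sub>R ?K y) \<le> indicator {..<l} y *\<^sub>R norm (?K y)" for y
          using elim by (auto simp: indicator_def)
      qed simp_all
      then show ?case using l(2) by simp
    qed
  qed
  show "(left_integral k \<longlongrightarrow> (LINT y|lebesgue_on I. k y)) FB"
  proof (rule tendstoI)
    fix e :: real assume e: "e > 0"
    obtain u where u: "u \<in> I" "(LINT y|lebesgue. indicator {u<..} y *\<^sub>R norm (?K y)) < e"
      using small_tails[OF k e] by metis
    show "\<forall>\<^sub>F x in FB. dist (left_integral k x) (LINT y|lebesgue_on I. k y) < e"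
      using eventually_FB[OF u(1)]
    proof eventually_elim
      case (elim x)
      have "(LINT y|lebesgue_on I. k y) - left_integral k x = (LINT y|lebesgue. ?K y - indicator {..<x} y *\<^sub>R ?K y)"
        unfolding left_integral_def integrable_on_I(2)[OF k, symmetric]
        by (rule Bochner_Integration.integral_diff[symmetric], rule integrable_on_I(1)[OF k], rule int(1), simp)
      also have "norm \<dots> \<le> (LINT y|lebesgue. indicator {u<..} y *\<^sub>R norm (?K y))"
      proof (rule Bochner_Integration.integral_norm_bound_integral[OF Bochner_Integration.integrable_diff[OF integrable_on_I(1)[OF k] int(1)] int(2)])
        show "norm (?K y - indicator {..<x} y *\<^sub>R ?K y) \<le> indicator {u<..} y *\<^sub>R norm (?K y)" for y
          using elim by (auto simp: indicator_def)
      qed simp_all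
      finally show ?case using u(2) by (simp add: dist_norm norm_minus_commute)
    qed
  qed
qed

text \<open>
  A primitive of a function integrable on the whole interval differs from \<open>left_integral\<close> by a constant.
\<close>

lemma primitive_limits:
  assumes G: "ac_primitive I G k" and k: "integrable (lebesgue_on I) k"
  obtains L where "(G \<longlongrightarrow> L) FA" "(G \<longlongrightarrow> L + (LINT y|lebesgue_on I. k y)) FB"
proof -
  obtain c where c: "c \<in> I" using I_nonempty by blast
  define L where "L = G c - left_integral k c"
  have "ac_primitive I (\<lambda>x. G x - left_integral k x) (\<lambda>x. 0)"
    using ac_primitive_diff[OF G ac_primitive_left_integral[OF k]] by simp
  then have eq: "G x = L + left_integral k x" if "x \<in> I" for x
    using ac_primitive_zero_const[OF interval_I _ that c] unfolding L_def by (metis diff_add_cancel)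
  have "(G \<longlongrightarrow> L + 0) FA"
    by (rule tendsto_cong_I[OF tendsto_add[OF tendsto_const left_integral_limits(1)[OF k]]]) (auto simp: eq)
  moreover have "(G \<longlongrightarrow> L + (LINT y|lebesgue_on I. k y)) FB"
    by (rule tendsto_cong_I[OF tendsto_add[OF tendsto_const left_integral_limits(2)[OF k]]]) (auto simp: eq)
  ultimately show ?thesis using that by simp
qed

end

section \<open>The maximal domain and boundary values\<close>

context sl_expression
begin

text \<open>
  Lebesgue measure is complete, so a change on a null set does not affect measurability. This applies to \<open>sl_apply\<close>, whose values
  on the exceptional null set are arbitrary.
\<close>

lemma SQ_cong_ae_complete:
  assumes "f \<in> SQ" "AE x in lebesgue_on I. g x = f x"
  shows "g \<in> SQ"
proof (rule SQ_cong_ae[OF assms(1)])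
  obtain N where N: "negligible N" "\<And>x. x \<in> I \<Longrightarrow> x \<notin> N \<Longrightarrow> g x = f x"
    using AE_lebesgue_on_negligibleE[OF open_I assms(2)] by blast
  have "f \<in> borel_measurable (lebesgue_on I)" using SQ_meas[OF assms(1)] by (simp only: measurable_weight)
  then have "(\<lambda>x. if x \<in> I then f x else 0) \<in> borel_measurable lebesgue"
    by (simp add: borel_measurable_if)
  moreover have "AE x in lebesgue. (if x \<in> I then f x else 0) = (if x \<in> I then g x else 0)"
  proof (rule AE_I'[of N])
    show "N \<in> null_sets lebesgue" using N(1) by (simp add: negligible_iff_null_sets)
    have "x \<in> N" if "x \<in> I" "f x \<noteq> g x" for x using N(2)[of x] that by fastforce
    then show "{x \<in> space lebesgue. (if x \<in> I then f x else 0) \<noteq> (if x \<in> I then g x else 0)} \<subseteq> N"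
      by auto
  qed
  ultimately have "(\<lambda>x. if x \<in> I then g x else 0) \<in> borel_measurable lebesgue"
    by (rule borel_measurable_AE)
  then show "g \<in> borel_measurable M"
    unfolding measurable_weight by (simp add: borel_measurable_if)
  show "AE x in M. g x = f x" unfolding AE_weight by (rule assms(2))
qed

lemma dom_maxD:
  assumes "f \<in> dom_max \<tau>"
  shows "sl_pair f (quasi_deriv \<tau> f) (sl_apply \<tau> f)" "f \<in> SQ" "sl_apply \<tau> f \<in> SQ"
  using assms frakD_sl_pair by (auto simp: dom_max_def)

lemma dom_maxI:
  assumes "sl_pair f h w" "f \<in> SQ" "w \<in> SQ"
  shows "f \<in> dom_max \<tau>"
  using sl_pair_frakD[OF assms(1)] SQ_cong_ae_complete[OF assms(3)] assms(2) by (auto simp: dom_max_def)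

lemma dom_max_add:
  assumes "f \<in> dom_max \<tau>" "g \<in> dom_max \<tau>"
  shows "(\<lambda>x. f x + g x) \<in> dom_max \<tau>"
    "\<And>x. x \<in> I \<Longrightarrow> quasi_deriv \<tau> (\<lambda>x. f x + g x) x = quasi_deriv \<tau> f x + quasi_deriv \<tau> g x"
    "AE x in lebesgue_on I. sl_apply \<tau> (\<lambda>x. f x + g x) x = sl_apply \<tau> f x + sl_apply \<tau> g x"
proof -
  note P = sl_pair_add[OF dom_maxD(1)[OF assms(1)] dom_maxD(1)[OF assms(2)]]
  show "(\<lambda>x. f x + g x) \<in> dom_max \<tau>"
    by (rule dom_maxI[OF P]) (intro SQ_add dom_maxD assms)+
  show "\<And>x. x \<in> I \<Longrightarrow> quasi_deriv \<tau> (\<lambda>x. f x + g x) x = quasi_deriv \<tau> f x + quasi_deriv \<tau> g x"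
    "AE x in lebesgue_on I. sl_apply \<tau> (\<lambda>x. f x + g x) x = sl_apply \<tau> f x + sl_apply \<tau> g x"
    using sl_pair_frakD(2,3)[OF P] by simp_all
qed

lemma dom_max_cmult:
  assumes "f \<in> dom_max \<tau>"
  shows "(\<lambda>x. k * f x) \<in> dom_max \<tau>"
    "\<And>x. x \<in> I \<Longrightarrow> quasi_deriv \<tau> (\<lambda>x. k * f x) x = k * quasi_deriv \<tau> f x"
    "AE x in lebesgue_on I. sl_apply \<tau> (\<lambda>x. k * f x) x = k * sl_apply \<tau> f x"
proof -
  note P = sl_pair_cmult[OF dom_maxD(1)[OF assms], of k]
  show "(\<lambda>x. k * f x) \<in> dom_max \<tau>"
    by (rule dom_maxI[OF P]) (intro SQ_cmult dom_maxD assms)+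
  show "\<And>x. x \<in> I \<Longrightarrow> quasi_deriv \<tau> (\<lambda>x. k * f x) x = k * quasi_deriv \<tau> f x"
    "AE x in lebesgue_on I. sl_apply \<tau> (\<lambda>x. k * f x) x = k * sl_apply \<tau> f x"
    using sl_pair_frakD(2,3)[OF P] by simp_all
qed

lemma dom_max_cnj:
  assumes "f \<in> dom_max \<tau>"
  shows "(\<lambda>x. cnj (f x)) \<in> dom_max \<tau>"
    "\<And>x. x \<in> I \<Longrightarrow> quasi_deriv \<tau> (\<lambda>x. cnj (f x)) x = cnj (quasi_deriv \<tau> f x)"
    "AE x in lebesgue_on I. sl_apply \<tau> (\<lambda>x. cnj (f x)) x = cnj (sl_apply \<tau> f x)"
proof -
  note P = sl_pair_cnj[OF dom_maxD(1)[OF assms]]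
  show "(\<lambda>x. cnj (f x)) \<in> dom_max \<tau>"
    by (rule dom_maxI[OF P]) (intro SQ_cnj dom_maxD assms)+
  show "\<And>x. x \<in> I \<Longrightarrow> quasi_deriv \<tau> (\<lambda>x. cnj (f x)) x = cnj (quasi_deriv \<tau> f x)"
    "AE x in lebesgue_on I. sl_apply \<tau> (\<lambda>x. cnj (f x)) x = cnj (sl_apply \<tau> f x)"
    using sl_pair_frakD(2,3)[OF P] by simp_all
qed

lemma dom_max_cong:
  assumes "f \<in> dom_max \<tau>" "g \<in> frakD \<tau>" "\<And>x. x \<in> I \<Longrightarrow> f x = g x"
  shows "\<And>x. x \<in> I \<Longrightarrow> quasi_deriv \<tau> g x = quasi_deriv \<tau> f x"
    "AE x in lebesgue_on I. sl_apply \<tau> g x = sl_apply \<tau> f x"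
proof -
  have P: "sl_pair g (quasi_deriv \<tau> f) (sl_apply \<tau> f)"
    by (rule sl_pair_cong[OF dom_maxD(1)[OF assms(1)]]) (use assms(3) in auto)
  show "\<And>x. x \<in> I \<Longrightarrow> quasi_deriv \<tau> g x = quasi_deriv \<tau> f x"
    "AE x in lebesgue_on I. sl_apply \<tau> g x = sl_apply \<tau> f x"
    using sl_pair_frakD(2,3)[OF P] by simp_all
qed

text \<open>
  The end point is represented by its filter, a parameter, so that each rule is proved once for both ends.
\<close>

definition bv :: "real filter \<Rightarrow> (real \<Rightarrow> complex) \<Rightarrow> (real \<Rightarrow> complex) \<Rightarrow> complex" where
  "bv F f g = Lim F (bracket \<tau> f g)"

definition ends :: "real filter set" where "ends = {FA, FB}"

lemma ends_nontrivial: "F \<in> ends \<Longrightarrow> F \<noteq> bot"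
  using FA_nontrivial FB_nontrivial by (auto simp: ends_def)

lemma bracket_lower_bv: "bracket_lower \<tau> f g = bv FA f g"
  unfolding bracket_lower_def bv_def FA_def Topological_Spaces.Lim_def filterlim_filtermap comp_def ..

lemma bracket_upper_bv: "bracket_upper \<tau> f g = bv FB f g"
  unfolding bracket_upper_def bv_def FB_def Topological_Spaces.Lim_def filterlim_filtermap comp_def ..

lemma bvI:
  assumes "F \<in> ends" "(G \<longlongrightarrow> L) F" "\<And>x. x \<in> I \<Longrightarrow> bracket \<tau> f g x = G x"
  shows "bv F f g = L"
  unfolding bv_def
proof (rule tendsto_Lim)
  show "F \<noteq> bot" by (rule ends_nontrivial[OF assms(1)])
  show "(bracket \<tau> f g \<longlongrightarrow> L) F"
    using assms(1) by (intro tendsto_cong_I[OF assms(2) _ assms(3)]) (auto simp: ends_def)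
qed

text \<open>
  The derivative of the bracket is $r$ times a sum of products of square integrable functions, hence integrable
  up to both ends.
\<close>

lemma bracket_limits:
  assumes f: "f \<in> dom_max \<tau>" and g: "g \<in> dom_max \<tau>"
  obtains L where "(bracket \<tau> f g \<longlongrightarrow> L) FA"
    "(bracket \<tau> f g \<longlongrightarrow> L + (LINT x|M. sl_apply \<tau> f x * cnj (g x) - f x * cnj (sl_apply \<tau> g x))) FB"
proof -
  note fD = dom_maxD[OF f] and gD = dom_maxD[OF g]
  let ?k = "\<lambda>x. sl_apply \<tau> f x * cnj (g x) - f x * cnj (sl_apply \<tau> g x)"
  have int: "integrable M ?k"
    by (intro Bochner_Integration.integrable_diff SQ_mult_integrable SQ_cnj fD gD)
  then have m: "?k \<in> borel_measurable M" by (rule borel_measurable_integrable)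
  have ri: "integrable (lebesgue_on I) (\<lambda>x. of_real (r x) * ?k x)"
    using int integrable_weight_iff[OF m] by simp
  have "ac_primitive I (bracket \<tau> f g) (\<lambda>x. of_real (r x) * ?k x)"
    using lagrange_identity[OF fD(1) sl_pair_cnj[OF gD(1)]] by (simp add: bracket_def[abs_def])
  from primitive_limits[OF this ri] obtain L where "(bracket \<tau> f g \<longlongrightarrow> L) FA"
    "(bracket \<tau> f g \<longlongrightarrow> L + (LINT x|lebesgue_on I. of_real (r x) * ?k x)) FB" .
  then show ?thesis using that integral_weight[OF m] by simp
qed

lemma bv_tendsto:
  assumes "F \<in> ends" "f \<in> dom_max \<tau>" "g \<in> dom_max \<tau>"
  shows "(bracket \<tau> f g \<longlongrightarrow> bv F f g) F"
proof -
  obtain L where "(bracket \<tau> f g \<longlongrightarrow> L) F"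
    using bracket_limits[OF assms(2,3)] assms(1) by (auto simp: ends_def)
  moreover then have "bv F f g = L" by (intro bvI[OF assms(1)]) auto
  ultimately show ?thesis by simp
qed

lemma green_formula:
  assumes "f \<in> dom_max \<tau>" "g \<in> dom_max \<tau>"
  shows "bv FB f g - bv FA f g = (LINT x|M. sl_apply \<tau> f x * cnj (g x) - f x * cnj (sl_apply \<tau> g x))"
proof -
  obtain L where "(bracket \<tau> f g \<longlongrightarrow> L) FA"
    "(bracket \<tau> f g \<longlongrightarrow> L + (LINT x|M. sl_apply \<tau> f x * cnj (g x) - f x * cnj (sl_apply \<tau> g x))) FB"
    using bracket_limits[OF assms] .
  then have "bv FA f g = L" "bv FB f g = L + (LINT x|M. sl_apply \<tau> f x * cnj (g x) - f x * cnj (sl_apply \<tau> g x))"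
    by (auto intro!: bvI simp: ends_def)
  then show ?thesis by simp
qed

lemma bv_cong:
  assumes "F \<in> ends" "f \<in> dom_max \<tau>" "f' \<in> dom_max \<tau>" "g \<in> dom_max \<tau>" "\<And>x. x \<in> I \<Longrightarrow> f x = f' x"
  shows "bv F f g = bv F f' g"
proof -
  have "f' \<in> frakD \<tau>" using assms(3) by (simp add: dom_max_def)
  from dom_max_cong(1)[OF assms(2) this assms(5)] show ?thesis
    by (intro bvI[OF assms(1) bv_tendsto[OF assms(1,3,4)]]) (simp add: bracket_def assms(5))
qed

lemma bv_add:
  assumes F: "F \<in> ends" and f: "f \<in> dom_max \<tau>" "f' \<in> dom_max \<tau>" and g: "g \<in> dom_max \<tau>"
  shows "bv F (\<lambda>x. f x + f' x) g = bv F f g + bv F f' g"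
  by (rule bvI[OF F tendsto_add[OF bv_tendsto[OF F f(1) g] bv_tendsto[OF F f(2) g]]])
    (simp add: bracket_def dom_max_add(2)[OF f] algebra_simps)

lemma bv_cmult:
  assumes F: "F \<in> ends" and f: "f \<in> dom_max \<tau>" and g: "g \<in> dom_max \<tau>"
  shows "bv F (\<lambda>x. k * f x) g = k * bv F f g"
  by (rule bvI[OF F tendsto_mult[OF tendsto_const bv_tendsto[OF F f g]]])
    (simp add: bracket_def dom_max_cmult(2)[OF f] algebra_simps)

lemma bv_swap:
  assumes F: "F \<in> ends" and f: "f \<in> dom_max \<tau>" and g: "g \<in> dom_max \<tau>"
  shows "bv F g f = - cnj (bv F f g)"
  by (rule bvI[OF F tendsto_minus[OF tendsto_cnj[OF bv_tendsto[OF F f g]]]])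
    (simp add: bracket_def algebra_simps)

text \<open>
  A real function equals its conjugate, whose quasi-derivative is the conjugate one.
\<close>

lemma real_valued_quasi_deriv:
  assumes "f \<in> dom_max \<tau>" "real_valued_on I f" "x \<in> I"
  shows "cnj (f x) = f x" "cnj (quasi_deriv \<tau> f x) = quasi_deriv \<tau> f x"
proof -
  have re: "cnj (f x) = f x" if "x \<in> I" for x
    using assms(2) that by (auto simp: real_valued_on_def Reals_cnj_iff)
  then show "cnj (f x) = f x" using assms(3) .
  have fr: "f \<in> frakD \<tau>" using assms(1) by (simp add: dom_max_def)
  have "quasi_deriv \<tau> (\<lambda>x. cnj (f x)) x = quasi_deriv \<tau> f x"
    by (rule dom_max_cong(1)[OF dom_max_cnj(1)[OF assms(1)] fr re assms(3), symmetric])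
  then show "cnj (quasi_deriv \<tau> f x) = quasi_deriv \<tau> f x"
    using dom_max_cnj(2)[OF assms(1,3)] by simp
qed

lemma bv_cnj:
  assumes F: "F \<in> ends" and f: "f \<in> dom_max \<tau>" and g: "g \<in> dom_max \<tau>" "real_valued_on I g"
  shows "bv F (\<lambda>x. cnj (f x)) g = cnj (bv F f g)"
  by (rule bvI[OF F tendsto_cnj[OF bv_tendsto[OF F f g(1)]]])
    (simp add: bracket_def dom_max_cnj(2)[OF f] real_valued_quasi_deriv[OF g])

text \<open>
  The Pluecker relation between the $2\times 2$ minors formed from $(f,pf')$, $(\overline g,p\overline g')$, $(\phi,p\phi')$ and
  $(\psi,p\psi')$ holds at every point and passes to the limit. It says that the boundary values with respect to
  $\phi$ and $\psi$ determine all others.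
\<close>

lemma bv_pluecker:
  assumes F: "F \<in> ends" and f: "f \<in> dom_max \<tau>" and g: "g \<in> dom_max \<tau>"
    and \<phi>: "\<phi> \<in> dom_max \<tau>" "real_valued_on I \<phi>" and \<psi>: "\<psi> \<in> dom_max \<tau>" "real_valued_on I \<psi>"
    and norm: "bv F \<psi> \<phi> = 1"
  shows "bv F f g = bv F f \<psi> * cnj (bv F g \<phi>) - bv F f \<phi> * cnj (bv F g \<psi>)"
proof -
  have "((\<lambda>x. bracket \<tau> f g x * bracket \<tau> \<psi> \<phi> x) \<longlongrightarrow> bv F f \<psi> * cnj (bv F g \<phi>) - bv F f \<phi> * cnj (bv F g \<psi>)) F"
  proof (rule tendsto_cong_I)
    show "((\<lambda>x. bracket \<tau> f \<psi> x * cnj (bracket \<tau> g \<phi> x) - bracket \<tau> f \<phi> x * cnj (bracket \<tau> g \<psi> x))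
        \<longlongrightarrow> bv F f \<psi> * cnj (bv F g \<phi>) - bv F f \<phi> * cnj (bv F g \<psi>)) F"
      by (intro tendsto_diff tendsto_mult tendsto_cnj bv_tendsto[OF F] f g \<phi> \<psi>)
    show "F = FA \<or> F = FB" using F by (simp add: ends_def)
    show "bracket \<tau> f g x * bracket \<tau> \<psi> \<phi> x
       = bracket \<tau> f \<psi> x * cnj (bracket \<tau> g \<phi> x) - bracket \<tau> f \<phi> x * cnj (bracket \<tau> g \<psi> x)" if "x \<in> I" for x
      by (simp add: bracket_def real_valued_quasi_deriv[OF \<phi> that] real_valued_quasi_deriv[OF \<psi> that] algebra_simps)
  qed
  moreover have "((\<lambda>x. bracket \<tau> f g x * bracket \<tau> \<psi> \<phi> x) \<longlongrightarrow> bv F f g * bv F \<psi> \<phi>) F"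
    by (intro tendsto_mult bv_tendsto[OF F] f g \<phi> \<psi>)
  ultimately have "bv F f \<psi> * cnj (bv F g \<phi>) - bv F f \<phi> * cnj (bv F g \<psi>) = bv F f g * bv F \<psi> \<phi>"
    by (rule tendsto_unique[OF ends_nontrivial[OF F]])
  then show ?thesis by (simp add: norm)
qed

end

section \<open>Variation of parameters and the adjoint of the maximal operator\<close>

locale sl_limit_circle = sl_expression +
  assumes lc_lower: "limit_circle_lower \<tau>" and lc_upper: "limit_circle_upper \<tau>"
begin

lemma compact_indicator_integrable:
  assumes "{a..b} \<subseteq> I"
  shows "integrable M (\<lambda>x. indicator {a..b} x * (B :: real))"
proof -
  have r: "r absolutely_integrable_on {a..b}" using sl assms by (auto simp: sturm_liouville_def L1_loc_def)
  have m: "(\<lambda>x. indicator {a..b} x * B) \<in> borel_measurable (lebesgue_on I)"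
    by (intro borel_measurable_times borel_measurable_const borel_measurable_indicator) (simp add: sets_restrict_space_iff assms)
  have nn: "AE x in lebesgue_on I. 0 \<le> r x" using r_pos by eventually_elim simp
  have "integrable lebesgue (\<lambda>x. B * (indicator {a..b} x *\<^sub>R r x))"
    using r unfolding set_integrable_def by (rule integrable_mult_right)
  also have "(\<lambda>x. B * (indicator {a..b} x *\<^sub>R r x)) = (\<lambda>x. indicator I x *\<^sub>R (r x *\<^sub>R (indicator {a..b} x * B)))"
    using assms by (auto simp: indicator_def fun_eq_iff)
  finally have "integrable (lebesgue_on I) (\<lambda>x. r x *\<^sub>R (indicator {a..b} x * B))"
    by (simp add: integrable_restrict_space)
  then show ?thesis
    unfolding weight_def using integrable_density[OF m r_meas nn] by simp
qed

text \<open>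
  The limit circle conditions control the two ends; in between a solution is bounded and $r$ is integrable.
\<close>

lemma solution_SQ:
  assumes "sl_solution \<tau> z y"
  shows "y \<in> SQ"
proof -
  obtain h where "sl_pair y h (\<lambda>x. z * y x)" using assms sl_solution_iff by blast
  then have cont: "continuous_on I y" by (rule sl_pairD)
  obtain c1 where c1: "c1 \<in> I" "set_integrable M {..<c1} (\<lambda>x. (norm (y x))\<^sup>2)"
    using lc_lower assms unfolding limit_circle_lower_def by blast
  obtain c2 where c2: "c2 \<in> I" "set_integrable M {c2<..} (\<lambda>x. (norm (y x))\<^sup>2)"
    using lc_upper assms unfolding limit_circle_upper_def by blast
  have sub: "{c1..c2} \<subseteq> I" by (rule segment_subset_interval[OF interval_I c1(1) c2(1)])
  have "bounded (y ` {c1..c2})"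
    by (intro compact_imp_bounded compact_continuous_image continuous_on_subset[OF cont sub]) simp
  then obtain B where B: "\<forall>u\<in>y ` {c1..c2}. norm u \<le> B" unfolding bounded_iff by blast
  show ?thesis
  proof (rule SQ_I)
    show "y \<in> borel_measurable M" by (rule continuous_measurable_weight[OF cont])
    show "integrable M (\<lambda>x. indicator {..<c1} x *\<^sub>R (norm (y x))\<^sup>2 + indicator {c2<..} x *\<^sub>R (norm (y x))\<^sup>2 + indicator {c1..c2} x * B\<^sup>2)"
      using c1(2) c2(2) unfolding set_integrable_def
      by (intro Bochner_Integration.integrable_add compact_indicator_integrable[OF sub])
    have "(norm (y x))\<^sup>2 \<le> indicator {..<c1} x *\<^sub>R (norm (y x))\<^sup>2 + indicator {c2<..} x *\<^sub>R (norm (y x))\<^sup>2 + indicator {c1..c2} x * B\<^sup>2" for x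
    proof -
      consider "x < c1" | "c2 < x" | "c1 \<le> x" "x \<le> c2" by linarith
      then show ?thesis
      proof cases
        case 3
        then have "norm (y x) \<le> B" using B by auto
        then have "(norm (y x))\<^sup>2 \<le> B\<^sup>2" by (intro power_mono) auto
        then show ?thesis using 3 by (simp add: indicator_def)
      qed (auto simp: indicator_def)
    qed
    then show "AE x in M. (norm (y x))\<^sup>2 \<le> indicator {..<c1} x *\<^sub>R (norm (y x))\<^sup>2 + indicator {c2<..} x *\<^sub>R (norm (y x))\<^sup>2 + indicator {c1..c2} x * B\<^sup>2"
      by simp
  qed
qed

lemma solution_dom_max:
  assumes "sl_solution \<tau> z y"
  shows "y \<in> dom_max \<tau>" "AE x in lebesgue_on I. sl_apply \<tau> y x = z * y x"
proof -
  obtain h where h: "sl_pair y h (\<lambda>x. z * y x)" using assms sl_solution_iff by blast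
  show "y \<in> dom_max \<tau>" by (rule dom_maxI[OF h solution_SQ[OF assms] SQ_cmult[OF solution_SQ[OF assms]]])
  show "AE x in lebesgue_on I. sl_apply \<tau> y x = z * y x" by (rule sl_pair_frakD(3)[OF h])
qed

lemma dom_max_solution:
  assumes "y \<in> dom_max \<tau>" "AE x in lebesgue_on I. sl_apply \<tau> y x = z * y x"
  shows "sl_solution \<tau> z y"
  using assms by (simp add: sl_solution_def dom_max_def)

lemma fundamental_system:
  assumes c: "c \<in> I"
  obtains u1 u2 where "sl_solution \<tau> z u1" "sl_solution \<tau> z u2"
    "u1 c = 1" "quasi_deriv \<tau> u1 c = 0" "u2 c = 0" "quasi_deriv \<tau> u2 c = 1"
    "\<And>x. x \<in> I \<Longrightarrow> u1 x * quasi_deriv \<tau> u2 x - quasi_deriv \<tau> u1 x * u2 x = 1"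
proof -
  obtain u1 h1 where u1: "sl_pair u1 h1 (\<lambda>x. z * u1 x)" "u1 c = 1" "h1 c = 0"
    by (rule sl_solution_pair[OF c])
  obtain u2 h2 where u2: "sl_pair u2 h2 (\<lambda>x. z * u2 x)" "u2 c = 0" "h2 c = 1"
    by (rule sl_solution_pair[OF c])
  have q: "quasi_deriv \<tau> u1 x = h1 x" "quasi_deriv \<tau> u2 x = h2 x" if "x \<in> I" for x
    using sl_pair_frakD(2)[OF u1(1) that] sl_pair_frakD(2)[OF u2(1) that] by auto
  have "ac_primitive I (\<lambda>x. u1 x * h2 x - h1 x * u2 x) (\<lambda>x. 0)"
    using lagrange_identity[OF u1(1) u2(1)] by (simp add: algebra_simps)
  from ac_primitive_zero_const[OF interval_I this _ c]
  have "u1 x * h2 x - h1 x * u2 x = 1" if "x \<in> I" for x using that u1 u2 by simp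
  then show ?thesis
    using that[of u1 u2] sl_solution_iff u1 u2 q c by auto
qed

text \<open>
  The bilinear pairing; conjugation is written explicitly where the inner product is meant.
\<close>

definition weighted_int :: "(real \<Rightarrow> complex) \<Rightarrow> (real \<Rightarrow> complex) \<Rightarrow> complex" where
  "weighted_int f g = (LINT x|M. f x * g x)"

lemma left_integral_bounded:
  assumes k: "integrable (lebesgue_on I) k"
  shows "norm (left_integral k x) \<le> (LINT y|lebesgue. norm (indicator I y *\<^sub>R k y))"
  unfolding left_integral_def
proof (rule Bochner_Integration.integral_norm_bound_integral)
  show "integrable lebesgue (\<lambda>y. indicator {..<x} y *\<^sub>R (indicator I y *\<^sub>R k y))"
    by (rule integrable_mult_indicator[OF _ integrable_on_I(1)[OF k]]) simp
  show "integrable lebesgue (\<lambda>y. norm (indicator I y *\<^sub>R k y))"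
    by (rule integrable_norm[OF integrable_on_I(1)[OF k]])
qed (auto simp: indicator_def)

text \<open>
  The solution $g = u_1 \int_a^x u_2 V r\,dt - u_2 \int_a^x u_1 V r\,dt$ starts at the end point $a$ itself, which
  the square integrability of $u_1$ and $u_2$ permits. For the same reason the two integrals are bounded,
  so $g$ is square integrable; and $g$ behaves like the zero solution at $a$ and like a
  combination of $u_1$ and $u_2$ at $b$.
\<close>

lemma variation_of_parameters:
  assumes u: "sl_solution \<tau> 0 u1" "sl_solution \<tau> 0 u2"
    and W: "\<And>x. x \<in> I \<Longrightarrow> u1 x * quasi_deriv \<tau> u2 x - quasi_deriv \<tau> u1 x * u2 x = 1"
    and V: "V \<in> SQ"
  obtains g where "g \<in> dom_max \<tau>" "AE x in lebesgue_on I. sl_apply \<tau> g x = V x"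
    "\<And>f. f \<in> dom_max \<tau> \<Longrightarrow> bv FA g f = 0"
    "\<And>f. f \<in> dom_max \<tau> \<Longrightarrow> bv FB g f = weighted_int u2 V * bv FB u1 f - weighted_int u1 V * bv FB u2 f"
proof -
  note uD = solution_dom_max(1)[OF u(1)] solution_dom_max(1)[OF u(2)]
  note uSQ = solution_SQ[OF u(1)] solution_SQ[OF u(2)]
  define h1 h2 where "h1 = quasi_deriv \<tau> u1" and "h2 = quasi_deriv \<tau> u2"
  have pair: "sl_pair u1 h1 (\<lambda>x. 0)" "sl_pair u2 h2 (\<lambda>x. 0)"
    using sl_pair_cong_ae[OF dom_maxD(1)[OF uD(1)]] sl_pair_cong_ae[OF dom_maxD(1)[OF uD(2)]]
      solution_dom_max(2)[OF u(1)] solution_dom_max(2)[OF u(2)] by (simp_all add: h1_def h2_def)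
  define k1 k2 where "k1 x = of_real (r x) * (u1 x * V x)" and "k2 x = of_real (r x) * (u2 x * V x)" for x
  have k: "integrable (lebesgue_on I) k1" "integrable (lebesgue_on I) k2"
    and kint: "(LINT x|lebesgue_on I. k1 x) = weighted_int u1 V" "(LINT x|lebesgue_on I. k2 x) = weighted_int u2 V"
    using integrable_weight_iff[OF borel_measurable_integrable[OF SQ_mult_integrable[OF uSQ(1) V]]]
      integrable_weight_iff[OF borel_measurable_integrable[OF SQ_mult_integrable[OF uSQ(2) V]]]
      integral_weight[OF borel_measurable_integrable[OF SQ_mult_integrable[OF uSQ(1) V]]]
      integral_weight[OF borel_measurable_integrable[OF SQ_mult_integrable[OF uSQ(2) V]]]
      SQ_mult_integrable[OF uSQ(1) V] SQ_mult_integrable[OF uSQ(2) V]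
    by (simp_all add: k1_def[abs_def] k2_def[abs_def] weighted_int_def)
  define A1 A2 where "A1 = left_integral k1" and "A2 = left_integral k2"
  have A: "ac_primitive I A1 k1" "ac_primitive I A2 k2"
    unfolding A1_def A2_def by (intro ac_primitive_left_integral k)+
  define g where "g x = u1 x * A2 x - u2 x * A1 x" for x
  define h where "h x = h1 x * A2 x - h2 x * A1 x" for x
  have gp: "sl_pair g h V"
    unfolding sl_pair_def
  proof
    have "ac_primitive I g (\<lambda>x. (u1 x * k2 x + h1 x / of_real (p x) * A2 x) - (u2 x * k1 x + h2 x / of_real (p x) * A1 x))"
      unfolding g_def by (intro ac_primitive_diff ac_primitive_mult[OF open_I] A sl_pairD(1)[OF pair(1)] sl_pairD(1)[OF pair(2)])
    then show "ac_primitive I g (\<lambda>x. h x / of_real (p x))"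
      by (rule ac_primitive_cong) (simp_all add: k1_def k2_def h_def diff_divide_distrib)
    have "ac_primitive I h (\<lambda>x. (h1 x * k2 x + (of_real (q x) * u1 x - of_real (r x) * 0) * A2 x) - (h2 x * k1 x + (of_real (q x) * u2 x - of_real (r x) * 0) * A1 x))"
      unfolding h_def by (intro ac_primitive_diff ac_primitive_mult[OF open_I] A sl_pairD(2)[OF pair(1)] sl_pairD(2)[OF pair(2)])
    then show "ac_primitive I h (\<lambda>x. of_real (q x) * g x - of_real (r x) * V x)"
    proof (rule ac_primitive_cong)
      fix x assume x: "x \<in> I"
      have "of_real (r x) * V x = of_real (r x) * V x * (u1 x * h2 x - h1 x * u2 x)"
        using W[OF x] by (simp add: h1_def h2_def)
      then show "(h1 x * k2 x + (of_real (q x) * u1 x - of_real (r x) * 0) * A2 x) - (h2 x * k1 x + (of_real (q x) * u2 x - of_real (r x) * 0) * A1 x)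
        = of_real (q x) * g x - of_real (r x) * V x"
        by (simp add: k1_def k2_def g_def algebra_simps)
    qed simp
  qed
  have gSQ: "g \<in> SQ"
  proof -
    have m: "A1 \<in> borel_measurable M" "A2 \<in> borel_measurable M"
      by (rule continuous_measurable_weight, rule ac_primitive_continuous_on[OF open_I A(1)], simp,
          rule continuous_measurable_weight, rule ac_primitive_continuous_on[OF open_I A(2)], simp)
    have b: "norm (A1 x) \<le> (LINT y|lebesgue. norm (indicator I y *\<^sub>R k1 y))"
      "norm (A2 x) \<le> (LINT y|lebesgue. norm (indicator I y *\<^sub>R k2 y))" for x
      unfolding A1_def A2_def by (intro left_integral_bounded k)+
    have "(\<lambda>x. A2 x * u1 x - A1 x * u2 x) \<in> SQ"
      by (intro SQ_diff SQ_bounded_mult[OF uSQ(1) m(2) b(2)] SQ_bounded_mult[OF uSQ(2) m(1) b(1)])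
    then show ?thesis by (simp add: g_def[abs_def] mult.commute)
  qed
  have br: "bracket \<tau> g f x = A2 x * bracket \<tau> u1 f x - A1 x * bracket \<tau> u2 f x" if "x \<in> I" for f x
    unfolding bracket_def sl_pair_frakD(2)[OF gp that] by (simp add: g_def h_def h1_def h2_def algebra_simps)
  have FA_FB_ends: "FA \<in> ends" "FB \<in> ends" by (simp_all add: ends_def)
  show ?thesis
  proof (rule that)
    show "g \<in> dom_max \<tau>" by (rule dom_maxI[OF gp gSQ V])
    show "AE x in lebesgue_on I. sl_apply \<tau> g x = V x" by (rule sl_pair_frakD(3)[OF gp])
    fix f assume f: "f \<in> dom_max \<tau>"
    have "((\<lambda>x. A2 x * bracket \<tau> u1 f x - A1 x * bracket \<tau> u2 f x) \<longlongrightarrow> 0 * bv FA u1 f - 0 * bv FA u2 f) FA"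
      unfolding A1_def A2_def
      by (intro tendsto_diff tendsto_mult bv_tendsto[OF FA_FB_ends(1)] left_integral_limits(1) k uD f)
    then show "bv FA g f = 0" using bvI[OF FA_FB_ends(1) _ br] by simp
    have "((\<lambda>x. A2 x * bracket \<tau> u1 f x - A1 x * bracket \<tau> u2 f x) \<longlongrightarrow> weighted_int u2 V * bv FB u1 f - weighted_int u1 V * bv FB u2 f) FB"
      unfolding A1_def A2_def kint[symmetric]
      by (intro tendsto_diff tendsto_mult bv_tendsto[OF FA_FB_ends(2)] left_integral_limits(2) k uD f)
    then show "bv FB g f = weighted_int u2 V * bv FB u1 f - weighted_int u1 V * bv FB u2 f"
      by (rule bvI[OF FA_FB_ends(2) _ br])
  qed
qed

lemma weighted_int_lin:
  assumes "f \<in> SQ" "g \<in> SQ" "h \<in> SQ"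
  shows "weighted_int (\<lambda>x. f x + g x) h = weighted_int f h + weighted_int g h"
    "weighted_int (\<lambda>x. f x - g x) h = weighted_int f h - weighted_int g h"
  using SQ_mult_integrable[OF assms(1,3)] SQ_mult_integrable[OF assms(2,3)]
  by (simp_all add: weighted_int_def distrib_right left_diff_distrib)

lemma weighted_int_cmult: "weighted_int (\<lambda>x. k * f x) h = k * weighted_int f h"
  by (simp add: weighted_int_def mult.assoc)

lemma weighted_int_commute: "weighted_int f g = weighted_int g f"
  by (simp add: weighted_int_def mult.commute)

lemma weighted_int_cong:
  assumes "f \<in> SQ" "f' \<in> SQ" "g \<in> SQ" "g' \<in> SQ" "AE x in lebesgue_on I. f x = f' x" "AE x in lebesgue_on I. g x = g' x"
  shows "weighted_int f g = weighted_int f' g'"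
  unfolding weighted_int_def
proof (rule integral_cong_AE)
  show "(\<lambda>x. f x * g x) \<in> borel_measurable M" "(\<lambda>x. f' x * g' x) \<in> borel_measurable M"
    using assms SQ_mult_integrable by (auto intro!: borel_measurable_integrable)
  show "AE x in M. f x * g x = f' x * g' x"
    unfolding AE_weight using assms(5,6) by eventually_elim simp
qed

lemma weighted_int_zero_imp:
  assumes f: "f \<in> SQ" and z: "\<And>h. h \<in> SQ \<Longrightarrow> weighted_int f h = 0"
  shows "AE x in lebesgue_on I. f x = 0"
proof -
  have "weighted_int f (\<lambda>x. cnj (f x)) = 0" by (rule z[OF SQ_cnj[OF f]])
  then have "(LINT x|M. complex_of_real ((norm (f x))\<^sup>2)) = 0"
    by (simp only: weighted_int_def complex_norm_square)
  then have "complex_of_real (LINT x|M. (norm (f x))\<^sup>2) = 0" by (simp only: integral_complex_of_real)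
  then have "(LINT x|M. (norm (f x))\<^sup>2) = 0" by (simp only: of_real_eq_0_iff)
  moreover have "integrable M (\<lambda>x. (norm (f x))\<^sup>2)" using f by (simp add: square_integrable_def)
  ultimately have "AE x in M. (norm (f x))\<^sup>2 = 0"
    by (subst (asm) integral_nonneg_eq_0_iff_AE) auto
  then show ?thesis unfolding AE_weight by eventually_elim simp
qed

lemma green_weighted:
  assumes "f \<in> dom_max \<tau>" "g \<in> dom_max \<tau>"
  shows "bv FB f g - bv FA f g = weighted_int (\<lambda>x. cnj (g x)) (sl_apply \<tau> f) - weighted_int (\<lambda>x. cnj (sl_apply \<tau> g x)) f"
proof -
  note D = dom_maxD[OF assms(1)] dom_maxD[OF assms(2)]
  have "(LINT x|M. sl_apply \<tau> f x * cnj (g x) - f x * cnj (sl_apply \<tau> g x))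
    = (LINT x|M. cnj (g x) * sl_apply \<tau> f x) - (LINT x|M. cnj (sl_apply \<tau> g x) * f x)"
    using SQ_mult_integrable[OF SQ_cnj[OF D(5)] D(3)] SQ_mult_integrable[OF SQ_cnj[OF D(6)] D(2)]
    by (simp add: mult.commute)
  then show ?thesis using green_formula[OF assms] by (simp add: weighted_int_def)
qed

text \<open>
  The adjoint relation is tested against the solutions $g$ of $\tau g = h$ from \<open>variation_of_parameters\<close>. With $w$ the solution of
  $\tau w = V$ obtained there, Green's formula turns the relation into orthogonality of $U - w$, corrected by a solution of $\tau u = 0$, to every $h \in L^2$; so the
  corrected difference is zero. This gives a representative $f \in \operatorname{dom}(T_{\max})$ of $U$ with $\tau f = V$ almost everywhere.
  Green's formula once more gives equal boundary terms at both ends for all test functions. For those that vanish at $a$ this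
  means that $h$ is orthogonal to a combination of $u_1$ and $u_2$ with coefficients $[u_2,f](b)$ and $[u_1,f](b)$, for every $h$;
  so these are zero, and every bracket with $f$ vanishes at $b$, and then also at $a$.
\<close>

theorem adjoint_of_maximal:
  assumes U: "U \<in> SQ" and V: "V \<in> SQ"
    and adj: "\<And>g. g \<in> dom_max \<tau> \<Longrightarrow> weighted_int (\<lambda>x. cnj (U x)) (sl_apply \<tau> g) = weighted_int (\<lambda>x. cnj (V x)) g"
  obtains f where "f \<in> dom_max \<tau>" "AE x in lebesgue_on I. f x = U x" "AE x in lebesgue_on I. sl_apply \<tau> f x = V x"
    "\<And>F g. F \<in> ends \<Longrightarrow> g \<in> dom_max \<tau> \<Longrightarrow> bv F f g = 0"
proof -
  obtain c where c: "c \<in> I" using I_nonempty by blast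
  obtain u1 u2 where u: "sl_solution \<tau> 0 u1" "sl_solution \<tau> 0 u2"
    and uc: "u1 c = 1" "quasi_deriv \<tau> u1 c = 0" "u2 c = 0" "quasi_deriv \<tau> u2 c = 1"
    and W: "\<And>x. x \<in> I \<Longrightarrow> u1 x * quasi_deriv \<tau> u2 x - quasi_deriv \<tau> u1 x * u2 x = 1"
    using fundamental_system[OF c, of 0] by metis
  note uD = solution_dom_max(1)[OF u(1)] solution_dom_max(1)[OF u(2)]
  note uSQ = solution_SQ[OF u(1)] solution_SQ[OF u(2)]
  have FA_FB_ends: "FA \<in> ends" "FB \<in> ends" by (simp_all add: ends_def)
  obtain w where w: "w \<in> dom_max \<tau>" "AE x in lebesgue_on I. sl_apply \<tau> w x = V x"
    using variation_of_parameters[OF u W V] by metis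
  define \<alpha>1 \<alpha>2 where "\<alpha>1 = bv FB u1 w" and "\<alpha>2 = bv FB u2 w"
  \<comment> \<open>The conjugate of the correction, read off from the boundary values of \<open>g\<close> at the upper end.\<close>
  define e0 where "e0 x = \<alpha>2 * u1 x + (- \<alpha>1) * u2 x" for x
  have e0D: "e0 \<in> dom_max \<tau>" unfolding e0_def by (intro dom_max_add(1) dom_max_cmult(1) uD)
  have e0z: "AE x in lebesgue_on I. sl_apply \<tau> e0 x = 0"
    using dom_max_add(3)[OF dom_max_cmult(1)[OF uD(1), of \<alpha>2] dom_max_cmult(1)[OF uD(2), of "- \<alpha>1"]]
      dom_max_cmult(3)[OF uD(1), of \<alpha>2] dom_max_cmult(3)[OF uD(2), of "- \<alpha>1"]
      solution_dom_max(2)[OF u(1)] solution_dom_max(2)[OF u(2)]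
    unfolding e0_def by eventually_elim simp
  define f where "f x = w x + cnj (e0 x)" for x
  note eD = dom_max_cnj(1)[OF e0D]
  have f: "f \<in> dom_max \<tau>" unfolding f_def by (rule dom_max_add(1)[OF w(1) eD])
  have fV: "AE x in lebesgue_on I. sl_apply \<tau> f x = V x"
    using dom_max_add(3)[OF w(1) eD] dom_max_cnj(3)[OF e0D] e0z w(2)
    unfolding f_def by eventually_elim simp
  have orth: "weighted_int (\<lambda>x. cnj (U x) - cnj (f x)) h = 0" if h: "h \<in> SQ" for h
  proof -
    obtain g where g: "g \<in> dom_max \<tau>" "AE x in lebesgue_on I. sl_apply \<tau> g x = h x"
      "bv FA g w = 0" "bv FB g w = weighted_int u2 h * \<alpha>1 - weighted_int u1 h * \<alpha>2"
      using variation_of_parameters[OF u W h] w(1) unfolding \<alpha>1_def \<alpha>2_def by metis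
    note gD = dom_maxD[OF g(1)] and wD = dom_maxD[OF w(1)]
    have "weighted_int (\<lambda>x. cnj (U x)) h = weighted_int (\<lambda>x. cnj (U x)) (sl_apply \<tau> g)"
      using g(2) by (intro weighted_int_cong SQ_cnj U h gD) (auto elim: eventually_mono)
    also have "\<dots> = weighted_int (\<lambda>x. cnj (V x)) g" by (rule adj[OF g(1)])
    also have "\<dots> = weighted_int (\<lambda>x. cnj (sl_apply \<tau> w x)) g"
      using w(2) by (intro weighted_int_cong SQ_cnj V wD gD) (auto elim: eventually_mono)
    also have "\<dots> = weighted_int (\<lambda>x. cnj (w x)) (sl_apply \<tau> g) - (weighted_int u2 h * \<alpha>1 - weighted_int u1 h * \<alpha>2)"
      using green_weighted[OF g(1) w(1)] g(3,4) by simp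
    also have "weighted_int (\<lambda>x. cnj (w x)) (sl_apply \<tau> g) = weighted_int (\<lambda>x. cnj (w x)) h"
      using g(2) by (intro weighted_int_cong SQ_cnj wD h gD) (auto elim: eventually_mono)
    finally have "weighted_int (\<lambda>x. cnj (U x)) h = weighted_int (\<lambda>x. cnj (w x)) h + weighted_int e0 h"
      unfolding e0_def[abs_def] weighted_int_lin(1)[OF SQ_cmult[OF uSQ(1)] SQ_cmult[OF uSQ(2)] h] weighted_int_cmult
      by (simp add: algebra_simps)
    moreover have "weighted_int (\<lambda>x. cnj (f x)) h = weighted_int (\<lambda>x. cnj (w x)) h + weighted_int e0 h"
      unfolding f_def using weighted_int_lin(1)[OF SQ_cnj[OF wD(2)] dom_maxD(2)[OF e0D] h] by simp
    ultimately show ?thesis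
      using weighted_int_lin(2)[OF SQ_cnj[OF U] SQ_cnj[OF dom_maxD(2)[OF f]] h] by simp
  qed
  have "AE x in lebesgue_on I. cnj (U x) - cnj (f x) = 0"
    by (rule weighted_int_zero_imp[OF _ orth]) (intro SQ_diff SQ_cnj U dom_maxD(2)[OF f])
  then have fU: "AE x in lebesgue_on I. f x = U x" by eventually_elim simp
  have bal: "bv FB g f = bv FA g f" if g: "g \<in> dom_max \<tau>" for g
  proof -
    have "weighted_int (\<lambda>x. cnj (f x)) (sl_apply \<tau> g) = weighted_int (\<lambda>x. cnj (U x)) (sl_apply \<tau> g)"
      using fU by (intro weighted_int_cong SQ_cnj U dom_maxD[OF f] dom_maxD[OF g]) (auto elim: eventually_mono)
    moreover have "weighted_int (\<lambda>x. cnj (sl_apply \<tau> f x)) g = weighted_int (\<lambda>x. cnj (V x)) g"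
      using fV by (intro weighted_int_cong SQ_cnj V dom_maxD[OF f] dom_maxD[OF g]) (auto elim: eventually_mono)
    ultimately show ?thesis using green_weighted[OF g f] adj[OF g] by simp
  qed
  \<comment> \<open>The combination \<open>y\<close> is orthogonal to everything, so it vanishes, together with its coefficients.\<close>
  define \<beta>1 \<beta>2 where "\<beta>1 = bv FB u1 f" and "\<beta>2 = bv FB u2 f"
  define y where "y x = \<beta>1 * u2 x + (- \<beta>2) * u1 x" for x
  have y: "y \<in> dom_max \<tau>" unfolding y_def by (intro dom_max_add(1) dom_max_cmult(1) uD)
  have "AE x in lebesgue_on I. y x = 0"
  proof (rule weighted_int_zero_imp[OF dom_maxD(2)[OF y]])
    fix h assume h: "h \<in> SQ"
    obtain g where g: "g \<in> dom_max \<tau>" "bv FA g f = 0" "bv FB g f = weighted_int u2 h * \<beta>1 - weighted_int u1 h * \<beta>2"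
      using variation_of_parameters[OF u W h] f unfolding \<beta>1_def \<beta>2_def by metis
    then have "weighted_int u2 h * \<beta>1 - weighted_int u1 h * \<beta>2 = 0" using bal[OF g(1)] by simp
    then show "weighted_int y h = 0"
      unfolding y_def[abs_def] weighted_int_lin(1)[OF SQ_cmult[OF uSQ(2)] SQ_cmult[OF uSQ(1)] h] weighted_int_cmult
      by (simp add: algebra_simps)
  qed
  then have y0: "y x = 0" if "x \<in> I" for x
    using continuous_eq_if_AE_eq[OF open_I sl_pairD(3)[OF dom_maxD(1)[OF y]] continuous_on_const[of I 0] _ that] by blast
  have yq: "quasi_deriv \<tau> y c = 0" by (rule sl_pair_zero_imp[OF dom_maxD(1)[OF y] y0 c])
  have "quasi_deriv \<tau> y c = \<beta>1 * quasi_deriv \<tau> u2 c + (- \<beta>2) * quasi_deriv \<tau> u1 c"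
    unfolding y_def
    using dom_max_add(2)[OF dom_max_cmult(1)[OF uD(2), of \<beta>1] dom_max_cmult(1)[OF uD(1), of "- \<beta>2"] c]
      dom_max_cmult(2)[OF uD(2) c, of \<beta>1] dom_max_cmult(2)[OF uD(1) c, of "- \<beta>2"] by simp
  then have \<beta>: "\<beta>1 = 0" "\<beta>2 = 0" using yq y0[OF c] uc by (simp_all add: y_def)
  \<comment> \<open>By the Wronskian one, \<open>g\<close> is a combination of \<open>u1\<close> and \<open>u2\<close> at each point, with convergent coefficients.\<close>
  have zeroB: "bv FB g f = 0" if g: "g \<in> dom_max \<tau>" for g
  proof (rule bvI[OF FA_FB_ends(2)])
    let ?u1 = "\<lambda>x. cnj (u1 x)" and ?u2 = "\<lambda>x. cnj (u2 x)"
    show "((\<lambda>x. bracket \<tau> g ?u2 x * bracket \<tau> u1 f x - bracket \<tau> g ?u1 x * bracket \<tau> u2 f x) \<longlongrightarrow> 0) FB"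
      using tendsto_diff[OF tendsto_mult[OF bv_tendsto[OF FA_FB_ends(2) g dom_max_cnj(1)[OF uD(2)]] bv_tendsto[OF FA_FB_ends(2) uD(1) f]]
          tendsto_mult[OF bv_tendsto[OF FA_FB_ends(2) g dom_max_cnj(1)[OF uD(1)]] bv_tendsto[OF FA_FB_ends(2) uD(2) f]]]
      \<beta> by (simp add: \<beta>1_def \<beta>2_def)
    fix x assume x: "x \<in> I"
    have "bracket \<tau> g ?u2 x * bracket \<tau> u1 f x - bracket \<tau> g ?u1 x * bracket \<tau> u2 f x
      = bracket \<tau> g f x * (u1 x * quasi_deriv \<tau> u2 x - quasi_deriv \<tau> u1 x * u2 x)"
      by (simp add: bracket_def dom_max_cnj(2)[OF uD(1) x] dom_max_cnj(2)[OF uD(2) x] algebra_simps)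
    then show "bracket \<tau> g f x = bracket \<tau> g ?u2 x * bracket \<tau> u1 f x - bracket \<tau> g ?u1 x * bracket \<tau> u2 f x"
      using W[OF x] by simp
  qed
  show ?thesis
  proof (rule that[OF f fU fV])
    fix F g assume F: "F \<in> ends" and g: "g \<in> dom_max \<tau>"
    have "bv F g f = 0" using F zeroB[OF g] bal[OF g] by (auto simp: ends_def)
    then show "bv F f g = 0" using bv_swap[OF F g f] by simp
  qed
qed

end

section \<open>Equivalence classes and resolvents\<close>

lemma L2_class_cong:
  assumes "AE x in N. f x = g x"
  shows "L2_class N f = L2_class N g"
proof -
  have "(AE x in N. h x = f x) \<longleftrightarrow> (AE x in N. h x = g x)" for h
  proof
    assume "AE x in N. h x = f x"
    with assms show "AE x in N. h x = g x" by eventually_elim simp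
  next
    assume "AE x in N. h x = g x"
    with assms show "AE x in N. h x = f x" by eventually_elim simp
  qed
  then show ?thesis by (simp add: L2_class_def)
qed

lemma L2_class_self: "f \<in> square_integrable N \<Longrightarrow> f \<in> L2_class N f"
  by (simp add: L2_class_def)

lemma L2_class_eqD:
  assumes "L2_class N f = L2_class N g" "f \<in> square_integrable N"
  shows "AE x in N. f x = g x"
  using L2_class_self[OF assms(2)] unfolding assms(1) by (simp add: L2_class_def)

lemma L2_rep_class:
  assumes "f \<in> square_integrable N"
  shows "L2_rep (L2_class N f) \<in> square_integrable N" "AE x in N. L2_rep (L2_class N f) x = f x"
proof -
  have "L2_rep (L2_class N f) \<in> L2_class N f"
    unfolding L2_rep_def by (rule someI[of "\<lambda>g. g \<in> L2_class N f", OF L2_class_self[OF assms]])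
  then show "L2_rep (L2_class N f) \<in> square_integrable N" "AE x in N. L2_rep (L2_class N f) x = f x"
    by (auto simp: L2_class_def)
qed

lemma L2_class_in_L2: "f \<in> square_integrable N \<Longrightarrow> L2_class N f \<in> L2 N"
  by (simp add: L2_def)

lemma L2_E:
  assumes "F \<in> L2 N"
  obtains f where "f \<in> square_integrable N" "F = L2_class N f"
  using assms by (auto simp: L2_def)

lemma L2_diff_class:
  assumes "f \<in> square_integrable N" "g \<in> square_integrable N"
  shows "L2_diff N (L2_class N f) (L2_class N g) = L2_class N (\<lambda>x. f x - g x)"
  unfolding L2_diff_def
proof (rule L2_class_cong)
  show "AE x in N. L2_rep (L2_class N f) x - L2_rep (L2_class N g) x = f x - g x"
    using L2_rep_class(2)[OF assms(1)] L2_rep_class(2)[OF assms(2)] by eventually_elim simp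
qed

lemma L2_scale_class:
  assumes "f \<in> square_integrable N"
  shows "L2_scale N k (L2_class N f) = L2_class N (\<lambda>x. k * f x)"
  unfolding L2_scale_def
proof (rule L2_class_cong)
  show "AE x in N. k * L2_rep (L2_class N f) x = k * f x"
    using L2_rep_class(2)[OF assms] by eventually_elim simp
qed

lemma singular_2x2:
  fixes a b c d :: complex
  assumes "a * d - b * c = 0"
  obtains x y where "x \<noteq> 0 \<or> y \<noteq> 0" "a * x + b * y = 0" "c * x + d * y = 0"
proof (cases "a = 0 \<and> b = 0")
  case True
  show ?thesis
  proof (cases "c = 0 \<and> d = 0")
    case True
    then show ?thesis using \<open>a = 0 \<and> b = 0\<close> that[of 1 0] by simp
  next
    case False
    then show ?thesis using \<open>a = 0 \<and> b = 0\<close> that[of d "- c"] by (auto simp: mult.commute)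
  qed
next
  case False
  then show ?thesis using assms that[of b "- a"] by (auto simp: algebra_simps)
qed

context sl_limit_circle
begin

lemma L2_inner_class:
  assumes "f \<in> SQ" "g \<in> SQ"
  shows "L2_inner M (L2_class M f) (L2_class M g) = weighted_int (\<lambda>x. cnj (f x)) g"
proof -
  note R = L2_rep_class[OF assms(1)] L2_rep_class[OF assms(2)]
  have "AE x in lebesgue_on I. cnj (L2_rep (L2_class M f) x) = cnj (f x)"
    using R(2) unfolding AE_weight by eventually_elim simp
  moreover have "AE x in lebesgue_on I. L2_rep (L2_class M g) x = g x"
    using R(4) unfolding AE_weight .
  ultimately show ?thesis
    using weighted_int_cong[OF SQ_cnj[OF R(1)] SQ_cnj[OF assms(1)] R(3) assms(2)]
    by (simp add: L2_inner_def weighted_int_def)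
qed

lemma class_eq_iff:
  assumes "f \<in> SQ"
  shows "L2_class M f = L2_class M g \<longleftrightarrow> (AE x in lebesgue_on I. f x = g x)"
  using L2_class_cong[where N = M and f = f and g = g] L2_class_eqD[OF _ assms, of g] unfolding AE_weight by blast

lemma class_eq_dom_max:
  assumes "f \<in> dom_max \<tau>" "g \<in> dom_max \<tau>" "L2_class M f = L2_class M g" "x \<in> I"
  shows "f x = g x"
proof -
  have "AE x in lebesgue_on I. f x = g x" using assms(3) class_eq_iff[OF dom_maxD(2)[OF assms(1)]] by simp
  then show ?thesis
    using continuous_eq_if_AE_eq[OF open_I sl_pairD(3)[OF dom_maxD(1)[OF assms(1)]] sl_pairD(3)[OF dom_maxD(1)[OF assms(2)]] _ assms(4)]
    by blast
qed

definition operator_of :: "(real \<Rightarrow> complex) set \<Rightarrow> real L2_operator" where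
  "operator_of D = {(L2_class M g, L2_class M (sl_apply \<tau> g)) |g. g \<in> D}"

lemma shift_operator_of:
  assumes "D \<subseteq> dom_max \<tau>"
  shows "(F, G) \<in> shift_op M (operator_of D) z \<longleftrightarrow>
    (\<exists>g\<in>D. F = L2_class M g \<and> G = L2_class M (\<lambda>x. sl_apply \<tau> g x - z * g x))"
proof -
  have "L2_diff M (L2_class M (sl_apply \<tau> g)) (L2_scale M z (L2_class M g)) = L2_class M (\<lambda>x. sl_apply \<tau> g x - z * g x)"
    if "g \<in> D" for g
  proof -
    have "g \<in> dom_max \<tau>" using assms that by auto
    note D = dom_maxD[OF this]
    show ?thesis unfolding L2_scale_class[OF D(2)] L2_diff_class[OF D(3) SQ_cmult[OF D(2)]] ..
  qed
  then show ?thesis unfolding shift_op_def operator_of_def by auto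
qed

text \<open>
  Both the class of $y$ and the zero class are mapped to zero by the shifted operator.
\<close>

lemma resolvent_set_injective:
  assumes z: "z \<in> resolvent_set M (operator_of D)" and D: "D \<subseteq> dom_max \<tau>" "(\<lambda>x. 0) \<in> D"
    and y: "y \<in> D" "sl_solution \<tau> z y" and x: "x \<in> I"
  shows "y x = 0"
proof -
  have zero: "L2_class M (\<lambda>x. sl_apply \<tau> g x - z * g x) = L2_class M (\<lambda>x. 0)" if "sl_solution \<tau> z g" for g
  proof (rule L2_class_cong, unfold AE_weight)
    show "AE x in lebesgue_on I. sl_apply \<tau> g x - z * g x = 0"
      using solution_dom_max(2)[OF that] by eventually_elim simp
  qed
  have "sl_pair (\<lambda>x. 0) (\<lambda>x. 0) (\<lambda>x. z * 0)" using ac_primitive_const[of I 0] by (simp add: sl_pair_def)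
  then have s0: "sl_solution \<tau> z (\<lambda>x. 0)" unfolding sl_solution_iff by blast
  have "(L2_class M y, L2_class M (\<lambda>x. 0)) \<in> shift_op M (operator_of D) z"
    unfolding shift_operator_of[OF D(1)] using y zero[OF y(2)] by auto
  moreover have "(L2_class M (\<lambda>x. 0), L2_class M (\<lambda>x. 0)) \<in> shift_op M (operator_of D) z"
    unfolding shift_operator_of[OF D(1)] using D(2) zero[OF s0] by (intro bexI[of _ "\<lambda>x. 0"]) auto
  moreover have "L2_class M (\<lambda>x. 0) \<in> L2 M"
    using D by (intro L2_class_in_L2) (auto dest: dom_maxD(2))
  ultimately have "L2_class M y = L2_class M (\<lambda>x. 0)"
    using z unfolding resolvent_set_def by blast
  then show ?thesis using class_eq_dom_max[of y "\<lambda>x. 0" x] y(1) D x by auto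
qed

lemma resolventI:
  assumes z: "z \<in> resolvent_set M (operator_of D)" and D: "D \<subseteq> dom_max \<tau>" and g: "g \<in> D" and V: "V \<in> SQ"
    and eq: "AE x in lebesgue_on I. sl_apply \<tau> g x - z * g x = V x"
  shows "resolvent M (operator_of D) z (L2_class M V) = L2_class M g"
proof -
  have "L2_class M V = L2_class M (\<lambda>x. sl_apply \<tau> g x - z * g x)"
  proof (rule L2_class_cong, unfold AE_weight)
    show "AE x in lebesgue_on I. V x = sl_apply \<tau> g x - z * g x"
      using eq by eventually_elim simp
  qed
  then have "(L2_class M g, L2_class M V) \<in> shift_op M (operator_of D) z"
    unfolding shift_operator_of[OF D] using g by blast
  moreover have "\<exists>!F. (F, L2_class M V) \<in> shift_op M (operator_of D) z"
    using z L2_class_in_L2[OF V] by (auto simp: resolvent_set_def)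
  ultimately show ?thesis unfolding resolvent_def by (intro the1_equality)
qed

lemma resolventE:
  assumes z: "z \<in> resolvent_set M (operator_of D)" and D: "D \<subseteq> dom_max \<tau>" and V: "V \<in> SQ"
  obtains g where "g \<in> D" "AE x in lebesgue_on I. sl_apply \<tau> g x - z * g x = V x"
    "resolvent M (operator_of D) z (L2_class M V) = L2_class M g"
proof -
  have "\<exists>!F. (F, L2_class M V) \<in> shift_op M (operator_of D) z"
    using z L2_class_in_L2[OF V] by (auto simp: resolvent_set_def)
  then obtain F where "(F, L2_class M V) \<in> shift_op M (operator_of D) z" by blast
  then obtain g where g: "g \<in> D" "L2_class M V = L2_class M (\<lambda>x. sl_apply \<tau> g x - z * g x)"
    unfolding shift_operator_of[OF D] by blast
  have "AE x in lebesgue_on I. V x = sl_apply \<tau> g x - z * g x"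
    using g(2) class_eq_iff[OF V] by simp
  then have "AE x in lebesgue_on I. sl_apply \<tau> g x - z * g x = V x" by eventually_elim simp
  from that[OF g(1) this resolventI[OF z D g(1) V this]] show ?thesis .
qed

end

section \<open>Separated boundary conditions and Krein's formula\<close>

locale sl_boundary_bases = sl_limit_circle +
  fixes \<phi>a \<psi>a \<phi>b \<psi>b :: "real \<Rightarrow> complex"
  assumes basis_a: "bc_basis_lower \<tau> \<phi>a \<psi>a" and basis_b: "bc_basis_upper \<tau> \<phi>b \<psi>b"
begin

lemma FA_FB_ends: "FA \<in> ends" "FB \<in> ends" by (simp_all add: ends_def)

lemma basis_facts:
  "\<phi>a \<in> dom_max \<tau>" "\<psi>a \<in> dom_max \<tau>" "real_valued_on I \<phi>a" "real_valued_on I \<psi>a" "bv FA \<psi>a \<phi>a = 1"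
  "\<phi>b \<in> dom_max \<tau>" "\<psi>b \<in> dom_max \<tau>" "real_valued_on I \<phi>b" "real_valued_on I \<psi>b" "bv FB \<psi>b \<phi>b = 1"
  using basis_a basis_b by (simp_all add: bc_basis_lower_def bc_basis_upper_def bracket_lower_bv bracket_upper_bv)

definition sep_dom :: "real \<Rightarrow> real \<Rightarrow> (real \<Rightarrow> complex) set" where
  "sep_dom \<alpha> \<beta> = {g \<in> dom_max \<tau>. of_real (cos \<alpha>) * bv FA g \<phi>a + of_real (sin \<alpha>) * bv FA g \<psi>a = 0 \<and>
     of_real (cos \<beta>) * bv FB g \<phi>b + of_real (sin \<beta>) * bv FB g \<psi>b = 0}"

lemma T_sep_operator_of: "T_sep \<tau> \<phi>a \<psi>a \<phi>b \<psi>b \<alpha> \<beta> = operator_of (sep_dom \<alpha> \<beta>)"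
  unfolding T_sep_def operator_of_def sep_dom_def bracket_lower_bv bracket_upper_bv by auto

lemma sep_dom_sub: "sep_dom \<alpha> \<beta> \<subseteq> dom_max \<tau>"
  by (auto simp: sep_dom_def)

lemma sep_dom_zero: "(\<lambda>x. 0) \<in> sep_dom \<alpha> \<beta>"
  using dom_max_cmult(1)[OF basis_facts(1), of 0] bv_cmult[OF FA_FB_ends(1) basis_facts(1), of _ 0] bv_cmult[OF FA_FB_ends(2) basis_facts(1), of _ 0] basis_facts
  by (simp add: sep_dom_def)

lemma sep_dom_00: "g \<in> sep_dom 0 0 \<longleftrightarrow> g \<in> dom_max \<tau> \<and> bv FA g \<phi>a = 0 \<and> bv FB g \<phi>b = 0"
  by (simp add: sep_dom_def)

lemma sep_dom_cot:
  assumes "\<alpha> \<in> {0<..<pi}" "\<beta> \<in> {0<..<pi}"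
  shows "g \<in> sep_dom \<alpha> \<beta> \<longleftrightarrow> g \<in> dom_max \<tau> \<and> of_real (cot \<alpha>) * bv FA g \<phi>a + bv FA g \<psi>a = 0 \<and>
     of_real (cot \<beta>) * bv FB g \<phi>b + bv FB g \<psi>b = 0"
proof -
  have s: "sin \<alpha> \<noteq> 0" "sin \<beta> \<noteq> 0" using assms sin_gt_zero by force+
  have "of_real (cos t) * X + of_real (sin t) * Y = of_real (sin t) * (of_real (cot t) * X + Y)" if "sin t \<noteq> 0"
    for t and X Y :: complex
    using that by (simp add: cot_def algebra_simps)
  then show ?thesis using s by (simp add: sep_dom_def)
qed

text \<open>
  A class contains at most one function of the maximal domain, up to values outside the interval. So a common element of the two
  graphs is represented by one function with $[g,\phi] = [g,\psi] = 0$ at both ends.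
\<close>

theorem common_part_is_minimal:
  assumes \<alpha>\<beta>: "\<alpha> \<in> {0<..<pi}" "\<beta> \<in> {0<..<pi}"
  shows "max_common_part (operator_of (sep_dom 0 0)) (operator_of (sep_dom \<alpha> \<beta>)) = T_min \<tau>"
proof (intro set_eqI iffI)
  fix FG assume "FG \<in> max_common_part (operator_of (sep_dom 0 0)) (operator_of (sep_dom \<alpha> \<beta>))"
  then obtain g g' where g: "FG = (L2_class M g, L2_class M (sl_apply \<tau> g))" "g \<in> sep_dom 0 0"
    and g': "L2_class M g = L2_class M g'" "g' \<in> sep_dom \<alpha> \<beta>"
    unfolding max_common_part_def operator_of_def by auto
  have dm: "g \<in> dom_max \<tau>" "g' \<in> dom_max \<tau>" using g g' sep_dom_sub by auto
  have "g x = g' x" if "x \<in> I" for x by (rule class_eq_dom_max[OF dm g'(1) that])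
  then have same: "bv F g k = bv F g' k" if "F \<in> ends" "k \<in> dom_max \<tau>" for F k
    by (intro bv_cong[OF that(1) dm that(2)])
  have z: "bv FA g \<phi>a = 0" "bv FB g \<phi>b = 0" using g(2) sep_dom_00 by auto
  have z': "bv FA g \<psi>a = 0" "bv FB g \<psi>b = 0"
    using g'(2) z same[OF FA_FB_ends(1)] same[OF FA_FB_ends(2)] basis_facts unfolding sep_dom_cot[OF \<alpha>\<beta>] by auto
  have "weighted_int (\<lambda>x. cnj (g x)) (sl_apply \<tau> k) = weighted_int (\<lambda>x. cnj (sl_apply \<tau> g x)) k" if k: "k \<in> dom_max \<tau>" for k
  proof -
    have "bv FA k g = 0" "bv FB k g = 0"
      using bv_pluecker[OF FA_FB_ends(1) k dm(1) basis_facts(1,3,2,4,5)] bv_pluecker[OF FA_FB_ends(2) k dm(1) basis_facts(6,8,7,9,10)] z z' by simp_all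
    then show ?thesis using green_weighted[OF k dm(1)] by simp
  qed
  then show "FG \<in> T_min \<tau>"
    using dom_maxD[OF dm(1)] dom_maxD(2,3)
    by (auto simp: T_min_def adjoint_op_def T_max_def g(1) L2_class_in_L2 L2_inner_class)
next
  fix FG assume FG: "FG \<in> T_min \<tau>"
  obtain F G where FGe: "FG = (F, G)" by fastforce
  have "F \<in> L2 M" "G \<in> L2 M" using FG by (auto simp: FGe T_min_def adjoint_op_def)
  then obtain U V where U: "U \<in> SQ" "F = L2_class M U" and V: "V \<in> SQ" "G = L2_class M V" using L2_E by metis
  have adj: "weighted_int (\<lambda>x. cnj (U x)) (sl_apply \<tau> g) = weighted_int (\<lambda>x. cnj (V x)) g" if g: "g \<in> dom_max \<tau>" for g
  proof -
    have "(L2_class M g, L2_class M (sl_apply \<tau> g)) \<in> T_max \<tau>" using g by (auto simp: T_max_def)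
    then have "L2_inner M F (L2_class M (sl_apply \<tau> g)) = L2_inner M G (L2_class M g)"
      using FG by (auto simp: FGe T_min_def adjoint_op_def)
    then show ?thesis using dom_maxD[OF g] U V by (simp add: L2_inner_class)
  qed
  obtain f where f: "f \<in> dom_max \<tau>" "AE x in lebesgue_on I. f x = U x" "AE x in lebesgue_on I. sl_apply \<tau> f x = V x"
    "\<And>E g. E \<in> ends \<Longrightarrow> g \<in> dom_max \<tau> \<Longrightarrow> bv E f g = 0"
    using adjoint_of_maximal[OF U(1) V(1) adj] by metis
  have "F = L2_class M f" "G = L2_class M (sl_apply \<tau> f)"
    using f(2,3) class_eq_iff dom_maxD[OF f(1)] U V by auto
  moreover have "f \<in> sep_dom a b" for a b
    unfolding sep_dom_def using f(1) f(4)[OF FA_FB_ends(1)] f(4)[OF FA_FB_ends(2)] basis_facts by simp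
  ultimately show "FG \<in> max_common_part (operator_of (sep_dom 0 0)) (operator_of (sep_dom \<alpha> \<beta>))"
    unfolding FGe max_common_part_def operator_of_def by blast
qed

text \<open>
  The properties that characterize $u_{z,j}$.
\<close>

definition boundary_solution :: "complex \<Rightarrow> 2 \<Rightarrow> (real \<Rightarrow> complex) \<Rightarrow> bool" where
  "boundary_solution z j y \<longleftrightarrow> sl_solution \<tau> z y \<and>
     bv FA y \<phi>a = (if j = 1 then 0 else 1) \<and> bv FB y \<phi>b = (if j = 1 then 1 else 0)"

lemma sol_u_boundary_solution:
  assumes "boundary_solution z j y"
  shows "boundary_solution z j (sol_u \<tau> \<phi>a \<phi>b z j)"
proof -
  have "sol_u \<tau> \<phi>a \<phi>b z j = (SOME y. boundary_solution z j y)"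
    unfolding sol_u_def boundary_solution_def bracket_lower_bv bracket_upper_bv
    by (rule arg_cong[where f = Eps]) auto
  then show ?thesis using someI[of "boundary_solution z j", OF assms] by simp
qed

text \<open>
  The map from solutions to their boundary values $([y,\phi_a](a),[y,\phi_b](b))$ is linear on a two-dimensional
  space. It is injective, since a solution in its kernel lies in the domain of $T_{0,0}$; hence it is onto.
\<close>

lemma boundary_solution_exists:
  assumes z: "z \<in> resolvent_set M (operator_of (sep_dom 0 0))"
  shows "\<exists>y. boundary_solution z j y"
proof -
  obtain c where c: "c \<in> I" using I_nonempty by blast
  obtain v1 v2 where v: "sl_solution \<tau> z v1" "sl_solution \<tau> z v2"
    and vc: "v1 c = 1" "quasi_deriv \<tau> v1 c = 0" "v2 c = 0" "quasi_deriv \<tau> v2 c = 1"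
    using fundamental_system[OF c, of z] by metis
  note vD = solution_dom_max(1)[OF v(1)] solution_dom_max(1)[OF v(2)]
  define a1 a2 b1 b2 where "a1 = bv FA v1 \<phi>a" "a2 = bv FA v2 \<phi>a" "b1 = bv FB v1 \<phi>b" "b2 = bv FB v2 \<phi>b"
  have comb: "sl_solution \<tau> z (\<lambda>x. s * v1 x + t * v2 x)"
    "bv FA (\<lambda>x. s * v1 x + t * v2 x) \<phi>a = a1 * s + a2 * t"
    "bv FB (\<lambda>x. s * v1 x + t * v2 x) \<phi>b = b1 * s + b2 * t"
    "quasi_deriv \<tau> (\<lambda>x. s * v1 x + t * v2 x) c = t" for s t
  proof -
    note sD = dom_max_cmult(1)[OF vD(1), of s] dom_max_cmult(1)[OF vD(2), of t]
    have "AE x in lebesgue_on I. sl_apply \<tau> (\<lambda>x. s * v1 x + t * v2 x) x = z * (s * v1 x + t * v2 x)"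
      using dom_max_add(3)[OF sD] dom_max_cmult(3)[OF vD(1), of s] dom_max_cmult(3)[OF vD(2), of t]
        solution_dom_max(2)[OF v(1)] solution_dom_max(2)[OF v(2)]
      by eventually_elim (simp add: algebra_simps)
    then show "sl_solution \<tau> z (\<lambda>x. s * v1 x + t * v2 x)" by (rule dom_max_solution[OF dom_max_add(1)[OF sD]])
    show "bv FA (\<lambda>x. s * v1 x + t * v2 x) \<phi>a = a1 * s + a2 * t"
      "bv FB (\<lambda>x. s * v1 x + t * v2 x) \<phi>b = b1 * s + b2 * t"
      unfolding bv_add[OF FA_FB_ends(1) sD basis_facts(1)] bv_add[OF FA_FB_ends(2) sD basis_facts(6)] bv_cmult[OF FA_FB_ends(1) vD(1) basis_facts(1)]
        bv_cmult[OF FA_FB_ends(1) vD(2) basis_facts(1)] bv_cmult[OF FA_FB_ends(2) vD(1) basis_facts(6)] bv_cmult[OF FA_FB_ends(2) vD(2) basis_facts(6)]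
      by (simp_all add: a1_a2_b1_b2_def mult.commute)
    show "quasi_deriv \<tau> (\<lambda>x. s * v1 x + t * v2 x) c = t"
      unfolding dom_max_add(2)[OF sD c] dom_max_cmult(2)[OF vD(1) c] dom_max_cmult(2)[OF vD(2) c] by (simp add: vc)
  qed
  have det: "a1 * b2 - a2 * b1 \<noteq> 0"
  proof
    assume "a1 * b2 - a2 * b1 = 0"
    then obtain s t where st: "s \<noteq> 0 \<or> t \<noteq> 0" "a1 * s + a2 * t = 0" "b1 * s + b2 * t = 0"
      by (rule singular_2x2)
    let ?y = "\<lambda>x. s * v1 x + t * v2 x"
    have yD: "?y \<in> dom_max \<tau>" by (rule solution_dom_max(1)[OF comb(1)])
    have "?y \<in> sep_dom 0 0" unfolding sep_dom_00 using yD comb(2,3) st by simp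
    then have y0: "?y x = 0" if "x \<in> I" for x
      using resolvent_set_injective[OF z sep_dom_sub sep_dom_zero _ comb(1) that] by blast
    have "s = 0" using y0[OF c] vc by simp
    moreover have "t = 0" using sl_pair_zero_imp[OF dom_maxD(1)[OF yD] y0 c] comb(4)[of s t] by simp
    ultimately show False using st(1) by simp
  qed
  have solve: "\<exists>y. sl_solution \<tau> z y \<and> bv FA y \<phi>a = ta \<and> bv FB y \<phi>b = tb" for ta tb
  proof -
    let ?d = "a1 * b2 - a2 * b1"
    let ?s = "(ta * b2 - tb * a2) / ?d" and ?t = "(tb * a1 - ta * b1) / ?d"
    have "a1 * ?s + a2 * ?t = (a1 * (ta * b2 - tb * a2) + a2 * (tb * a1 - ta * b1)) / ?d"
      "b1 * ?s + b2 * ?t = (b1 * (ta * b2 - tb * a2) + b2 * (tb * a1 - ta * b1)) / ?d"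
      by (simp_all add: add_divide_distrib)
    moreover have "a1 * (ta * b2 - tb * a2) + a2 * (tb * a1 - ta * b1) = ta * ?d"
      "b1 * (ta * b2 - tb * a2) + b2 * (tb * a1 - ta * b1) = tb * ?d"
      by (simp_all add: algebra_simps)
    ultimately have e: "a1 * ?s + a2 * ?t = ta" "b1 * ?s + b2 * ?t = tb"
      using det by (simp_all only: nonzero_mult_div_cancel_right not_False_eq_True)
    have "sl_solution \<tau> z (\<lambda>x. ?s * v1 x + ?t * v2 x) \<and> bv FA (\<lambda>x. ?s * v1 x + ?t * v2 x) \<phi>a = ta
        \<and> bv FB (\<lambda>x. ?s * v1 x + ?t * v2 x) \<phi>b = tb"
      using comb(1)[of ?s ?t] comb(2)[of ?s ?t, unfolded e] comb(3)[of ?s ?t, unfolded e] by (intro conjI)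
    then show ?thesis by (rule exI[of _ "\<lambda>x. ?s * v1 x + ?t * v2 x"])
  qed
  show ?thesis unfolding boundary_solution_def by (rule solve)
qed

text \<open>
  Conjugation carries the solutions for $z$ to those for $\overline z$. Therefore $u_{\overline z,j}$ is available as soon as $z$ is in the
  resolvent set of $T_{0,0}$.
\<close>

lemma boundary_solution_cnj:
  assumes "boundary_solution z j y"
  shows "boundary_solution (cnj z) j (\<lambda>x. cnj (y x))"
proof -
  have s: "sl_solution \<tau> z y" using assms by (simp add: boundary_solution_def)
  then obtain h where "sl_pair y h (\<lambda>x. z * y x)" using sl_solution_iff by blast
  from sl_pair_cnj[OF this] have "sl_solution \<tau> (cnj z) (\<lambda>x. cnj (y x))" unfolding sl_solution_iff by auto
  then show ?thesis
    using assms bv_cnj[OF FA_FB_ends(1) solution_dom_max(1)[OF s] basis_facts(1,3)] bv_cnj[OF FA_FB_ends(2) solution_dom_max(1)[OF s] basis_facts(6,8)]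
    by (auto simp: boundary_solution_def)
qed

text \<open>
  For every $e$ the function $f = f_0 - e_1 u_{z,1} - e_2 u_{z,2}$ satisfies $(\tau - z)f = F$. The choice $e = (K^{-1})^T c$ gives
  $K^T e = c$, and these two equations are the boundary conditions of $T_{\alpha,\beta}$ at $b$ and at $a$.
\<close>

theorem krein_formula:
  assumes \<alpha>\<beta>: "\<alpha> \<in> {0<..<pi}" "\<beta> \<in> {0<..<pi}"
    and z0: "z \<in> resolvent_set M (operator_of (sep_dom 0 0))" and z1: "z \<in> resolvent_set M (operator_of (sep_dom \<alpha> \<beta>))"
  defines "u \<equiv> sol_u \<tau> \<phi>a \<phi>b" and "K \<equiv> K_matrix \<tau> \<phi>a \<psi>a \<phi>b \<psi>b \<alpha> \<beta> z"
  shows "invertible K"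
    and "F \<in> L2 M \<Longrightarrow> resolvent M (operator_of (sep_dom \<alpha> \<beta>)) z F =
          L2_diff M (resolvent M (operator_of (sep_dom 0 0)) z F)
            (L2_class M (\<lambda>x. \<Sum>j\<in>UNIV. \<Sum>k\<in>UNIV.
               matrix_inv K $ j $ k * L2_inner M (L2_class M (u (cnj z) j)) F * u z k x))"
proof -
  have ub: "boundary_solution z j (u z j)" "boundary_solution (cnj z) j (u (cnj z) j)" for j
    using boundary_solution_exists[OF z0, of j] sol_u_boundary_solution boundary_solution_cnj unfolding u_def by blast+
  note sol = ub(1)[unfolded boundary_solution_def, THEN conjunct1]
    and solc = ub(2)[unfolded boundary_solution_def, THEN conjunct1]
  note uD = solution_dom_max(1)[OF sol] and ucD = solution_dom_max(1)[OF solc]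
  have ubv: "bv FA (u z 1) \<phi>a = 0" "bv FB (u z 1) \<phi>b = 1" "bv FA (u z 2) \<phi>a = 1" "bv FB (u z 2) \<phi>b = 0"
    "bv FA (u (cnj z) 1) \<phi>a = 0" "bv FB (u (cnj z) 1) \<phi>b = 1" "bv FA (u (cnj z) 2) \<phi>a = 1" "bv FB (u (cnj z) 2) \<phi>b = 0"
    using ub[of 1] ub[of 2] by (simp_all add: boundary_solution_def)
  have K: "K $ 1 $ 1 = of_real (cot \<beta>) + bv FB (u z 1) \<psi>b" "K $ 1 $ 2 = - bv FA (u z 1) \<psi>a"
    "K $ 2 $ 1 = bv FB (u z 2) \<psi>b" "K $ 2 $ 2 = - of_real (cot \<alpha>) - bv FA (u z 2) \<psi>a"
    unfolding K_def K_matrix_def Let_def u_def bracket_lower_bv bracket_upper_bv by simp_all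
  have comb: "(\<lambda>x. f x + (s * u z 1 x + t * u z 2 x)) \<in> dom_max \<tau>"
    "bv E (\<lambda>x. f x + (s * u z 1 x + t * u z 2 x)) g = bv E f g + (s * bv E (u z 1) g + t * bv E (u z 2) g)"
    "AE x in lebesgue_on I. sl_apply \<tau> (\<lambda>x. f x + (s * u z 1 x + t * u z 2 x)) x - z * (f x + (s * u z 1 x + t * u z 2 x))
       = sl_apply \<tau> f x - z * f x"
    if f: "f \<in> dom_max \<tau>" and E: "E \<in> ends" and g: "g \<in> dom_max \<tau>" for f s t E g
  proof -
    note sD = dom_max_cmult(1)[OF uD[of 1], of s] dom_max_cmult(1)[OF uD[of 2], of t]
    note aD = dom_max_add(1)[OF sD]
    show "(\<lambda>x. f x + (s * u z 1 x + t * u z 2 x)) \<in> dom_max \<tau>" by (rule dom_max_add(1)[OF f aD])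
    show "bv E (\<lambda>x. f x + (s * u z 1 x + t * u z 2 x)) g = bv E f g + (s * bv E (u z 1) g + t * bv E (u z 2) g)"
      unfolding bv_add[OF E f aD g] bv_add[OF E sD g] bv_cmult[OF E uD g] ..
    show "AE x in lebesgue_on I. sl_apply \<tau> (\<lambda>x. f x + (s * u z 1 x + t * u z 2 x)) x - z * (f x + (s * u z 1 x + t * u z 2 x))
       = sl_apply \<tau> f x - z * f x"
      using dom_max_add(3)[OF f aD] dom_max_add(3)[OF sD] dom_max_cmult(3)[OF uD[of 1], of s] dom_max_cmult(3)[OF uD[of 2], of t]
        solution_dom_max(2)[OF sol[of 1]] solution_dom_max(2)[OF sol[of 2]]
      by eventually_elim (simp add: algebra_simps)
  qed
  show inv: "invertible K"
    unfolding invertible_det_nz det_2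
  proof
    assume "K $ 1 $ 1 * K $ 2 $ 2 - K $ 1 $ 2 * K $ 2 $ 1 = 0"
    then have "K $ 1 $ 1 * K $ 2 $ 2 - K $ 2 $ 1 * K $ 1 $ 2 = 0" by (simp add: mult.commute)
    then obtain s t where st: "s \<noteq> 0 \<or> t \<noteq> 0" "K $ 1 $ 1 * s + K $ 2 $ 1 * t = 0" "K $ 1 $ 2 * s + K $ 2 $ 2 * t = 0"
      by (rule singular_2x2)
    let ?y = "\<lambda>x. 0 + (s * u z 1 x + t * u z 2 x)"
    have zD: "(\<lambda>x. 0) \<in> dom_max \<tau>" using sep_dom_zero[of 0 0] sep_dom_sub by blast
    have zbv: "bv E (\<lambda>x. 0) g = 0" if "E \<in> ends" "g \<in> dom_max \<tau>" for E g
      using bv_cmult[OF that(1) basis_facts(1) that(2), of 0] by simp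
    have zsol: "AE x in lebesgue_on I. sl_apply \<tau> (\<lambda>x. 0) x = 0"
      using dom_max_cmult(3)[OF basis_facts(1), of 0] by simp
    note c = comb[OF zD, of _ _ s t]
    have ya: "bv FA ?y \<phi>a = t" "bv FA ?y \<psi>a = s * bv FA (u z 1) \<psi>a + t * bv FA (u z 2) \<psi>a"
      "bv FB ?y \<phi>b = s" "bv FB ?y \<psi>b = s * bv FB (u z 1) \<psi>b + t * bv FB (u z 2) \<psi>b"
      using c(2)[OF FA_FB_ends(1) basis_facts(1)] c(2)[OF FA_FB_ends(1) basis_facts(2)] c(2)[OF FA_FB_ends(2) basis_facts(6)] c(2)[OF FA_FB_ends(2) basis_facts(7)]
        zbv FA_FB_ends basis_facts ubv by simp_all
    have yD: "?y \<in> dom_max \<tau>" by (rule c(1)[OF FA_FB_ends(1) basis_facts(1)])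
    have "?y \<in> sep_dom \<alpha> \<beta>"
      unfolding sep_dom_cot[OF \<alpha>\<beta>] ya using yD st(2,3) unfolding K by (simp add: algebra_simps add_eq_0_iff)
    moreover have "sl_solution \<tau> z ?y"
    proof (rule dom_max_solution[OF yD])
      show "AE x in lebesgue_on I. sl_apply \<tau> ?y x = z * ?y x"
        using c(3)[OF FA_FB_ends(1) basis_facts(1)] zsol by eventually_elim simp
    qed
    ultimately have y0: "?y x = 0" if "x \<in> I" for x
      using resolvent_set_injective[OF z1 sep_dom_sub sep_dom_zero _ _ that] by blast
    have "bv E ?y g = bv E (\<lambda>x. 0) g" if "E \<in> ends" "g \<in> dom_max \<tau>" for E g
      by (rule bv_cong[OF that(1) yD zD that(2) y0])
    then have "s = 0" "t = 0" using ya(1,3) zbv FA_FB_ends basis_facts by auto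
    then show False using st(1) by simp
  qed
  assume "F \<in> L2 M"
  then obtain V where V: "V \<in> SQ" "F = L2_class M V" by (rule L2_E)
  obtain f0 where f0: "f0 \<in> sep_dom 0 0" "AE x in lebesgue_on I. sl_apply \<tau> f0 x - z * f0 x = V x"
    "resolvent M (operator_of (sep_dom 0 0)) z F = L2_class M f0"
    using resolventE[OF z0 sep_dom_sub V(1)] unfolding V(2) by metis
  have f0D: "f0 \<in> dom_max \<tau>" and f0bv: "bv FA f0 \<phi>a = 0" "bv FB f0 \<phi>b = 0" using f0(1) sep_dom_00 by auto
  define c where "c j = L2_inner M (L2_class M (u (cnj z) j)) F" for j
  \<comment> \<open>Green and the equation for \<open>u (cnj z) j\<close>, in which \<open>cnj z\<close> is conjugated back to \<open>z\<close>.\<close>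
  have c_bv: "c j = bv FB f0 (u (cnj z) j) - bv FA f0 (u (cnj z) j)" for j
  proof -
    let ?w = "u (cnj z) j"
    note wD = dom_maxD[OF ucD[of j]] and fD = dom_maxD[OF f0D]
    have "c j = weighted_int (\<lambda>x. cnj (?w x)) V" unfolding c_def V(2) by (rule L2_inner_class[OF wD(2) V(1)])
    also have "\<dots> = weighted_int (\<lambda>x. sl_apply \<tau> f0 x - z * f0 x) (\<lambda>x. cnj (?w x))"
      unfolding weighted_int_commute[of _ V]
      using f0(2) by (intro weighted_int_cong V(1) SQ_cnj wD fD SQ_diff SQ_cmult) (auto elim: eventually_mono)
    also have "\<dots> = weighted_int (\<lambda>x. cnj (?w x)) (sl_apply \<tau> f0) - z * weighted_int (\<lambda>x. cnj (?w x)) f0"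
      unfolding weighted_int_lin(2)[OF fD(3) SQ_cmult[OF fD(2)] SQ_cnj[OF wD(2)]] weighted_int_cmult
      by (simp add: weighted_int_commute)
    also have "z * weighted_int (\<lambda>x. cnj (?w x)) f0 = weighted_int (\<lambda>x. cnj (sl_apply \<tau> ?w x)) f0"
      unfolding weighted_int_cmult[symmetric]
      using solution_dom_max(2)[OF solc[of j]]
      by (intro weighted_int_cong SQ_cmult SQ_cnj wD fD) (auto elim: eventually_mono)
    finally show ?thesis using green_weighted[OF f0D ucD[of j]] by simp
  qed
  have c1: "c 1 = bv FB f0 \<psi>b" and c2: "c 2 = - bv FA f0 \<psi>a"
    unfolding c_bv bv_pluecker[OF FA_FB_ends(1) f0D ucD basis_facts(1,3,2,4,5)] bv_pluecker[OF FA_FB_ends(2) f0D ucD basis_facts(6,8,7,9,10)]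
    by (simp_all add: f0bv ubv)
  let ?R = "matrix_inv K"
  define e where "e k = ?R $ 1 $ k * c 1 + ?R $ 2 $ k * c 2" for k
  have inv_mult: "?R $ i $ 1 * K $ 1 $ k + ?R $ i $ 2 * K $ 2 $ k = (if i = k then 1 else 0)" for i k
  proof -
    have "K ** ?R = mat 1 \<and> ?R ** K = mat 1"
      unfolding matrix_inv_def using inv unfolding invertible_def by (rule someI_ex)
    then have "?R ** K = mat 1" ..
    then have "(?R ** K) $ i $ k = (mat 1 :: complex ^ 2 ^ 2) $ i $ k" by simp
    then show ?thesis by (simp add: matrix_matrix_mult_def mat_def sum_2)
  qed
  have Ke: "K $ 1 $ k * e 1 + K $ 2 $ k * e 2 = c k" for k
  proof -
    have "K $ 1 $ k * e 1 + K $ 2 $ k * e 2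
      = (?R $ 1 $ 1 * K $ 1 $ k + ?R $ 1 $ 2 * K $ 2 $ k) * c 1 + (?R $ 2 $ 1 * K $ 1 $ k + ?R $ 2 $ 2 * K $ 2 $ k) * c 2"
      by (simp add: e_def algebra_simps)
    also have "\<dots> = c k" unfolding inv_mult using exhaust_2[of k] by auto
    finally show ?thesis .
  qed
  define f where "f x = f0 x + ((- e 1) * u z 1 x + (- e 2) * u z 2 x)" for x
  note cf = comb[OF f0D, of _ _ "- e 1" "- e 2", folded f_def]
  have fD: "f \<in> dom_max \<tau>" by (rule cf(1)[OF FA_FB_ends(1) basis_facts(1)])
  have fbv: "bv FA f \<phi>a = - e 2" "bv FA f \<psi>a = - c 2 - e 1 * bv FA (u z 1) \<psi>a - e 2 * bv FA (u z 2) \<psi>a"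
    "bv FB f \<phi>b = - e 1" "bv FB f \<psi>b = c 1 - e 1 * bv FB (u z 1) \<psi>b - e 2 * bv FB (u z 2) \<psi>b"
    using cf(2)[OF FA_FB_ends(1) basis_facts(1)] cf(2)[OF FA_FB_ends(1) basis_facts(2)] cf(2)[OF FA_FB_ends(2) basis_facts(6)] cf(2)[OF FA_FB_ends(2) basis_facts(7)]
    by (simp_all add: ubv f0bv c1 c2)
  have fdom: "f \<in> sep_dom \<alpha> \<beta>"
    unfolding sep_dom_cot[OF \<alpha>\<beta>] fbv using fD Ke[of 1] Ke[of 2] unfolding K by (simp add: algebra_simps)
  have "AE x in lebesgue_on I. sl_apply \<tau> f x - z * f x = V x"
    using cf(3)[OF FA_FB_ends(1) basis_facts(1)] f0(2) by eventually_elim simp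
  then have "resolvent M (operator_of (sep_dom \<alpha> \<beta>)) z F = L2_class M f"
    unfolding V(2) by (rule resolventI[OF z1 sep_dom_sub fdom V(1)])
  moreover have "(\<lambda>x. \<Sum>j\<in>UNIV. \<Sum>k\<in>UNIV. ?R $ j $ k * c j * u z k x) = (\<lambda>x. e 1 * u z 1 x + e 2 * u z 2 x)"
    by (simp add: sum_2 e_def algebra_simps fun_eq_iff)
  moreover have "L2_diff M (L2_class M f0) (L2_class M (\<lambda>x. e 1 * u z 1 x + e 2 * u z 2 x)) = L2_class M f"
    by (subst L2_diff_class)
      (auto intro!: SQ_add SQ_cmult dom_maxD(2)[OF uD] dom_maxD(2)[OF f0D] simp: f_def[abs_def] algebra_simps)
  ultimately show "resolvent M (operator_of (sep_dom \<alpha> \<beta>)) z F =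
          L2_diff M (resolvent M (operator_of (sep_dom 0 0)) z F)
            (L2_class M (\<lambda>x. \<Sum>j\<in>UNIV. \<Sum>k\<in>UNIV.
               ?R $ j $ k * L2_inner M (L2_class M (u (cnj z) j)) F * u z k x))"
    unfolding f0(3) c_def[symmetric] by simp
qed

end

theorem theorem4p4:
  fixes \<tau> :: sl_expr
    and \<phi>a \<psi>a \<phi>b \<psi>b :: "real \<Rightarrow> complex"
    and \<alpha> \<beta> :: real
  defines "M \<equiv> weight \<tau>"
    and "T \<equiv> T_sep \<tau> \<phi>a \<psi>a \<phi>b \<psi>b"
    and "u \<equiv> sol_u \<tau> \<phi>a \<phi>b"
    and "K \<equiv> K_matrix \<tau> \<phi>a \<psi>a \<phi>b \<psi>b \<alpha> \<beta>"
  assumes "sturm_liouville \<tau>"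
    and "limit_circle_lower \<tau>" and "limit_circle_upper \<tau>"
    and "bc_basis_lower \<tau> \<phi>a \<psi>a" and "bc_basis_upper \<tau> \<phi>b \<psi>b"
    and "\<alpha> \<in> {0<..<pi}" and "\<beta> \<in> {0<..<pi}"
  shows "relatively_prime (T_min \<tau>) (T 0 0) (T \<alpha> \<beta>) \<and>
    (\<forall>z \<in> resolvent_set M (T 0 0) \<inter> resolvent_set M (T \<alpha> \<beta>).
       invertible (K z) \<and>
       (\<forall>F \<in> L2 M. resolvent M (T \<alpha> \<beta>) z F =
          L2_diff M (resolvent M (T 0 0) z F)
            (L2_class M (\<lambda>x. \<Sum>j\<in>UNIV. \<Sum>k\<in>UNIV.
               matrix_inv (K z) $ j $ k * L2_inner M (L2_class M (u (cnj z) j)) F * u z k x))))"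
proof -
  interpret sl_boundary_bases \<tau> \<phi>a \<psi>a \<phi>b \<psi>b
    by unfold_locales fact+
  have T: "T a b = operator_of (sep_dom a b)" for a b
    unfolding T_def by (rule T_sep_operator_of)
  show ?thesis
    unfolding T relatively_prime_def M_def u_def K_def
    using common_part_is_minimal[OF assms(10,11)] krein_formula[OF assms(10,11)] by blast
qed

end
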